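(* Let $\lambda\in\mathbb{K}$ and let $\mathcal{A}=\{\sum_{i=0}^n b_id_i: b_i\in\mathbb{Z}_{\geq 0}\}$ be the $\mathbb{Z}_{\geq0}$-span of all the $d_i$. Then $\gcd(d_0,\dots,d_n)=1$ and $\lambda\in(\mathbb{K}\setminus\mathbb{Z})\cup\mathcal{A}$ if and only if $\mathrm{Ker}\,\Gamma_\lambda$ is a zero category, i.e. the only objects $\mathcal{M}$ of $\mathcal{D}^\lambda_{[X]}\text{-Qcoh}$ with $\Gamma_\lambda(\mathcal{M})=0$ are the zero objects.
   Context: $\mathbb{K}$ is an algebraically closed field of characteristic zero; $n\geq1$ and $0<d_0\leq d_1\leq\dots\leq d_n$ are integers. $[X]=[\mathbb{P}(V)]=[(V\setminus\{0\})/\mathbb{G}_m]$ is the weighted projective stack, where $V=\mathbb{K}^{n+1}$ and $\mathbb{G}_m$ acts on the $i$-th coordinate vector with weight $d_i$. $\mathbb{A}=\mathbb{K}[x_0,\dots,x_n]$ is graded by $\deg x_i=d_i$, and $\mathbb{D}=\mathbb{K}\langle x_0,\dots,x_n,\partial_0,\dots,\partial_n\rangle$ is the Weyl algebra graded by $\deg x_i=d_i$, $\deg\partial_i=-d_i$, with Euler field $\mathbf{E}=\sum_id_ix_i\partial_i\in\mathbb{D}_0$. For a left $\mathbb{D}$-module $M$ and $\mu\in\mathbb{K}$ let $M^\mu=\{m\in M:\mathbf{E}m=\mu m\}$. $M$ is $\lambda$-Euler if $M=\bigoplus_{k\in\mathbb{Z}}M^{\lambda+k}$; it is then $\mathbb{Z}$-graded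 by $M_k=M^{\lambda+k}$. A graded $\mathbb{A}$-module $M$ is torsion if for every $m\in M$ there is $N$ with $\mathbb{A}_km=0$ for all $k>N$. $\mathbb{D}\text{-Grmod}^\lambda$ is the category of $\lambda$-Euler $\mathbb{D}$-modules and $\mathbb{D}\text{-Tors}^\lambda$ its full subcategory of modules that are torsion over $\mathbb{A}$. The category of twisted D-modules on $[X]$ is by definition $\mathcal{D}^\lambda_{[X]}\text{-Qcoh}=\mathbb{D}\text{-Grmod}^\lambda/\mathbb{D}\text{-Tors}^\lambda$. The quotient functor $\pi^\lambda_{\mathbb{D}}:\mathbb{D}\text{-Grmod}^\lambda\to\mathcal{D}^\lambda_{[X]}\text{-Qcoh}$ has a right adjoint $\omega^\lambda_{\mathbb{D}}$. Put $D^\lambda_{[X]}=\mathbb{D}/\mathbb{D}(\mathbf{E}-\lambda)$. Since $\mathbf{E}$ is central in $\mathbb{D}_0$, its degree zero part $(D^\lambda_{[X]})_0=\mathbb{D}_0/\mathbb{D}_0(\mathbf{E}-\lambda)$ is an algebra. The global sections functor $\Gamma_\lambda:\mathcal{D}^\lambda_{[X]}\text{-Qcoh}\to(D^\lambda_{[X]})_0\text{-Mod}$ is $\Gamma_\lambda(\mathcal{M})=\omega^\lambda_{\mathbb{D}}(\mathcal{M})_0=\omega^\lambda_{\mathbb{D}}(\mathcal{M})^\lambda$. $\mathrm{Ker}\,\Gamma_\lambda$ is the full subcategory of objects $\mathcal{M}$ with $\Gamma_\lambda(\mathcal{M})=0$. *)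

theory Defs
  imports "HOL-Algebra.QuotRing" "HOL-Algebra.Module" "HOL-Library.Poly_Mapping"
    "HOL-Computational_Algebra.Polynomial"
begin

section \<open>The Weyl algebra by generators and relations\<close>

text \<open>
  The free algebra is the monoid algebra of the free monoid; the list type is wrapped so that
  concatenation can be the addition that \<^typ>\<open>'a \<Rightarrow>\<^sub>0 'b\<close> convolves over.
\<close>

datatype 'a word = Word (letters: "'a list")

instantiation word :: (type) monoid_add
begin
definition zero_word :: "'a word" where "0 = Word []"
definition plus_word :: "'a word \<Rightarrow> 'a word \<Rightarrow> 'a word"
  where "u + v = Word (letters u @ letters v)"
instance by standard (simp_all add: zero_word_def plus_word_def)
end

datatype weyl_gen = Var nat | Der nat

fun gen_index :: "weyl_gen \<Rightarrow> nat" where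
  "gen_index (Var i) = i"
| "gen_index (Der i) = i"

type_synonym 'k free_alg = "weyl_gen word \<Rightarrow>\<^sub>0 'k"

definition free_algebra :: "nat \<Rightarrow> 'k::field free_alg ring" where
  "free_algebra n =
     \<lparr>carrier = {p. \<forall>w\<in>Poly_Mapping.keys p. \<forall>g\<in>set (letters w). gen_index g \<le> n},
      monoid.mult = (*), one = 1, ring.zero = 0, ring.add = (+)\<rparr>"

definition free_x :: "nat \<Rightarrow> 'k::field free_alg"
  where "free_x i = Poly_Mapping.single (Word [Var i]) 1"

definition free_d :: "nat \<Rightarrow> 'k::field free_alg"
  where "free_d i = Poly_Mapping.single (Word [Der i]) 1"

definition weyl_relations :: "nat \<Rightarrow> 'k::field free_alg set" where
  "weyl_relations n =
     {free_x i * free_x j - free_x j * free_x i | i j. i \<le> n \<and> j \<le> n}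
   \<union> {free_d i * free_d j - free_d j * free_d i | i j. i \<le> n \<and> j \<le> n}
   \<union> {free_d i * free_x j - free_x j * free_d i - (if i = j then 1 else 0) | i j. i \<le> n \<and> j \<le> n}"

definition weyl_ideal :: "nat \<Rightarrow> 'k::field free_alg set"
  where "weyl_ideal n = genideal (free_algebra n) (weyl_relations n)"

type_synonym 'k weyl_elt = "'k free_alg set"

definition weyl :: "nat \<Rightarrow> 'k::field weyl_elt ring"
  where "weyl n = free_algebra n Quot weyl_ideal n"

definition weyl_class :: "nat \<Rightarrow> 'k::field free_alg \<Rightarrow> 'k weyl_elt"
  where "weyl_class n p = weyl_ideal n +>\<^bsub>free_algebra n\<^esub> p"

definition weyl_scalar :: "nat \<Rightarrow> 'k::field \<Rightarrow> 'k weyl_elt"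
  where "weyl_scalar n c = weyl_class n (Poly_Mapping.single 0 c)"

definition euler_field :: "nat \<Rightarrow> (nat \<Rightarrow> nat) \<Rightarrow> 'k::field weyl_elt"
  where "euler_field n d = weyl_class n (\<Sum>i\<le>n. of_nat (d i) * free_x i * free_d i)"

fun gen_deg :: "(nat \<Rightarrow> nat) \<Rightarrow> weyl_gen \<Rightarrow> int" where
  "gen_deg d (Var i) = int (d i)"
| "gen_deg d (Der i) = - int (d i)"

definition word_deg :: "(nat \<Rightarrow> nat) \<Rightarrow> weyl_gen word \<Rightarrow> int"
  where "word_deg d w = sum_list (map (gen_deg d) (letters w))"

definition weyl_part :: "nat \<Rightarrow> (nat \<Rightarrow> nat) \<Rightarrow> int \<Rightarrow> 'k::field weyl_elt set" where
  "weyl_part n d k = weyl_class n `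
     {p \<in> carrier (free_algebra n). \<forall>w\<in>Poly_Mapping.keys p. word_deg d w = k}"

text \<open>The polynomial ring \<open>\<bbbA>\<close> is used as the subalgebra of the Weyl algebra generated by the
  variables; \<open>poly_part n d k\<close> is \<open>\<bbbA>\<close> in degree \<open>k\<close>.\<close>

definition poly_part :: "nat \<Rightarrow> (nat \<Rightarrow> nat) \<Rightarrow> int \<Rightarrow> 'k::field weyl_elt set" where
  "poly_part n d k = weyl_class n `
     {p \<in> carrier (free_algebra n).
        \<forall>w\<in>Poly_Mapping.keys p. set (letters w) \<subseteq> range Var \<and> word_deg d w = k}"


section \<open>Left modules over a not necessarily commutative ring\<close>

text \<open>The library's \<open>module\<close> locale requires a commutative ring; only its record type is reused.
  The \<open>mult\<close> and \<open>one\<close> fields of the \<open>module\<close> record carry no information here.\<close>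

locale left_module = R?: ring R + M?: abelian_group M
  for R :: "('a, 'c) ring_scheme" (structure) and M :: "('a, 'm) module" (structure) +
  assumes smult_closed:
      "\<lbrakk>a \<in> carrier R; x \<in> carrier M\<rbrakk> \<Longrightarrow> a \<odot>\<^bsub>M\<^esub> x \<in> carrier M"
    and smult_l_distr:
      "\<lbrakk>a \<in> carrier R; b \<in> carrier R; x \<in> carrier M\<rbrakk> \<Longrightarrow>
       (a \<oplus>\<^bsub>R\<^esub> b) \<odot>\<^bsub>M\<^esub> x = a \<odot>\<^bsub>M\<^esub> x \<oplus>\<^bsub>M\<^esub> b \<odot>\<^bsub>M\<^esub> x"
    and smult_r_distr:
      "\<lbrakk>a \<in> carrier R; x \<in> carrier M; y \<in> carrier M\<rbrakk> \<Longrightarrow>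
       a \<odot>\<^bsub>M\<^esub> (x \<oplus>\<^bsub>M\<^esub> y) = a \<odot>\<^bsub>M\<^esub> x \<oplus>\<^bsub>M\<^esub> a \<odot>\<^bsub>M\<^esub> y"
    and smult_assoc:
      "\<lbrakk>a \<in> carrier R; b \<in> carrier R; x \<in> carrier M\<rbrakk> \<Longrightarrow>
       (a \<otimes>\<^bsub>R\<^esub> b) \<odot>\<^bsub>M\<^esub> x = a \<odot>\<^bsub>M\<^esub> (b \<odot>\<^bsub>M\<^esub> x)"
    and smult_one: "x \<in> carrier M \<Longrightarrow> \<one>\<^bsub>R\<^esub> \<odot>\<^bsub>M\<^esub> x = x"

definition zero_module :: "('a, 'm) module \<Rightarrow> bool"
  where "zero_module M \<longleftrightarrow> carrier M = {\<zero>\<^bsub>M\<^esub>}"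

definition restrict_module :: "('a, 'm) module \<Rightarrow> 'm set \<Rightarrow> ('a, 'm) module"
  where "restrict_module M H = M\<lparr>carrier := H\<rparr>"

definition quot_module :: "('a, 'm) module \<Rightarrow> 'm set \<Rightarrow> ('a, 'm set) module" where
  "quot_module M H =
     \<lparr>carrier = a_rcosets\<^bsub>M\<^esub> H, monoid.mult = (\<lambda>_ _. H), one = H, ring.zero = H, ring.add = (<+>\<^bsub>M\<^esub>),
      module.smult = (\<lambda>a C. H <+>\<^bsub>M\<^esub> ((\<lambda>x. a \<odot>\<^bsub>M\<^esub> x) ` C))\<rparr>"

definition mod_hom :: "('a, 'c) ring_scheme \<Rightarrow> ('a, 'm) module \<Rightarrow> ('a, 'l) module \<Rightarrow> ('m \<Rightarrow> 'l) set"
  where "mod_hom R M N =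
    {f \<in> carrier M \<rightarrow>\<^sub>E carrier N.
       (\<forall>x\<in>carrier M. \<forall>y\<in>carrier M. f (x \<oplus>\<^bsub>M\<^esub> y) = f x \<oplus>\<^bsub>N\<^esub> f y) \<and>
       (\<forall>a\<in>carrier R. \<forall>x\<in>carrier M. f (a \<odot>\<^bsub>M\<^esub> x) = a \<odot>\<^bsub>N\<^esub> f x)}"


section \<open>Categories, functors, adjunctions\<close>

record ('o, 'a) category =
  Ob :: "'o set"
  Hom :: "'o \<Rightarrow> 'o \<Rightarrow> 'a set"
  Comp :: "'o \<Rightarrow> 'o \<Rightarrow> 'o \<Rightarrow> 'a \<Rightarrow> 'a \<Rightarrow> 'a"
  Ident :: "'o \<Rightarrow> 'a"

text \<open>Hom-sets need not be disjoint; \<open>Comp C A B E g f\<close> is \<open>g \<circ> f\<close> for \<open>f : A \<rightarrow> B\<close>, \<open>g : B \<rightarrow> E\<close>.\<close>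

definition full_subcat :: "('o, 'a) category \<Rightarrow> ('o \<Rightarrow> bool) \<Rightarrow> ('o, 'a) category"
  where "full_subcat C P = C\<lparr>Ob := {A \<in> Ob C. P A}\<rparr>"

definition zero_object :: "('o, 'a) category \<Rightarrow> 'o \<Rightarrow> bool" where
  "zero_object C Z \<longleftrightarrow> Z \<in> Ob C \<and>
     (\<forall>A\<in>Ob C. (\<exists>!f. f \<in> Hom C A Z) \<and> (\<exists>!f. f \<in> Hom C Z A))"

record ('o, 'a, 'p, 'b) cat_functor =
  fob :: "'o \<Rightarrow> 'p"
  fmor :: "'o \<Rightarrow> 'o \<Rightarrow> 'a \<Rightarrow> 'b"

locale is_functor =
  fixes C :: "('o, 'a) category" and D :: "('p, 'b) category"
    and F :: "('o, 'a, 'p, 'b) cat_functor"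
  assumes fob_in: "A \<in> Ob C \<Longrightarrow> fob F A \<in> Ob D"
    and fmor_in: "\<lbrakk>A \<in> Ob C; B \<in> Ob C; f \<in> Hom C A B\<rbrakk>
      \<Longrightarrow> fmor F A B f \<in> Hom D (fob F A) (fob F B)"
    and fmor_ident: "A \<in> Ob C \<Longrightarrow> fmor F A A (Ident C A) = Ident D (fob F A)"
    and fmor_comp: "\<lbrakk>A \<in> Ob C; B \<in> Ob C; E \<in> Ob C; f \<in> Hom C A B; g \<in> Hom C B E\<rbrakk>
      \<Longrightarrow> fmor F A E (Comp C A B E g f)
          = Comp D (fob F A) (fob F B) (fob F E) (fmor F B E g) (fmor F A B f)"

definition right_adjoint ::
  "('o, 'a) category \<Rightarrow> ('p, 'b) category \<Rightarrow> ('o, 'a, 'p, 'b) cat_functor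
     \<Rightarrow> ('p, 'b, 'o, 'a) cat_functor \<Rightarrow> bool" where
  "right_adjoint C D F G \<longleftrightarrow> is_functor C D F \<and> is_functor D C G \<and>
     (\<exists>\<phi> :: 'o \<Rightarrow> 'p \<Rightarrow> 'b \<Rightarrow> 'a.
        (\<forall>A\<in>Ob C. \<forall>B\<in>Ob D. bij_betw (\<phi> A B) (Hom D (fob F A) B) (Hom C A (fob G B))) \<and>
        (\<forall>A'\<in>Ob C. \<forall>A\<in>Ob C. \<forall>B\<in>Ob D. \<forall>f\<in>Hom C A' A. \<forall>h\<in>Hom D (fob F A) B.
           \<phi> A' B (Comp D (fob F A') (fob F A) B h (fmor F A' A f))
             = Comp C A' A (fob G B) (\<phi> A B h) f) \<and>
        (\<forall>A\<in>Ob C. \<forall>B\<in>Ob D. \<forall>B'\<in>Ob D. \<forall>g\<in>Hom D B B'. \<forall>h\<in>Hom D (fob F A) B.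
           \<phi> A B' (Comp D (fob F A) B B' g h)
             = Comp C A (fob G B) (fob G B') (fmor G B B' g) (\<phi> A B h)))"

definition LMod :: "('a, 'c) ring_scheme \<Rightarrow> (('a, 'm) module, 'm \<Rightarrow> 'm) category" where
  "LMod R = \<lparr>Ob = {M. left_module R M}, Hom = mod_hom R,
     Comp = (\<lambda>L M N g f. compose (carrier L) g f),
     Ident = (\<lambda>M. \<lambda>x\<in>carrier M. x)\<rparr>"


section \<open>Euler modules and torsion\<close>

definition eigenspace ::
  "nat \<Rightarrow> (nat \<Rightarrow> nat) \<Rightarrow> ('k::field weyl_elt, 'm) module \<Rightarrow> 'k \<Rightarrow> 'm set" where
  "eigenspace n d M \<mu> = {m \<in> carrier M. euler_field n d \<odot>\<^bsub>M\<^esub> m = weyl_scalar n \<mu> \<odot>\<^bsub>M\<^esub> m}"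

definition euler_module ::
  "nat \<Rightarrow> (nat \<Rightarrow> nat) \<Rightarrow> 'k::field \<Rightarrow> ('k weyl_elt, 'm) module \<Rightarrow> bool" where
  "euler_module n d lam M \<longleftrightarrow> left_module (weyl n) M \<and>
     (\<forall>m\<in>carrier M. \<exists>!c :: int \<Rightarrow> 'm.
        (\<forall>k. c k \<in> eigenspace n d M (lam + of_int k)) \<and>
        finite {k. c k \<noteq> \<zero>\<^bsub>M\<^esub>} \<and>
        m = (\<Oplus>\<^bsub>M\<^esub>k\<in>{k. c k \<noteq> \<zero>\<^bsub>M\<^esub>}. c k))"

definition torsion ::
  "nat \<Rightarrow> (nat \<Rightarrow> nat) \<Rightarrow> ('k::field weyl_elt, 'm) module \<Rightarrow> bool" where
  "torsion n d M \<longleftrightarrow>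
     (\<forall>m\<in>carrier M. \<exists>N::int. \<forall>k>N. \<forall>a\<in>poly_part n d k. a \<odot>\<^bsub>M\<^esub> m = \<zero>\<^bsub>M\<^esub>)"

definition torsion_euler_module ::
  "nat \<Rightarrow> (nat \<Rightarrow> nat) \<Rightarrow> 'k::field \<Rightarrow> ('k weyl_elt, 'm) module \<Rightarrow> bool" where
  "torsion_euler_module n d lam M \<longleftrightarrow> euler_module n d lam M \<and> torsion n d M"

text \<open>
  The type \<open>'m\<close> is the universe: objects are the modules carried by subsets of \<open>'m\<close>. As soon as
  \<open>'k\<close> injects into \<open>'m\<close>, this category contains \<open>\<bbbD>/\<bbbD>(E - \<lambda>)\<close> up to isomorphism, and it
  is large enough for the right adjoint of the quotient functor: \<open>\<omega>\<pi>M\<close> is a countable union of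
  images of sets \<open>Hom(I, M/t(M))\<close> for the torsion submodule \<open>t(M)\<close> of \<open>M\<close> and finitely generated
  graded ideals \<open>I\<close> of \<open>\<bbbA>\<close>.
\<close>

definition DGrmod ::
  "nat \<Rightarrow> (nat \<Rightarrow> nat) \<Rightarrow> 'k::field \<Rightarrow> (('k weyl_elt, 'm) module, 'm \<Rightarrow> 'm) category" where
  "DGrmod n d lam = full_subcat (LMod (weyl n)) (euler_module n d lam)"


section \<open>The quotient category of twisted D-modules\<close>

text \<open>
  This is the Serre quotient in Gabriel's form: morphisms from \<open>M\<close> to \<open>N\<close> are
  the elements of the filtered colimit of \<open>Hom(M', N/N')\<close> over the submodules \<open>M'\<close> of \<open>M\<close> with
  torsion cokernel and the torsion submodules \<open>N'\<close> of \<open>N\<close>. An element of the colimit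
  is an equivalence class of triples \<open>(M', N', f)\<close>.
\<close>

type_synonym 'm roof = "'m set \<times> 'm set \<times> ('m \<Rightarrow> 'm set)"

definition roof_index ::
  "nat \<Rightarrow> (nat \<Rightarrow> nat) \<Rightarrow> 'k::field \<Rightarrow> ('k weyl_elt, 'm) module \<Rightarrow> ('k weyl_elt, 'm) module
     \<Rightarrow> ('m set \<times> 'm set) set" where
  "roof_index n d lam M N = {(M', N').
     submodule M' (weyl n) M \<and> torsion_euler_module n d lam (quot_module M M') \<and>
     submodule N' (weyl n) N \<and> torsion_euler_module n d lam (restrict_module N N')}"

definition roofs ::
  "nat \<Rightarrow> (nat \<Rightarrow> nat) \<Rightarrow> 'k::field \<Rightarrow> ('k weyl_elt, 'm) module \<Rightarrow> ('k weyl_elt, 'm) module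
     \<Rightarrow> 'm roof set" where
  "roofs n d lam M N = {(M', N', f). (M', N') \<in> roof_index n d lam M N \<and>
     f \<in> mod_hom (weyl n) (restrict_module M M') (quot_module N N')}"

text \<open>For \<open>N' \<subseteq> N''\<close> the projection \<open>N/N' \<rightarrow> N/N''\<close> sends a coset \<open>C\<close> to \<open>N'' + C\<close>.\<close>

definition roof_rel ::
  "nat \<Rightarrow> (nat \<Rightarrow> nat) \<Rightarrow> 'k::field \<Rightarrow> ('k weyl_elt, 'm) module \<Rightarrow> ('k weyl_elt, 'm) module
     \<Rightarrow> 'm roof rel" where
  "roof_rel n d lam M N =
     {((M1, N1, f1), (M2, N2, f2)).
        (M1, N1, f1) \<in> roofs n d lam M N \<and> (M2, N2, f2) \<in> roofs n d lam M N \<and>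
        (\<exists>(M3, N3) \<in> roof_index n d lam M N. M3 \<subseteq> M1 \<inter> M2 \<and> N1 \<union> N2 \<subseteq> N3 \<and>
           (\<forall>m\<in>M3. N3 <+>\<^bsub>N\<^esub> f1 m = N3 <+>\<^bsub>N\<^esub> f2 m))}"

text \<open>
  The composite of \<open>f : L' \<rightarrow> M/M'\<close> and \<open>g : M'' \<rightarrow> N/N'\<close> is defined on
  \<open>L'' = f\<^sup>-\<^sup>1((M' + M'')/M')\<close> with values in \<open>N/N''\<close>, where \<open>N''/N' = g(M' \<inter> M'')\<close>, through
  \<open>(M' + M'')/M' \<cong> M''/(M' \<inter> M'') \<rightarrow> N/N''\<close>. Cosets being sets, \<open>N''\<close> and the composite are unions
  of values of \<open>g\<close>.
\<close>

fun roof_comp :: "'m roof \<Rightarrow> 'm roof \<Rightarrow> 'm roof" where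
  "roof_comp (M'', N', g) (L', M', f) =
     (let L'' = {l \<in> L'. f l \<inter> M'' \<noteq> {}}
      in (L'', \<Union>m\<in>M' \<inter> M''. g m, \<lambda>l\<in>L''. \<Union>m\<in>f l \<inter> M''. g m))"

definition DQcoh ::
  "nat \<Rightarrow> (nat \<Rightarrow> nat) \<Rightarrow> 'k::field \<Rightarrow> (('k weyl_elt, 'm) module, 'm roof set) category" where
  "DQcoh n d lam =
     \<lparr>Ob = Ob (DGrmod n d lam),
      Hom = (\<lambda>M N. roofs n d lam M N // roof_rel n d lam M N),
      Comp = (\<lambda>L M N G F. \<Union>g\<in>G. \<Union>f\<in>F. roof_rel n d lam L N `` {roof_comp g f}),
      Ident = (\<lambda>M. roof_rel n d lam M M `` {(carrier M, {\<zero>\<^bsub>M\<^esub>}, \<lambda>m\<in>carrier M. {m})})\<rparr>"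

definition quot_functor ::
  "nat \<Rightarrow> (nat \<Rightarrow> nat) \<Rightarrow> 'k::field
     \<Rightarrow> (('k weyl_elt, 'm) module, 'm \<Rightarrow> 'm, ('k weyl_elt, 'm) module, 'm roof set) cat_functor" where
  "quot_functor n d lam =
     \<lparr>fob = (\<lambda>M. M),
      fmor = (\<lambda>M N f. roof_rel n d lam M N `` {(carrier M, {\<zero>\<^bsub>N\<^esub>}, \<lambda>m\<in>carrier M. {f m})})\<rparr>"


section \<open>Global sections\<close>

text \<open>\<open>\<bbbD>\<^sub>0\<close> and its quotient by the (two-sided, as \<open>E\<close> is central in \<open>\<bbbD>\<^sub>0\<close>) ideal \<open>\<bbbD>\<^sub>0(E - \<lambda>)\<close>.\<close>

definition weyl0 :: "nat \<Rightarrow> (nat \<Rightarrow> nat) \<Rightarrow> 'k::field weyl_elt ring"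
  where "weyl0 n d = (weyl n)\<lparr>carrier := weyl_part n d 0\<rparr>"

definition twisted_ring0 :: "nat \<Rightarrow> (nat \<Rightarrow> nat) \<Rightarrow> 'k::field \<Rightarrow> 'k weyl_elt set ring" where
  "twisted_ring0 n d lam = weyl0 n d Quot
     {a \<otimes>\<^bsub>weyl n\<^esub> (euler_field n d \<ominus>\<^bsub>weyl n\<^esub> weyl_scalar n lam) | a. a \<in> weyl_part n d 0}"

text \<open>A coset acts on the \<open>\<lambda>\<close>-eigenspace by the common action of its representatives.\<close>

definition eigenspace_module ::
  "nat \<Rightarrow> (nat \<Rightarrow> nat) \<Rightarrow> 'k::field \<Rightarrow> ('k weyl_elt, 'm) module \<Rightarrow> ('k weyl_elt set, 'm) module"
  where
  "eigenspace_module n d lam M =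
     \<lparr>carrier = eigenspace n d M lam, monoid.mult = monoid.mult M, one = one M, ring.zero = \<zero>\<^bsub>M\<^esub>, ring.add = ring.add M,
      module.smult = (\<lambda>C m. the_elem ((\<lambda>a. a \<odot>\<^bsub>M\<^esub> m) ` C))\<rparr>"

text \<open>The functor \<open>\<Gamma>\<^sub>\<lambda>\<close> from \<^const>\<open>DQcoh\<close> to \<^const>\<open>LMod\<close> of \<^const>\<open>twisted_ring0\<close>, for a given right
  adjoint \<open>\<omega>\<close> of the quotient functor.\<close>

definition global_sections ::
  "nat \<Rightarrow> (nat \<Rightarrow> nat) \<Rightarrow> 'k::field
     \<Rightarrow> (('k weyl_elt, 'm) module, 'm roof set, ('k weyl_elt, 'm) module, 'm \<Rightarrow> 'm) cat_functor
     \<Rightarrow> (('k weyl_elt, 'm) module, 'm roof set, ('k weyl_elt set, 'm) module, 'm \<Rightarrow> 'm) cat_functor"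
  where
  "global_sections n d lam \<omega> =
     \<lparr>fob = (\<lambda>A. eigenspace_module n d lam (fob \<omega> A)),
      fmor = (\<lambda>A B f. restrict (fmor \<omega> A B f) (eigenspace n d (fob \<omega> A) lam))\<rparr>"

definition ker_global_sections ::
  "nat \<Rightarrow> (nat \<Rightarrow> nat) \<Rightarrow> 'k::field
     \<Rightarrow> (('k weyl_elt, 'm) module, 'm roof set, ('k weyl_elt, 'm) module, 'm \<Rightarrow> 'm) cat_functor
     \<Rightarrow> (('k weyl_elt, 'm) module, 'm roof set) category"
  where
  "ker_global_sections n d lam \<omega> =
     full_subcat (DQcoh n d lam) (\<lambda>A. zero_module (fob (global_sections n d lam \<omega>) A))"

definition weight_span :: "nat \<Rightarrow> (nat \<Rightarrow> nat) \<Rightarrow> int set"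
  where "weight_span n d = {\<Sum>i\<le>n. int (b i * d i) | b :: nat \<Rightarrow> nat. True}"

end

theory Submission
  imports Defs "HOL-Library.Countable"
begin

text \<open>
  Only the bijections \<open>Hom(\<pi>A, B) \<cong> Hom(A, \<omega>B)\<close> are used, in the form: one side is a singleton
  iff the other is. An object is zero in the quotient category iff it is torsion, and torsion means
  that each element is killed by a power of each \<open>x\<^sub>i\<close>.

  Suppose that the arithmetic conditions hold and that \<open>N = \<omega>M\<close> has \<open>N\<^sub>0 = 0\<close>. Testing against the
  torsion submodule of \<open>N\<close> shows that \<open>N\<close> is torsion-free. Let \<open>L = \<Prod> d\<^sub>i\<close> and \<open>c \<ge> 0\<close>. Elements
  of degree \<open>-cL\<close> are killed by all \<open>x\<^sub>i\<^bsup>cL/d\<^sub>i\<^esup>\<close>, so they vanish. Elements of degree \<open>cL\<close> are killed by all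
  \<open>\<partial>\<^sub>i\<^bsup>cL/d\<^sub>i\<^esup>\<close>, so a nonzero one yields \<open>v \<noteq> 0\<close> with \<open>\<partial>\<^sub>i v = 0\<close> for all \<open>i\<close>. Then \<open>E v = 0\<close>, hence
  \<open>\<lambda> \<in> \<int>\<close>, say \<open>\<lambda> = \<Sum> b\<^sub>i d\<^sub>i\<close>, and \<open>x\<^sup>b v\<close> is a nonzero element of \<open>N\<^sub>0\<close>, a contradiction. Any nonzero
  element can be moved to a degree divisible by \<open>L\<close>: the gcd condition supplies \<open>z\<close> such that
  \<open>\<Sum> z\<^sub>i d\<^sub>i\<close> is the required shift, and for each \<open>i\<close> in turn one of \<open>x\<^sub>i\<^bsup>z\<^sub>i mod L\<^esup>\<close> and \<open>\<partial>\<^sub>i\<^bsup>-z\<^sub>i mod L\<^esup>\<close> does not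
  kill it. So \<open>N = 0\<close>, the only endomorphism of \<open>\<pi>M\<close> is zero, and \<open>M\<close> is torsion.

  Conversely, if \<open>\<lambda> \<in> \<int> - \<A>\<close> then the polynomial ring, which vanishes in degree \<open>\<lambda>\<close>, is a nonzero object
  without global sections; if the gcd is not \<open>1\<close>, the Laurent polynomials times \<open>x\<^sub>0\<^bsup>(\<lambda>+1)/d\<^sub>0\<^esup>\<close> are
  such an object, as their Euler eigenvalues are \<open>\<lambda> + 1\<close> modulo the gcd.
\<close>

section \<open>The Weyl algebra\<close>

lemma carrier_free_algebra:
  "carrier (free_algebra n) = {p. \<forall>w\<in>Poly_Mapping.keys p. \<forall>g\<in>set (letters w). gen_index g \<le> n}"
  and mult_free_algebra [simp]: "monoid.mult (free_algebra n) = (*)"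
  and one_free_algebra [simp]: "\<one>\<^bsub>free_algebra n\<^esub> = 1"
  and zero_free_algebra [simp]: "\<zero>\<^bsub>free_algebra n\<^esub> = 0"
  and add_free_algebra [simp]: "ring.add (free_algebra n) = (+)"
  by (simp_all add: free_algebra_def)

lemma letters_plus [simp]: "letters (u + v) = letters u @ letters v"
  by (simp add: plus_word_def)

lemma letters_zero [simp]: "letters 0 = []"
  by (simp add: zero_word_def)

lemma free_algebra_zero: "0 \<in> carrier (free_algebra n)"
  and free_algebra_one: "1 \<in> carrier (free_algebra n)"
  by (auto simp: carrier_free_algebra)

lemma free_algebra_single:
  "(\<And>g. g \<in> set (letters w) \<Longrightarrow> gen_index g \<le> n) \<Longrightarrow> Poly_Mapping.single w c \<in> carrier (free_algebra n)"
  by (auto simp: carrier_free_algebra)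

lemma free_algebra_add:
  assumes "p \<in> carrier (free_algebra n)" "q \<in> carrier (free_algebra n)"
  shows "p + q \<in> carrier (free_algebra n)"
  using assms keys_add[of p q] unfolding carrier_free_algebra by blast

lemma free_algebra_mult:
  assumes "p \<in> carrier (free_algebra n)" "q \<in> carrier (free_algebra n)"
  shows "p * q \<in> carrier (free_algebra n)"
proof -
  have "\<forall>g\<in>set (letters w). gen_index g \<le> n" if "w \<in> Poly_Mapping.keys (p * q)" for w
  proof -
    obtain u v where "w = u + v" "u \<in> Poly_Mapping.keys p" "v \<in> Poly_Mapping.keys q"
      using keys_mult[of p q] \<open>w \<in> Poly_Mapping.keys (p * q)\<close> by auto
    then show ?thesis using assms unfolding carrier_free_algebra by auto
  qed
  then show ?thesis unfolding carrier_free_algebra by blast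
qed

lemma free_algebra_uminus:
  "p \<in> carrier (free_algebra n) \<Longrightarrow> - p \<in> carrier (free_algebra n)"
  by (auto simp: carrier_free_algebra in_keys_iff)

lemma free_algebra_diff:
  "p \<in> carrier (free_algebra n) \<Longrightarrow> q \<in> carrier (free_algebra n) \<Longrightarrow> p - q \<in> carrier (free_algebra n)"
  using free_algebra_add[of p n "- q"] free_algebra_uminus by auto

lemma free_algebra_sum:
  "(\<And>i. i \<in> I \<Longrightarrow> p i \<in> carrier (free_algebra n)) \<Longrightarrow> sum p I \<in> carrier (free_algebra n)"
  by (induction I rule: infinite_finite_induct) (auto simp: free_algebra_zero free_algebra_add)

lemma free_x_closed: "i \<le> n \<Longrightarrow> free_x i \<in> carrier (free_algebra n)"
  and free_d_closed: "i \<le> n \<Longrightarrow> free_d i \<in> carrier (free_algebra n)"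
  and free_scalar_closed: "Poly_Mapping.single 0 c \<in> carrier (free_algebra n)"
  unfolding free_x_def free_d_def by (auto intro!: free_algebra_single)

lemmas free_algebra_closed =
  free_algebra_zero free_algebra_one free_algebra_add free_algebra_mult free_algebra_uminus
  free_algebra_diff free_algebra_sum free_x_closed free_d_closed free_scalar_closed

lemma free_algebra_ring: "ring (free_algebra n)"
proof (rule ringI)
  show "abelian_group (free_algebra n)"
  proof (rule abelian_groupI)
    fix x assume "x \<in> carrier (free_algebra n)"
    then show "\<exists>y\<in>carrier (free_algebra n). y \<oplus>\<^bsub>free_algebra n\<^esub> x = \<zero>\<^bsub>free_algebra n\<^esub>"
      by (intro bexI[of _ "- x"]) (auto intro: free_algebra_closed)
  qed (auto simp: algebra_simps intro: free_algebra_closed)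
  show "Group.monoid (free_algebra n)"
    by (rule monoidI) (auto simp: algebra_simps intro: free_algebra_closed)
qed (auto simp: algebra_simps)

lemma free_algebra_a_inv:
  assumes "p \<in> carrier (free_algebra n)"
  shows "\<ominus>\<^bsub>free_algebra n\<^esub> p = - p"
proof -
  interpret ring "free_algebra n" by (rule free_algebra_ring)
  show ?thesis
    using assms minus_equality[of "- p" p] free_algebra_uminus[OF assms] by simp
qed

section \<open>The quotient by the Weyl relations and its class map\<close>

lemma weyl_relations_closed: "weyl_relations n \<subseteq> carrier (free_algebra n)"
  unfolding weyl_relations_def by (auto intro!: free_algebra_closed)

lemma weyl_ideal_ideal: "ideal (weyl_ideal n) (free_algebra n)"
  unfolding weyl_ideal_def
  by (rule ring.genideal_ideal[OF free_algebra_ring weyl_relations_closed])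

lemma weyl_ring: "ring (weyl n)"
  unfolding weyl_def by (rule ideal.quotient_is_ring[OF weyl_ideal_ideal])

lemma weyl_class_hom: "ring_hom_ring (free_algebra n) (weyl n) (weyl_class n)"
  unfolding weyl_def weyl_class_def[abs_def]
  by (rule ideal.rcos_ring_hom_ring[OF weyl_ideal_ideal])

lemma carrier_weyl: "carrier (weyl n) = weyl_class n ` carrier (free_algebra n)"
  unfolding weyl_def weyl_class_def FactRing_def A_RCOSETS_def' by auto

context
  fixes n :: nat
begin

interpretation h: ring_hom_ring "free_algebra n" "weyl n" "weyl_class n"
  by (rule weyl_class_hom)

lemma weyl_class_closed: "p \<in> carrier (free_algebra n) \<Longrightarrow> weyl_class n p \<in> carrier (weyl n)"
  by (rule h.hom_closed)

lemma weyl_class_add: "p \<in> carrier (free_algebra n) \<Longrightarrow> q \<in> carrier (free_algebra n) \<Longrightarrow>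
    weyl_class n (p + q) = weyl_class n p \<oplus>\<^bsub>weyl n\<^esub> weyl_class n q"
  using h.hom_add[of p q] by simp

lemma weyl_class_mult: "p \<in> carrier (free_algebra n) \<Longrightarrow> q \<in> carrier (free_algebra n) \<Longrightarrow>
    weyl_class n (p * q) = weyl_class n p \<otimes>\<^bsub>weyl n\<^esub> weyl_class n q"
  using h.hom_mult[of p q] by simp

lemma weyl_class_zero: "weyl_class n 0 = \<zero>\<^bsub>weyl n\<^esub>"
  using h.hom_zero by simp

lemma weyl_class_one: "weyl_class n 1 = \<one>\<^bsub>weyl n\<^esub>"
  using h.hom_one by simp

lemma weyl_class_diff_eq_zero:
  assumes "p \<in> carrier (free_algebra n)" "q \<in> carrier (free_algebra n)" "p - q \<in> weyl_ideal n"
  shows "weyl_class n p = weyl_class n q"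
proof -
  interpret I: ideal "weyl_ideal n" "free_algebra n" by (rule weyl_ideal_ideal)
  have "p \<in> weyl_ideal n +>\<^bsub>free_algebra n\<^esub> q"
    using assms unfolding a_r_coset_def r_coset_def by (auto intro!: bexI[of _ "p - q"])
  from I.a_repr_independence'[OF this assms(2)] show ?thesis
    unfolding weyl_class_def by simp
qed

lemma weyl_class_relation:
  assumes "p \<in> carrier (free_algebra n)" "q \<in> carrier (free_algebra n)" "p - q \<in> weyl_relations n"
  shows "weyl_class n p = weyl_class n q"
  using assms weyl_class_diff_eq_zero
    ring.genideal_self[OF free_algebra_ring weyl_relations_closed] unfolding weyl_ideal_def by blast

end

section \<open>Generators, commutation relations and induction over the Weyl algebra\<close>

definition weyl_x :: "nat \<Rightarrow> nat \<Rightarrow> 'k::field weyl_elt" where "weyl_x n i = weyl_class n (free_x i)"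
definition weyl_d :: "nat \<Rightarrow> nat \<Rightarrow> 'k::field weyl_elt" where "weyl_d n i = weyl_class n (free_d i)"

lemma weyl_x_closed: "i \<le> n \<Longrightarrow> weyl_x n i \<in> carrier (weyl n)"
  and weyl_d_closed: "i \<le> n \<Longrightarrow> weyl_d n i \<in> carrier (weyl n)"
  and weyl_scalar_closed: "weyl_scalar n c \<in> carrier (weyl n)"
  unfolding weyl_x_def weyl_d_def weyl_scalar_def by (auto intro: weyl_class_closed free_algebra_closed)

text \<open>Reduces additive identities in a monoid algebra to monomials. The zero mapping is
  covered by \<open>Poly_Mapping.single a 0\<close>.\<close>

lemma poly_mapping_add_induct [case_names single add]:
  fixes p :: "'a \<Rightarrow>\<^sub>0 'b::comm_monoid_add"
  assumes single: "\<And>a b. P (Poly_Mapping.single a b)"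
    and add: "\<And>p q. P p \<Longrightarrow> P q \<Longrightarrow> P (p + q)"
  shows "P p"
proof (induction p rule: update_induct)
  case const
  show ?case using single[of _ 0] by simp
next
  case (update p a b)
  have "Poly_Mapping.update a b p = p + Poly_Mapping.single a b"
    using update(1) by (intro poly_mapping_eqI)
      (auto simp: lookup_update lookup_add lookup_single in_keys_iff)
  then show ?case using update(3) single add by simp
qed

lemma single_mult_scalar:
  fixes p :: "'a::monoid_add \<Rightarrow>\<^sub>0 'b::comm_semiring_1"
  shows "Poly_Mapping.single 0 c * p = p * Poly_Mapping.single 0 c"
  by (induction p rule: poly_mapping_add_induct)
    (simp_all add: mult_single mult.commute distrib_left distrib_right)

lemma weyl_scalar_mult: "weyl_scalar n (a * b) = weyl_scalar n a \<otimes>\<^bsub>weyl n\<^esub> weyl_scalar n b"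
  unfolding weyl_scalar_def
  by (subst weyl_class_mult[symmetric]) (auto intro: free_algebra_closed simp: mult_single)

lemma weyl_scalar_add: "weyl_scalar n (a + b) = weyl_scalar n a \<oplus>\<^bsub>weyl n\<^esub> weyl_scalar n b"
  unfolding weyl_scalar_def
  by (subst weyl_class_add[symmetric]) (auto intro: free_algebra_closed simp: single_add)

lemma weyl_scalar_0: "weyl_scalar n 0 = \<zero>\<^bsub>weyl n\<^esub>"
  unfolding weyl_scalar_def by (simp add: weyl_class_zero)

lemma weyl_scalar_1: "weyl_scalar n 1 = \<one>\<^bsub>weyl n\<^esub>"
  unfolding weyl_scalar_def by (simp add: weyl_class_one)

lemma weyl_scalar_commute:
  assumes "a \<in> carrier (weyl n)"
  shows "weyl_scalar n c \<otimes>\<^bsub>weyl n\<^esub> a = a \<otimes>\<^bsub>weyl n\<^esub> weyl_scalar n c"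
proof -
  obtain p where "p \<in> carrier (free_algebra n)" "a = weyl_class n p"
    using assms unfolding carrier_weyl by blast
  then show ?thesis unfolding weyl_scalar_def
    by (simp add: free_scalar_closed single_mult_scalar flip: weyl_class_mult)
qed

lemma weyl_x_commute: "i \<le> n \<Longrightarrow> j \<le> n \<Longrightarrow>
    weyl_x n i \<otimes>\<^bsub>weyl n\<^esub> weyl_x n j = weyl_x n j \<otimes>\<^bsub>weyl n\<^esub> weyl_x n i"
  unfolding weyl_x_def weyl_class_mult[symmetric, OF free_x_closed free_x_closed]
  by (rule weyl_class_relation) (auto intro: free_algebra_closed simp: weyl_relations_def)

lemma weyl_d_commute: "i \<le> n \<Longrightarrow> j \<le> n \<Longrightarrow>
    weyl_d n i \<otimes>\<^bsub>weyl n\<^esub> weyl_d n j = weyl_d n j \<otimes>\<^bsub>weyl n\<^esub> weyl_d n i"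
  unfolding weyl_d_def weyl_class_mult[symmetric, OF free_d_closed free_d_closed]
  by (rule weyl_class_relation) (auto intro: free_algebra_closed simp: weyl_relations_def)

lemma weyl_d_x:
  fixes n :: nat
  assumes "i \<le> n" "j \<le> n"
  shows "weyl_d n i \<otimes>\<^bsub>weyl n\<^esub> (weyl_x n j :: 'k::field weyl_elt) =
    weyl_x n j \<otimes>\<^bsub>weyl n\<^esub> weyl_d n i \<oplus>\<^bsub>weyl n\<^esub> (if i = j then \<one>\<^bsub>weyl n\<^esub> else \<zero>\<^bsub>weyl n\<^esub>)"
proof -
  define e :: "'k free_alg" where "e = (if i = j then 1 else 0)"
  have e: "e \<in> carrier (free_algebra n)"
    by (simp add: e_def free_algebra_zero free_algebra_one)
  have "free_d i * free_x j - (free_x j * free_d i + e) \<in> weyl_relations n"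
    using assms unfolding weyl_relations_def diff_diff_eq[symmetric] e_def by blast
  then have "weyl_class n (free_d i * free_x j) = weyl_class n (free_x j * free_d i + e)"
    using assms by (intro weyl_class_relation) (simp_all add: free_algebra_closed e)
  moreover have "weyl_class n e = (if i = j then \<one>\<^bsub>weyl n\<^esub> else \<zero>\<^bsub>weyl n\<^esub>)"
    by (simp add: e_def weyl_class_one weyl_class_zero)
  ultimately show ?thesis using assms unfolding weyl_x_def weyl_d_def
    by (simp add: weyl_class_add weyl_class_mult free_algebra_closed e)
qed

lemma poly_mapping_sum_singles:
  "p = (\<Sum>w\<in>Poly_Mapping.keys p. Poly_Mapping.single w (Poly_Mapping.lookup p w))"
  by (rule poly_mapping_eqI) (auto simp: lookup_sum lookup_single when_def in_keys_iff)

text \<open>The monomial case ranges only over the words in the support of \<open>p\<close>, so that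
  a condition on these words, such as having large degree, is available there.\<close>

lemma weyl_class_induct:
  fixes P :: "'k::field weyl_elt \<Rightarrow> bool"
  assumes p: "p \<in> carrier (free_algebra n)"
    and single: "\<And>w c. w \<in> Poly_Mapping.keys p \<Longrightarrow> P (weyl_class n (Poly_Mapping.single w c))"
    and zero: "P \<zero>\<^bsub>weyl n\<^esub>"
    and add: "\<And>a b. \<lbrakk>a \<in> carrier (weyl n); b \<in> carrier (weyl n); P a; P b\<rbrakk> \<Longrightarrow> P (a \<oplus>\<^bsub>weyl n\<^esub> b)"
  shows "P (weyl_class n p)"
proof -
  have cl: "Poly_Mapping.single w c \<in> carrier (free_algebra n)"
    if "w \<in> Poly_Mapping.keys p" for w and c :: 'k
    using p that by (intro free_algebra_single) (auto simp: carrier_free_algebra)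
  have "P (weyl_class n (\<Sum>w\<in>I. Poly_Mapping.single w (Poly_Mapping.lookup p w)))"
    if "finite I" "I \<subseteq> Poly_Mapping.keys p" for I
    using that
  proof (induction I rule: finite_induct)
    case (insert w I)
    then show ?case
      by (auto simp: weyl_class_add cl free_algebra_sum subset_iff
          intro!: add single weyl_class_closed free_algebra_sum cl)
  qed (simp add: weyl_class_zero zero)
  from this[OF finite_keys subset_refl] show ?thesis
    by (simp flip: poly_mapping_sum_singles)
qed

lemma single_Word_Cons:
  fixes c :: "'k::field"
  shows "Poly_Mapping.single (Word (g # w)) c = 
    Poly_Mapping.single (Word [g]) 1 * Poly_Mapping.single (Word w) c"
  by (simp add: mult_single plus_word_def)

text \<open>Every class is a sum of scalar multiples of words in the generators. It follows that
  stability of a subset under the whole Weyl algebra can be tested on scalars, variables and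
  derivations.\<close>

lemma weyl_induct [consumes 1, case_names scalar x d add mult]:
  fixes P :: "'k::field weyl_elt \<Rightarrow> bool"
  assumes a: "a \<in> carrier (weyl n)"
    and scalar: "\<And>c. P (weyl_scalar n c)"
    and x: "\<And>i. i \<le> n \<Longrightarrow> P (weyl_x n i)"
    and d: "\<And>i. i \<le> n \<Longrightarrow> P (weyl_d n i)"
    and add: "\<And>a b. \<lbrakk>a \<in> carrier (weyl n); b \<in> carrier (weyl n); P a; P b\<rbrakk> \<Longrightarrow> P (a \<oplus>\<^bsub>weyl n\<^esub> b)"
    and mult: "\<And>a b. \<lbrakk>a \<in> carrier (weyl n); b \<in> carrier (weyl n); P a; P b\<rbrakk> \<Longrightarrow> P (a \<otimes>\<^bsub>weyl n\<^esub> b)"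
  shows "P a"
proof -
  have word: "P (weyl_class n (Poly_Mapping.single (Word w) c))"
    if "\<forall>g\<in>set w. gen_index g \<le> n" for w c
    using that
  proof (induction w)
    case Nil
    then show ?case using scalar[of c] by (simp add: weyl_scalar_def zero_word_def)
  next
    case (Cons g w)
    have cl: "Poly_Mapping.single (Word [g]) (1::'k) \<in> carrier (free_algebra n)"
      "Poly_Mapping.single (Word w) c \<in> carrier (free_algebra n)"
      using Cons.prems by (auto intro!: free_algebra_single)
    have "P (weyl_class n (Poly_Mapping.single (Word [g]) 1))"
      using Cons.prems x[of "gen_index g"] d[of "gen_index g"]
      by (cases g) (auto simp: weyl_x_def weyl_d_def free_x_def free_d_def)
    then show ?case using Cons cl
      unfolding single_Word_Cons[of g w]
      by (auto simp: weyl_class_mult intro!: mult weyl_class_closed)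
  qed
  obtain p where p: "p \<in> carrier (free_algebra n)" "a = weyl_class n p"
    using a unfolding carrier_weyl by blast
  have "P (weyl_class n (Poly_Mapping.single w c))" if "w \<in> Poly_Mapping.keys p" for w c
    using word[of "letters w" c] that p by (auto simp: carrier_free_algebra)
  then show ?thesis using weyl_class_induct[OF p(1), of P] scalar[of 0] add p(2)
    by (simp add: weyl_scalar_0)
qed

section \<open>Submodules and quotients\<close>

context left_module
begin

lemma smult_zero_right:
  assumes "a \<in> carrier R" shows "a \<odot>\<^bsub>M\<^esub> \<zero>\<^bsub>M\<^esub> = \<zero>\<^bsub>M\<^esub>"
proof -
  have "a \<odot>\<^bsub>M\<^esub> \<zero>\<^bsub>M\<^esub> \<oplus>\<^bsub>M\<^esub> a \<odot>\<^bsub>M\<^esub> \<zero>\<^bsub>M\<^esub> = a \<odot>\<^bsub>M\<^esub> \<zero>\<^bsub>M\<^esub>"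
    using smult_r_distr[OF assms M.zero_closed M.zero_closed] by simp
  then show ?thesis using smult_closed[OF assms M.zero_closed] by (metis M.add.r_cancel_one')
qed

lemma smult_zero_left:
  assumes "x \<in> carrier M" shows "\<zero>\<^bsub>R\<^esub> \<odot>\<^bsub>M\<^esub> x = \<zero>\<^bsub>M\<^esub>"
proof -
  have "\<zero>\<^bsub>R\<^esub> \<odot>\<^bsub>M\<^esub> x \<oplus>\<^bsub>M\<^esub> \<zero>\<^bsub>R\<^esub> \<odot>\<^bsub>M\<^esub> x = \<zero>\<^bsub>R\<^esub> \<odot>\<^bsub>M\<^esub> x"
    using smult_l_distr[OF R.zero_closed R.zero_closed assms] by simp
  then show ?thesis using smult_closed[OF R.zero_closed assms] by (metis M.add.r_cancel_one')
qed

lemma smult_minus_one: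
  assumes "x \<in> carrier M"
  shows "(\<ominus>\<^bsub>R\<^esub> \<one>\<^bsub>R\<^esub>) \<odot>\<^bsub>M\<^esub> x = \<ominus>\<^bsub>M\<^esub> x"
proof -
  have "(\<ominus>\<^bsub>R\<^esub> \<one>\<^bsub>R\<^esub>) \<odot>\<^bsub>M\<^esub> x \<oplus>\<^bsub>M\<^esub> x = \<zero>\<^bsub>M\<^esub>"
    using assms smult_l_distr[of "\<ominus>\<^bsub>R\<^esub> \<one>\<^bsub>R\<^esub>" "\<one>\<^bsub>R\<^esub>" x] by (simp add: R.l_neg smult_one smult_zero_left)
  then show ?thesis using assms by (simp add: M.minus_equality smult_closed)
qed

text \<open>Negation is the action of minus one, so closure under the action yields the inverses
  that a subgroup requires.\<close>

lemma submoduleI: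
  assumes "H \<subseteq> carrier M" "\<zero>\<^bsub>M\<^esub> \<in> H" "\<And>x y. \<lbrakk>x \<in> H; y \<in> H\<rbrakk> \<Longrightarrow> x \<oplus>\<^bsub>M\<^esub> y \<in> H"
    and smult: "\<And>a x. \<lbrakk>a \<in> carrier R; x \<in> H\<rbrakk> \<Longrightarrow> a \<odot>\<^bsub>M\<^esub> x \<in> H"
  shows "submodule H R M"
proof (intro submodule.intro submodule_axioms.intro M.add.subgroupI)
  fix x assume "x \<in> H"
  then show "\<ominus>\<^bsub>M\<^esub> x \<in> H"
    using smult[of "\<ominus>\<^bsub>R\<^esub> \<one>\<^bsub>R\<^esub>" x] assms(1) by (auto simp: smult_minus_one subset_iff)
qed (use assms in auto)

lemma submodule_carrier: "submodule (carrier M) R M"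
  by (rule submoduleI) (auto intro: smult_closed)

lemma submodule_zero: "submodule {\<zero>\<^bsub>M\<^esub>} R M"
  by (rule submoduleI) (auto simp: smult_zero_right)

end

locale left_submodule = left_module +
  fixes H
  assumes submod: "submodule H R M"
begin

interpretation S: submodule H R M by (rule submod)

lemma sub_carrier: "x \<in> H \<Longrightarrow> x \<in> carrier M" using S.mem_carrier by simp
lemma sub_zero: "\<zero>\<^bsub>M\<^esub> \<in> H" using S.one_closed by simp
lemma sub_add: "x \<in> H \<Longrightarrow> y \<in> H \<Longrightarrow> x \<oplus>\<^bsub>M\<^esub> y \<in> H" using S.m_closed by simp
lemma sub_minus: "x \<in> H \<Longrightarrow> \<ominus>\<^bsub>M\<^esub> x \<in> H" using S.m_inv_closed by (simp add: a_inv_def)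
lemma sub_smult: "a \<in> carrier R \<Longrightarrow> x \<in> H \<Longrightarrow> a \<odot>\<^bsub>M\<^esub> x \<in> H" by (rule S.smult_closed)

lemma sub_add_cancel: "x \<in> H \<Longrightarrow> y \<in> carrier M \<Longrightarrow> x \<oplus>\<^bsub>M\<^esub> y \<in> H \<longleftrightarrow> y \<in> H"
  by (metis M.add.inv_closed M.add.m_assoc M.l_neg M.l_zero a_inv_def sub_add sub_carrier sub_minus)

lemma restrict_left_module: "left_module R (restrict_module M H)"
proof -
  have "abelian_group (restrict_module M H)"
  proof (rule abelian_groupI)
    fix x assume "x \<in> carrier (restrict_module M H)"
    then show "\<exists>y\<in>carrier (restrict_module M H). y \<oplus>\<^bsub>restrict_module M H\<^esub> x = \<zero>\<^bsub>restrict_module M H\<^esub>"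
      by (intro bexI[of _ "\<ominus>\<^bsub>M\<^esub> x"])
        (auto simp: restrict_module_def M.l_neg sub_carrier intro: sub_minus)
  qed (auto simp: restrict_module_def sub_add sub_zero sub_carrier M.a_ac)
  then show ?thesis
    unfolding left_module_def left_module_axioms_def using R.ring_axioms
    by (auto simp: restrict_module_def sub_smult sub_carrier smult_l_distr smult_r_distr smult_assoc smult_one)
qed

lemma sub_abelian: "abelian_subgroup H M"
  using S.subgroup_axioms by (intro abelian_subgroupI3 additive_subgroupI) unfold_locales

interpretation A: abelian_subgroup H M by (rule sub_abelian)

definition coset :: "'c \<Rightarrow> 'c set" where "coset x = H +>\<^bsub>M\<^esub> x"

lemma carrier_quot: "carrier (quot_module M H) = coset ` carrier M"
  unfolding quot_module_def coset_def A_RCOSETS_def' by auto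

lemma zero_quot: "\<zero>\<^bsub>quot_module M H\<^esub> = H"
  and add_quot: "ring.add (quot_module M H) = (<+>\<^bsub>M\<^esub>)"
  by (simp_all add: quot_module_def)

lemma coset_mem: "x \<in> carrier M \<Longrightarrow> x \<in> coset x"
  unfolding coset_def by (rule A.a_rcos_self)

lemma mem_coset: "x \<in> carrier M \<Longrightarrow> y \<in> coset x \<longleftrightarrow> (\<exists>h\<in>H. y = h \<oplus>\<^bsub>M\<^esub> x)"
  unfolding coset_def a_r_coset_def r_coset_def by auto

lemma coset_subset: "x \<in> carrier M \<Longrightarrow> coset x \<subseteq> carrier M"
  by (auto simp: mem_coset sub_carrier)

lemma coset_eq_mem: "x \<in> carrier M \<Longrightarrow> y \<in> coset x \<Longrightarrow> coset y = coset x"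
  unfolding coset_def using A.a_repr_independence'[of y x] by simp

lemma coset_zero: "coset \<zero>\<^bsub>M\<^esub> = H"
  unfolding coset_def using A.a_subset by simp

lemma coset_eq_zero: "x \<in> carrier M \<Longrightarrow> coset x = H \<longleftrightarrow> x \<in> H"
  using coset_mem[of x] coset_eq_mem[of "\<zero>\<^bsub>M\<^esub>" x] by (auto simp: coset_zero)

lemma coset_add: "x \<in> carrier M \<Longrightarrow> y \<in> carrier M \<Longrightarrow>
    coset x <+>\<^bsub>M\<^esub> coset y = coset (x \<oplus>\<^bsub>M\<^esub> y)"
  unfolding coset_def by (rule A.a_rcos_sum)

text \<open>The elementwise image of a coset under \<open>a\<close> may be a proper subset of a
  coset; the summand \<open>H\<close> in \<open>quot_module\<close> fills it up.\<close>

lemma coset_smult: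
  assumes a: "a \<in> carrier R" and x: "x \<in> carrier M"
  shows "a \<odot>\<^bsub>quot_module M H\<^esub> coset x = coset (a \<odot>\<^bsub>M\<^esub> x)"
proof -
  have "y \<in> H <+>\<^bsub>M\<^esub> ((\<lambda>x. a \<odot>\<^bsub>M\<^esub> x) ` coset x) \<longleftrightarrow> y \<in> coset (a \<odot>\<^bsub>M\<^esub> x)" for y
  proof
    assume "y \<in> H <+>\<^bsub>M\<^esub> ((\<lambda>x. a \<odot>\<^bsub>M\<^esub> x) ` coset x)"
    then obtain h h' where h: "h \<in> H" "h' \<in> H" "y = h \<oplus>\<^bsub>M\<^esub> a \<odot>\<^bsub>M\<^esub> (h' \<oplus>\<^bsub>M\<^esub> x)"
      unfolding set_add_def' using x by (auto simp: mem_coset)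
    then have "y = (h \<oplus>\<^bsub>M\<^esub> a \<odot>\<^bsub>M\<^esub> h') \<oplus>\<^bsub>M\<^esub> a \<odot>\<^bsub>M\<^esub> x"
      using a x by (simp add: smult_r_distr sub_carrier M.a_assoc smult_closed)
    then show "y \<in> coset (a \<odot>\<^bsub>M\<^esub> x)"
      using a x h by (auto simp: mem_coset smult_closed intro!: bexI[of _ "h \<oplus>\<^bsub>M\<^esub> a \<odot>\<^bsub>M\<^esub> h'"] sub_add sub_smult)
  next
    assume "y \<in> coset (a \<odot>\<^bsub>M\<^esub> x)"
    then show "y \<in> H <+>\<^bsub>M\<^esub> ((\<lambda>x. a \<odot>\<^bsub>M\<^esub> x) ` coset x)"
      using coset_mem[OF x] unfolding set_add_def' mem_coset[OF smult_closed[OF a x]] by blast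
  qed
  then show ?thesis by (auto simp: quot_module_def)
qed

lemma quot_left_module: "left_module R (quot_module M H)"
proof -
  have "abelian_group (quot_module M H)"
  proof (rule abelian_groupI)
    fix C assume "C \<in> carrier (quot_module M H)"
    then obtain x where x: "x \<in> carrier M" "C = coset x" by (auto simp: carrier_quot)
    then show "\<exists>C'\<in>carrier (quot_module M H). C' \<oplus>\<^bsub>quot_module M H\<^esub> C = \<zero>\<^bsub>quot_module M H\<^esub>"
      by (intro bexI[of _ "coset (\<ominus>\<^bsub>M\<^esub> x)"])
        (auto simp: carrier_quot add_quot zero_quot coset_add M.l_neg coset_zero)
    show "\<zero>\<^bsub>quot_module M H\<^esub> \<oplus>\<^bsub>quot_module M H\<^esub> C = C"
      using coset_add[OF M.zero_closed x(1)] x by (simp add: zero_quot add_quot coset_zero)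
  next
    show "\<zero>\<^bsub>quot_module M H\<^esub> \<in> carrier (quot_module M H)"
      using coset_zero by (auto simp: zero_quot carrier_quot)
  qed (auto simp: carrier_quot add_quot coset_add M.a_ac)
  then show ?thesis
    unfolding left_module_def left_module_axioms_def using R.ring_axioms
    by (auto simp: carrier_quot add_quot coset_smult coset_add smult_closed
        smult_l_distr smult_r_distr smult_assoc smult_one)
qed

end

section \<open>Modules over the Weyl algebra\<close>

locale weyl_module = left_module "weyl n" M
  for n :: nat and M :: "('k::field_char_0 weyl_elt, 'm) module" (structure)
begin

definition X :: "nat \<Rightarrow> 'm \<Rightarrow> 'm" where "X i m = weyl_x n i \<odot> m"
definition D :: "nat \<Rightarrow> 'm \<Rightarrow> 'm" where "D i m = weyl_d n i \<odot> m"
definition S :: "'k \<Rightarrow> 'm \<Rightarrow> 'm" where "S c m = weyl_scalar n c \<odot> m"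

lemma X_closed: "i \<le> n \<Longrightarrow> m \<in> carrier M \<Longrightarrow> X i m \<in> carrier M"
  and D_closed: "i \<le> n \<Longrightarrow> m \<in> carrier M \<Longrightarrow> D i m \<in> carrier M"
  and S_closed: "m \<in> carrier M \<Longrightarrow> S c m \<in> carrier M"
  by (simp_all add: X_def D_def S_def smult_closed weyl_x_closed weyl_d_closed weyl_scalar_closed)

lemmas XDS_closed = X_closed D_closed S_closed

lemma X_add: "i \<le> n \<Longrightarrow> m \<in> carrier M \<Longrightarrow> m' \<in> carrier M \<Longrightarrow> X i (m \<oplus> m') = X i m \<oplus> X i m'"
  and D_add: "i \<le> n \<Longrightarrow> m \<in> carrier M \<Longrightarrow> m' \<in> carrier M \<Longrightarrow> D i (m \<oplus> m') = D i m \<oplus> D i m'"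
  and S_add: "m \<in> carrier M \<Longrightarrow> m' \<in> carrier M \<Longrightarrow> S c (m \<oplus> m') = S c m \<oplus> S c m'"
  by (simp_all add: X_def D_def S_def smult_r_distr weyl_x_closed weyl_d_closed weyl_scalar_closed)

lemma X_zero: "i \<le> n \<Longrightarrow> X i \<zero> = \<zero>"
  and D_zero: "i \<le> n \<Longrightarrow> D i \<zero> = \<zero>"
  and S_zero: "S c \<zero> = \<zero>"
  by (simp_all add: X_def D_def S_def smult_zero_right weyl_x_closed weyl_d_closed weyl_scalar_closed)

lemma S_0: "m \<in> carrier M \<Longrightarrow> S 0 m = \<zero>"
  and S_1: "m \<in> carrier M \<Longrightarrow> S 1 m = m"
  by (simp_all add: S_def weyl_scalar_0 weyl_scalar_1 smult_zero_left smult_one)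

lemma S_plus: "m \<in> carrier M \<Longrightarrow> S (b + c) m = S b m \<oplus> S c m"
  and S_mult: "m \<in> carrier M \<Longrightarrow> S (b * c) m = S b (S c m)"
  by (simp_all add: S_def weyl_scalar_add weyl_scalar_mult smult_l_distr smult_assoc weyl_scalar_closed)

lemma S_minus_1: assumes "m \<in> carrier M" shows "S (- 1) m = \<ominus> m"
proof -
  have "S (- 1) m \<oplus> m = \<zero>" using S_plus[OF assms, of "-1" 1] by (simp add: S_0 S_1 assms)
  then show ?thesis using assms by (simp add: M.minus_equality S_closed)
qed

lemma S_eq_zero_iff:
  assumes "m \<in> carrier M" shows "S c m = \<zero> \<longleftrightarrow> c = 0 \<or> m = \<zero>"
proof -
  have "m = \<zero>" if "c \<noteq> 0" "S c m = \<zero>"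
    using S_mult[OF assms, of "inverse c" c] that by (simp add: S_1 S_zero assms)
  then show ?thesis using S_0[OF assms] by (auto simp: S_zero)
qed

lemma smult_S: "a \<in> carrier (weyl n) \<Longrightarrow> m \<in> carrier M \<Longrightarrow> a \<odot> S c m = S c (a \<odot> m)"
  by (simp add: S_def weyl_scalar_closed weyl_scalar_commute flip: smult_assoc)

lemma X_S: "i \<le> n \<Longrightarrow> m \<in> carrier M \<Longrightarrow> X i (S c m) = S c (X i m)"
  and D_S: "i \<le> n \<Longrightarrow> m \<in> carrier M \<Longrightarrow> D i (S c m) = S c (D i m)"
  unfolding X_def D_def by (simp_all add: smult_S weyl_x_closed weyl_d_closed)

lemma X_X: "i \<le> n \<Longrightarrow> j \<le> n \<Longrightarrow> m \<in> carrier M \<Longrightarrow> X i (X j m) = X j (X i m)"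
  by (simp add: X_def weyl_x_closed weyl_x_commute[of i n j] flip: smult_assoc)

lemma D_D: "i \<le> n \<Longrightarrow> j \<le> n \<Longrightarrow> m \<in> carrier M \<Longrightarrow> D i (D j m) = D j (D i m)"
  by (simp add: D_def weyl_d_closed weyl_d_commute[of i n j] flip: smult_assoc)

lemma D_X: "i \<le> n \<Longrightarrow> j \<le> n \<Longrightarrow> m \<in> carrier M \<Longrightarrow>
    D i (X j m) = X j (D i m) \<oplus> (if i = j then m else \<zero>)"
  by (simp add: X_def D_def weyl_d_closed weyl_x_closed weyl_d_x smult_l_distr smult_one
      smult_zero_left smult_assoc R.m_closed smult_closed flip: smult_assoc) 

lemma pow_closed:
  "i \<le> n \<Longrightarrow> m \<in> carrier M \<Longrightarrow> (X i ^^ k) m \<in> carrier M"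
  "i \<le> n \<Longrightarrow> m \<in> carrier M \<Longrightarrow> (D i ^^ k) m \<in> carrier M"
  by (induction k) (auto intro: XDS_closed)

lemma pow_zero:
  "i \<le> n \<Longrightarrow> (X i ^^ k) \<zero> = \<zero>"
  "i \<le> n \<Longrightarrow> (D i ^^ k) \<zero> = \<zero>"
  by (induction k) (auto simp: X_zero D_zero)

lemma pow_add:
  "i \<le> n \<Longrightarrow> m \<in> carrier M \<Longrightarrow> m' \<in> carrier M \<Longrightarrow> (X i ^^ k) (m \<oplus> m') = (X i ^^ k) m \<oplus> (X i ^^ k) m'"
  by (induction k) (auto simp: X_add pow_closed)

lemma pow_S:
  "i \<le> n \<Longrightarrow> m \<in> carrier M \<Longrightarrow> (X i ^^ k) (S c m) = S c ((X i ^^ k) m)"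
  by (induction k) (auto simp: X_S pow_closed)

lemma X_pow_X: "i \<le> n \<Longrightarrow> j \<le> n \<Longrightarrow> m \<in> carrier M \<Longrightarrow> (X i ^^ k) (X j m) = X j ((X i ^^ k) m)"
  by (induction k) (auto simp: X_X[of i j] pow_closed)

lemma X_pow_pow: "i \<le> n \<Longrightarrow> j \<le> n \<Longrightarrow> m \<in> carrier M \<Longrightarrow>
    (X i ^^ k) ((X j ^^ l) m) = (X j ^^ l) ((X i ^^ k) m)"
  by (induction l) (auto simp: X_pow_X pow_closed)

lemma D_pow_D: "i \<le> n \<Longrightarrow> j \<le> n \<Longrightarrow> m \<in> carrier M \<Longrightarrow> (D i ^^ k) (D j m) = D j ((D i ^^ k) m)"
  by (induction k) (auto simp: D_D[of i j] pow_closed)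

lemma D_X_pow_neq: "i \<le> n \<Longrightarrow> j \<le> n \<Longrightarrow> i \<noteq> j \<Longrightarrow> m \<in> carrier M \<Longrightarrow>
    D i ((X j ^^ k) m) = (X j ^^ k) (D i m)"
  by (induction k) (auto simp: D_X XDS_closed pow_closed)

text \<open>This is the commutator of a derivation with a power of its own variable, by induction on
  the exponent. The exponent is \<open>Suc k\<close> so that the lower power appears without
  subtraction.\<close>

lemma D_X_pow: "i \<le> n \<Longrightarrow> m \<in> carrier M \<Longrightarrow>
    D i ((X i ^^ Suc k) m) = (X i ^^ Suc k) (D i m) \<oplus> S (of_nat (Suc k)) ((X i ^^ k) m)"
proof (induction k)
  case 0
  then show ?case by (simp add: D_X S_1)
next
  case (Suc k)
  have "D i ((X i ^^ Suc (Suc k)) m) = X i (D i ((X i ^^ Suc k) m)) \<oplus> (X i ^^ Suc k) m"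
    using D_X[of i i "(X i ^^ Suc k) m"] Suc.prems pow_closed(1)[of i m "Suc k"] by simp
  also have "\<dots> = (X i ^^ Suc (Suc k)) (D i m) \<oplus> (S (of_nat (Suc k)) ((X i ^^ Suc k) m) \<oplus> (X i ^^ Suc k) m)"
    unfolding Suc.IH[OF Suc.prems] using Suc.prems
    by (simp add: X_add XDS_closed pow_closed X_S M.a_assoc del: of_nat_Suc)
  also have "S (of_nat (Suc k)) ((X i ^^ Suc k) m) \<oplus> (X i ^^ Suc k) m = S (of_nat (Suc (Suc k))) ((X i ^^ Suc k) m)"
    using S_plus[of "(X i ^^ Suc k) m" "of_nat (Suc k)" 1] Suc.prems pow_closed(1)[of i m "Suc k"]
    by (simp add: S_1 add.commute)
  finally show ?case .
qed

text \<open>Characteristic zero enters here: \<open>[\<partial>\<^sub>i, x\<^sub>i\<^sup>c] = c x\<^sub>i\<^sup>c\<^sup>-\<^sup>1\<close>, so \<open>x\<^sub>i\<close> and \<open>\<partial>\<^sub>i\<close> are never both nilpotent on \<open>m \<noteq> 0\<close>.\<close>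

lemma D_pow_nonzero_of_X_pow_zero:
  assumes i: "i \<le> n" and m: "m \<in> carrier M" "m \<noteq> \<zero>" "(X i ^^ c) m = \<zero>"
  shows "(D i ^^ k) m \<noteq> \<zero> \<and> (\<exists>c. (X i ^^ c) ((D i ^^ k) m) = \<zero>)"
proof (induction k)
  case (Suc k)
  define w where "w = (D i ^^ k) m"
  have w: "w \<in> carrier M" "w \<noteq> \<zero>" "\<exists>c. (X i ^^ c) w = \<zero>"
    using Suc pow_closed(2)[OF i m(1)] by (auto simp: w_def)
  \<comment> \<open>Differentiating \<open>(X i ^^ c) w = \<zero>\<close> at the least such
    \<open>c\<close> produces the term \<open>c\<close> times \<open>(X i ^^ b) w\<close>, which is
    nonzero in characteristic zero. Hence \<open>D i w\<close> cannot vanish.\<close>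
  define c where "c = (LEAST c. (X i ^^ c) w = \<zero>)"
  have c: "(X i ^^ c) w = \<zero>" "\<And>b. b < c \<Longrightarrow> (X i ^^ b) w \<noteq> \<zero>"
    unfolding c_def using w(3) by (auto intro: LeastI dest: not_less_Least)
  obtain b where b: "c = Suc b" using c(1) w(2) by (cases c) auto
  have eq: "(X i ^^ Suc b) (D i w) \<oplus> S (of_nat (Suc b)) ((X i ^^ b) w) = \<zero>"
    using D_X_pow[OF i w(1), of b] c(1) by (simp only: b D_zero i)
  have nz: "S (of_nat (Suc b)) ((X i ^^ b) w) \<noteq> \<zero>"
    using c(2)[of b] w i by (simp add: b S_eq_zero_iff pow_closed del: of_nat_Suc)
  have "D i w \<noteq> \<zero>"
    using eq nz i w pow_zero(1)[OF i, of "Suc b"] by (auto simp: S_closed pow_closed simp del: funpow.simps of_nat_Suc)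
  \<comment> \<open>Nilpotence of the variable must survive for the induction to go on: one further
    power suffices, because the commutator term contains
    \<open>(X i ^^ c) w = \<zero>\<close>.\<close>
  moreover have "(X i ^^ Suc c) (D i w) = \<zero>"
    using D_X_pow[OF i w(1), of c] c(1) w i pow_zero(1)[OF i]
    by (simp add: X_zero D_zero S_zero XDS_closed pow_closed)
  ultimately show ?case by (auto simp: w_def simp del: funpow.simps simp: funpow.simps(2)[where f = "D i"])
qed (use m in auto)

end

lemma (in weyl_module) mult_scalar_class:
  assumes "m \<in> carrier M" "i \<le> n"
  shows "weyl_class n (of_nat k * free_x i * free_d i) \<odot> m = S (of_nat k) (X i (D i m))"
proof -
  have "of_nat k = (Poly_Mapping.single 0 (of_nat k) :: 'k free_alg)" by simp
  then have "weyl_class n (of_nat k * free_x i * free_d i) =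
      weyl_scalar n (of_nat k) \<otimes>\<^bsub>weyl n\<^esub> weyl_x n i \<otimes>\<^bsub>weyl n\<^esub> (weyl_d n i :: 'k weyl_elt)"
    using assms
    by (metis weyl_class_mult free_algebra_mult free_scalar_closed free_x_closed free_d_closed
        weyl_scalar_def weyl_x_def weyl_d_def)
  then show ?thesis using assms
    by (simp add: S_def X_def D_def smult_assoc weyl_x_closed weyl_d_closed weyl_scalar_closed smult_closed)
qed

locale weighted_module = weyl_module n M
  for n and M :: "('k::field_char_0 weyl_elt, 'm) module" (structure) +
  fixes d :: "nat \<Rightarrow> nat"
  assumes d_pos: "i \<le> n \<Longrightarrow> 0 < d i"
begin

section \<open>The Euler field and its eigenspaces\<close>

text \<open>The Euler field restricted to the indices in \<open>I\<close>; a variable index set lets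
  the commutator formulas be proved by induction over the summands.\<close>

definition Eul :: "nat set \<Rightarrow> 'm \<Rightarrow> 'm"
  where "Eul I m = weyl_class n (\<Sum>i\<in>I. of_nat (d i) * free_x i * free_d i) \<odot> m"

lemma Eul_term_closed: "i \<le> n \<Longrightarrow> of_nat (d i) * free_x i * free_d i \<in> carrier (free_algebra n)"
  by (metis free_algebra_mult free_scalar_closed free_x_closed free_d_closed single_of_nat)

lemma Eul_closed: "I \<subseteq> {..n} \<Longrightarrow> m \<in> carrier M \<Longrightarrow> Eul I m \<in> carrier M"
  unfolding Eul_def by (auto intro!: smult_closed weyl_class_closed free_algebra_sum Eul_term_closed)

lemma Eul_empty: "m \<in> carrier M \<Longrightarrow> Eul {} m = \<zero>"
  unfolding Eul_def by (simp add: weyl_class_zero smult_zero_left)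

lemma Eul_insert:
  assumes "finite I" "I \<subseteq> {..n}" "i \<le> n" "i \<notin> I" "m \<in> carrier M"
  shows "Eul (insert i I) m = S (of_nat (d i)) (X i (D i m)) \<oplus> Eul I m"
proof -
  have "(\<Sum>i\<in>I. of_nat (d i) * free_x i * free_d i :: 'k free_alg) \<in> carrier (free_algebra n)"
    using assms(2) by (intro free_algebra_sum Eul_term_closed) auto
  then show ?thesis unfolding Eul_def using assms
    by (simp add: weyl_class_add Eul_term_closed smult_l_distr weyl_class_closed mult_scalar_class)
qed

text \<open>Among the summands only the one with index \<open>i\<close> fails to commute with
  \<open>X i\<close>; its commutator contributes \<open>d i\<close> copies of
  \<open>X i m\<close>.\<close>

lemma Eul_X:
  assumes "finite I" "I \<subseteq> {..n}" "i \<le> n" "m \<in> carrier M"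
  shows "Eul I (X i m) = X i (Eul I m) \<oplus> S (if i \<in> I then of_nat (d i) else 0) (X i m)"
  using assms(1,2)
proof (induction I rule: finite_induct)
  case empty
  then show ?case using assms by (simp add: Eul_empty X_zero S_0 X_closed)
next
  case (insert j I)
  then have cl: "Eul I m \<in> carrier M" "j \<le> n" "I \<subseteq> {..n}" by (simp_all add: Eul_closed assms)
  note eq = insert.IH[OF cl(3)]
  show ?case
  proof (cases "i = j")
    case True
    then show ?thesis using assms insert.hyps cl eq
      by (simp add: Eul_insert D_X X_add X_S X_X S_add XDS_closed Eul_closed M.a_ac S_0)
  next
    case False
    then show ?thesis using assms insert.hyps cl eq
      by (simp add: Eul_insert D_X X_add X_S X_X[of i j] XDS_closed Eul_closed M.a_ac)
  qed
qed

text \<open>The same computation for derivations, where the weight is negative; the correction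
  stands on the left so that no subtraction in \<open>M\<close> occurs.\<close>

lemma Eul_D:
  assumes "finite I" "I \<subseteq> {..n}" "i \<le> n" "m \<in> carrier M"
  shows "Eul I (D i m) \<oplus> S (if i \<in> I then of_nat (d i) else 0) (D i m) = D i (Eul I m)"
  using assms(1,2)
proof (induction I rule: finite_induct)
  case empty
  then show ?case using assms by (simp add: Eul_empty D_zero S_0 D_closed)
next
  case (insert j I)
  then have cl: "Eul I m \<in> carrier M" "j \<le> n" "I \<subseteq> {..n}" by (simp_all add: Eul_closed assms)
  note eq = insert.IH[OF cl(3), symmetric]
  show ?case
  proof (cases "i = j")
    case True
    then show ?thesis using assms insert.hyps cl eq
      by (simp add: Eul_insert D_add D_X D_S S_add XDS_closed Eul_closed M.a_ac S_0)
  next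
    case False
    then show ?thesis using assms insert.hyps cl eq
      by (simp add: Eul_insert D_add D_X D_S D_D[of i j] XDS_closed Eul_closed M.a_ac)
  qed
qed

abbreviation V :: "'k \<Rightarrow> 'm set" where "V \<equiv> eigenspace n d M"
abbreviation Eu :: "'m \<Rightarrow> 'm" where "Eu \<equiv> Eul {..n}"

lemma Eu_smult: "Eu m = euler_field n d \<odot> m"
  by (simp add: Eul_def euler_field_def)

lemma euler_field_closed: "euler_field n d \<in> carrier (weyl n)"
  unfolding euler_field_def by (intro weyl_class_closed free_algebra_sum Eul_term_closed) auto

lemma V_iff: "m \<in> V \<mu> \<longleftrightarrow> m \<in> carrier M \<and> Eu m = S \<mu> m"
  by (simp add: eigenspace_def Eu_smult S_def)

lemma Eu_add: "m \<in> carrier M \<Longrightarrow> m' \<in> carrier M \<Longrightarrow> Eu (m \<oplus> m') = Eu m \<oplus> Eu m'"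
  and Eu_zero: "Eu \<zero> = \<zero>"
  and Eu_S: "m \<in> carrier M \<Longrightarrow> Eu (S c m) = S c (Eu m)"
  unfolding Eu_smult by (simp_all add: euler_field_closed smult_r_distr smult_zero_right smult_S)

lemma V_carrier: "m \<in> V \<mu> \<Longrightarrow> m \<in> carrier M" by (simp add: V_iff)

lemma V_zero: "\<zero> \<in> V \<mu>" by (simp add: V_iff Eu_zero S_zero)

lemma V_add: "m \<in> V \<mu> \<Longrightarrow> m' \<in> V \<mu> \<Longrightarrow> m \<oplus> m' \<in> V \<mu>"
  by (simp add: V_iff Eu_add S_add)

lemma V_S: "m \<in> V \<mu> \<Longrightarrow> S c m \<in> V \<mu>"
  by (simp add: V_iff Eu_S S_closed mult.commute flip: S_mult)

lemma V_X:
  assumes "i \<le> n" "m \<in> V \<mu>" shows "X i m \<in> V (\<mu> + of_nat (d i))"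
  using assms Eul_X[of "{..n}" i m] by (simp add: V_iff X_closed X_S S_plus)

lemma V_D:
  assumes "i \<le> n" "m \<in> V \<mu>" shows "D i m \<in> V (\<mu> - of_nat (d i))"
proof -
  have cl: "m \<in> carrier M" "D i m \<in> carrier M" using assms by (auto simp: V_iff D_closed)
  have "Eu (D i m) \<oplus> S (of_nat (d i)) (D i m) = S (\<mu> - of_nat (d i)) (D i m) \<oplus> S (of_nat (d i)) (D i m)"
    using assms Eul_D[of "{..n}" i m] by (simp add: V_iff D_S cl flip: S_plus)
  then show ?thesis using cl assms(1) by (simp add: V_iff Eul_closed S_closed)
qed

lemma V_X_pow: "i \<le> n \<Longrightarrow> m \<in> V \<mu> \<Longrightarrow> (X i ^^ k) m \<in> V (\<mu> + of_nat (k * d i))"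
proof (induction k)
  case (Suc k)
  then show ?case using V_X[of i "(X i ^^ k) m" "\<mu> + of_nat (k * d i)"] by (simp add: algebra_simps)
qed simp

lemma V_D_pow: "i \<le> n \<Longrightarrow> m \<in> V \<mu> \<Longrightarrow> (D i ^^ k) m \<in> V (\<mu> - of_nat (k * d i))"
proof (induction k)
  case (Suc k)
  then show ?case using V_D[of i "(D i ^^ k) m" "\<mu> - of_nat (k * d i)"] by (simp add: algebra_simps)
qed simp

section \<open>Decomposition into Euler eigenvectors\<close>

lemma finsum_additive:
  assumes "\<And>x y. \<lbrakk>x \<in> carrier M; y \<in> carrier M\<rbrakk> \<Longrightarrow> f (x \<oplus> y) = f x \<oplus> f y" "f \<zero> = \<zero>"
    and "\<And>x. x \<in> carrier M \<Longrightarrow> f x \<in> carrier M" "finite F" "\<And>k. k \<in> F \<Longrightarrow> c k \<in> carrier M"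
  shows "f (\<Oplus>k\<in>F. c k) = (\<Oplus>k\<in>F. f (c k))"
  using assms(4,5)
proof (induction F rule: finite_induct)
  case (insert a F)
  then have "c \<in> F \<rightarrow> carrier M" "(\<lambda>k. f (c k)) \<in> F \<rightarrow> carrier M" using assms(3) by auto
  then show ?case using insert assms by simp
qed (simp add: assms(2))

text \<open>Submodules are graded. The operator \<open>T\<close>, which is the Euler field minus
  \<open>lam + k0\<close>, preserves \<open>H\<close>, kills the component in degree
  \<open>k0\<close> and multiplies the one in degree \<open>k\<close> by \<open>k - k0\<close>, a
  nonzero scalar in characteristic zero. Induction puts the other components into \<open>H\<close>,
  and then subtraction puts in the one of degree \<open>k0\<close>. For \<open>H\<close> zero this
  is the independence of eigenvectors.\<close>

lemma component_in_submodule: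
  assumes H: "submodule H (weyl n) M" and "finite F"
    and "\<And>k. k \<in> F \<Longrightarrow> c k \<in> V (lam + of_int k)" "(\<Oplus>k\<in>F. c k) \<in> H" "k \<in> F"
  shows "c k \<in> H"
  using assms(2-)
proof (induction F arbitrary: c k rule: finite_induct)
  case (insert k0 F)
  interpret left_submodule "weyl n" M H by (intro left_submodule.intro left_submodule_axioms.intro left_module_axioms H)
  have c: "c \<in> F \<rightarrow> carrier M" "c k0 \<in> carrier M"
    using insert.prems(1) by (auto intro: V_carrier)
  define T where "T m = Eu m \<oplus> S (- (lam + of_int k0)) m" for m
  have T_add: "T (x \<oplus> y) = T x \<oplus> T y" if "x \<in> carrier M" "y \<in> carrier M" for x y
    using that by (simp add: T_def Eu_add S_add Eul_closed S_closed M.a_ac)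
  have T_closed: "T x \<in> carrier M" if "x \<in> carrier M" for x
    using that by (simp add: T_def Eul_closed S_closed)
  have T_c: "T (c k) = S (of_int k - of_int k0) (c k)" if "k \<in> insert k0 F" for k
    using insert.prems(1)[OF that] by (simp add: T_def V_iff flip: S_plus)
  have T_H: "T x \<in> H" if "x \<in> H" for x
    using that unfolding T_def Eu_smult S_def
    by (intro sub_add sub_smult euler_field_closed weyl_scalar_closed)
  define w where "w = (\<Oplus>k\<in>F. c k)"
  have w: "w \<in> carrier M" "c k0 \<oplus> w \<in> H"
    using insert.prems(2) insert.hyps c by (simp_all add: w_def)
  have "T (c k0 \<oplus> w) = T w"
    using w c T_c[of k0] by (simp add: T_add T_closed S_0)
  also have "\<dots> = (\<Oplus>k\<in>F. T (c k))"
    unfolding w_def using T_add T_closed insert.hyps c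
    by (intro finsum_additive) (auto simp: T_def Eu_zero S_zero)
  also have "\<dots> = (\<Oplus>k\<in>F. S (of_int k - of_int k0) (c k))"
    using c by (intro M.finsum_cong') (auto simp: T_c S_closed Pi_iff)
  finally have "(\<Oplus>k\<in>F. S (of_int k - of_int k0) (c k)) \<in> H" using T_H[OF w(2)] by simp
  \<comment> \<open>The induction hypothesis is used for the rescaled components, which is why
    \<open>c\<close> is generalized.\<close>
  then have S_H: "S (of_int k - of_int k0) (c k) \<in> H" if "k \<in> F" for k
    using insert.IH[of "\<lambda>k. S (of_int k - of_int k0) (c k)"] that insert.prems(1) by (simp add: V_S)
  have F_H: "c k \<in> H" if "k \<in> F" for k
  proof -
    have "(of_int k - of_int k0 :: 'k) \<noteq> 0" using that insert.hyps by auto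
    then have "c k = weyl_scalar n (inverse (of_int k - of_int k0)) \<odot> S (of_int k - of_int k0) (c k)"
      using c that S_mult[of "c k" "inverse (of_int k - of_int k0)" "of_int k - of_int k0"]
      by (auto simp: S_1 simp flip: S_def)
    then show ?thesis using sub_smult[OF weyl_scalar_closed S_H[OF that]] by metis
  qed
  have "(\<Oplus>k\<in>F'. c k) \<in> H" if "finite F'" "F' \<subseteq> F" for F'
    using that by (induction F' rule: finite_induct) (use F_H c in \<open>auto simp: sub_zero sub_add Pi_iff subset_iff\<close>)
  then have "w \<in> H" unfolding w_def using insert.hyps(1) by blast
  then have "c k0 \<in> H" using sub_add_cancel[of w "c k0"] w(2) c w(1) by (simp add: M.a_comm)
  then show ?case using F_H insert.prems(3) by auto
qed simp

text \<open>The sum of the eigenspaces for \<open>lam\<close> plus integers, built by adding one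
  eigenvector at a time. Rule induction on it replaces work with the families in
  \<open>euler_module\<close>.\<close>

inductive_set esum :: "'k \<Rightarrow> 'm set" for lam where
  zero: "\<zero> \<in> esum lam"
| add: "\<lbrakk>e \<in> V (lam + of_int k); m \<in> esum lam\<rbrakk> \<Longrightarrow> e \<oplus> m \<in> esum lam"

lemma esum_carrier: "m \<in> esum lam \<Longrightarrow> m \<in> carrier M"
  by (induction rule: esum.induct) (auto intro: V_carrier)

lemma esum_finsum:
  assumes "finite F" "\<And>k. k \<in> F \<Longrightarrow> c k \<in> V (lam + of_int k)"
  shows "(\<Oplus>k\<in>F. c k) \<in> esum lam"
  using assms
proof (induction F rule: finite_induct)
  case (insert k F)
  then have "(\<Oplus>k\<in>insert k F. c k) = c k \<oplus> (\<Oplus>k\<in>F. c k)"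
    by (intro M.finsum_insert) (auto dest: V_carrier)
  then show ?case using insert by (auto intro: esum.add)
qed (simp add: esum.zero)

lemma finsum_support:
  assumes "finite F" "\<And>k. k \<in> F \<Longrightarrow> c k \<in> carrier M" "{k. c k \<noteq> \<zero>} \<subseteq> F"
  shows "(\<Oplus>k\<in>{k. c k \<noteq> \<zero>}. c k) = (\<Oplus>k\<in>F. c k)"
  using assms by (intro M.add.finprod_mono_neutral_cong_left) auto

lemma esum_decompose:
  assumes "m \<in> esum lam"
  shows "\<exists>c. (\<forall>k. c k \<in> V (lam + of_int k)) \<and> finite {k. c k \<noteq> \<zero>} \<and> m = (\<Oplus>k\<in>{k. c k \<noteq> \<zero>}. c k)"
  using assms
proof (induction rule: esum.induct)
  case zero
  show ?case by (intro exI[of _ "\<lambda>_. \<zero>"]) (auto simp: V_zero)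
next
  case (add e k m)
  then obtain c where c: "\<And>k. c k \<in> V (lam + of_int k)" "finite {k. c k \<noteq> \<zero>}" "m = (\<Oplus>k\<in>{k. c k \<noteq> \<zero>}. c k)"
    by auto
  have cc: "c j \<in> carrier M" for j using c(1) by (rule V_carrier)
  have ec: "e \<in> carrier M" using add by (auto intro: V_carrier)
  define F where "F = {k. c k \<noteq> \<zero>} - {k}"
  have F: "finite F" "k \<notin> F" "{k. c k \<noteq> \<zero>} \<subseteq> insert k F" using c(2) by (auto simp: F_def)
  \<comment> \<open>Only the component in degree \<open>k\<close> changes. It may appear or cancel,
    so all sums are compared over the fixed set \<open>insert k F\<close> instead of over the
    supports.\<close>
  define c' where "c' = c(k := e \<oplus> c k)"
  have c'V: "c' j \<in> V (lam + of_int j)" for j using c(1) add(1) by (auto simp: c'_def V_add)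
  have c'F: "{j. c' j \<noteq> \<zero>} \<subseteq> insert k F" using F by (auto simp: c'_def)
  have "(\<Oplus>j\<in>{k. c' k \<noteq> \<zero>}. c' j) = (\<Oplus>j\<in>insert k F. c' j)"
    using F c'F V_carrier[OF c'V] by (intro finsum_support) auto
  also have "\<dots> = (e \<oplus> c k) \<oplus> (\<Oplus>j\<in>F. c' j)"
    using F V_carrier[OF c'V] ec cc by (subst M.finsum_insert) (auto simp: c'_def)
  also have "(\<Oplus>j\<in>F. c' j) = (\<Oplus>j\<in>F. c j)"
    using F cc by (intro M.finsum_cong') (auto simp: c'_def)
  also have "(e \<oplus> c k) \<oplus> \<dots> = e \<oplus> (\<Oplus>j\<in>insert k F. c j)"
    using F cc ec by (simp add: M.a_assoc Pi_iff)
  also have "(\<Oplus>j\<in>insert k F. c j) = m"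
    unfolding c(3) using F cc by (intro finsum_support[symmetric]) auto
  finally show ?case using c'V finite_subset[OF c'F] F by (intro exI[of _ c']) auto
qed

text \<open>Uniqueness of the decomposition is automatic: the difference of two decompositions sums
  to zero, and \<open>component_in_submodule\<close> for the zero submodule makes each of its
  components vanish. Only spanning remains to be checked.\<close>

lemma euler_module_iff: "euler_module n d lam M \<longleftrightarrow> carrier M \<subseteq> esum lam"
proof
  assume L: "euler_module n d lam M"
  show "carrier M \<subseteq> esum lam"
  proof
    fix m assume "m \<in> carrier M"
    then obtain c where "\<forall>k. c k \<in> V (lam + of_int k)" "finite {k. c k \<noteq> \<zero>}"
      "m = (\<Oplus>k\<in>{k. c k \<noteq> \<zero>}. c k)"
      using L unfolding euler_module_def by metis
    then show "m \<in> esum lam" using esum_finsum by metis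
  qed
next
  assume R: "carrier M \<subseteq> esum lam"
  show "euler_module n d lam M"
    unfolding euler_module_def
  proof (intro conjI ballI left_module_axioms)
    fix m assume m: "m \<in> carrier M"
    let ?P = "\<lambda>c. (\<forall>k. c k \<in> V (lam + of_int k)) \<and> finite {k. c k \<noteq> \<zero>} \<and> m = (\<Oplus>k\<in>{k. c k \<noteq> \<zero>}. c k)"
    have "\<exists>c. ?P c" using esum_decompose R m by blast
    moreover have "c = c'" if c: "?P c" and c': "?P c'" for c c'
    proof
      fix k
      have cc: "c j \<in> carrier M" "c' j \<in> carrier M" for j using c c' by (auto intro: V_carrier)
      define F where "F = insert k ({k. c k \<noteq> \<zero>} \<union> {k. c' k \<noteq> \<zero>})"
      have F: "finite F" "k \<in> F" using c c' by (auto simp: F_def)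
      have sub: "{k. c k \<noteq> \<zero>} \<subseteq> F" "{k. c' k \<noteq> \<zero>} \<subseteq> F" by (auto simp: F_def)
      have sums: "(\<Oplus>j\<in>F. c j) = m" "(\<Oplus>j\<in>F. c' j) = m"
        using c c' finsum_support[OF F(1), of c] finsum_support[OF F(1), of c'] cc sub by auto
      have neg: "(\<Oplus>j\<in>F. S (-1) (c' j)) = S (-1) m"
        unfolding sums(2)[symmetric] using F cc
        by (intro finsum_additive[symmetric]) (auto simp: S_add S_zero S_closed)
      have "(\<Oplus>j\<in>F. c j \<oplus> S (-1) (c' j)) = m \<oplus> S (-1) m"
        using F cc by (subst M.finsum_addf) (auto simp: sums neg S_closed)
      also have "\<dots> = \<zero>" using m by (simp add: S_minus_1 M.r_neg)
      finally have zero: "(\<Oplus>j\<in>F. c j \<oplus> S (-1) (c' j)) \<in> {\<zero>}" by simp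
      have "c j \<oplus> S (-1) (c' j) \<in> V (lam + of_int j)" for j
        using c c' by (simp add: V_add V_S)
      from component_in_submodule[OF submodule_zero F(1) this zero F(2)]
      have "c k \<oplus> S (-1) (c' k) \<in> {\<zero>}" .
      then have "c k \<oplus> \<ominus> c' k = \<zero>" using cc by (simp add: S_minus_1)
      then have "\<ominus> (\<ominus> c' k) = c k" using cc by (intro M.minus_equality) auto
      then show "c k = c' k" using M.minus_minus[OF cc(2)[of k]] by (rule trans[OF sym])
    qed
    ultimately show "\<exists>!c. ?P c" by blast
  qed
qed

end

section \<open>Torsion\<close>

context weyl_module
begin

lemma replicate_var_smult:
  assumes "i \<le> n" "m \<in> carrier M"
  shows "weyl_class n (Poly_Mapping.single (Word (replicate k (Var i))) 1) \<odot> m = (X i ^^ k) m"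
proof (induction k)
  case 0
  show ?case using assms by (simp add: weyl_class_one smult_one flip: zero_word_def)
next
  case (Suc k)
  have "Poly_Mapping.single (Word (replicate k (Var i))) (1::'k) \<in> carrier (free_algebra n)"
    using assms by (intro free_algebra_single) auto
  then show ?case using assms Suc
    by (simp add: single_Word_Cons[of "Var i"] weyl_class_mult free_x_closed smult_assoc
        weyl_class_closed X_def weyl_x_def flip: free_x_def)
qed

lemma var_word_smult:
  assumes "set js \<subseteq> {..n}" "m \<in> carrier M"
  shows "weyl_class n (Poly_Mapping.single (Word (map Var js)) c) \<odot> m = foldr X js (S c m)"
  using assms(1)
proof (induction js)
  case Nil
  show ?case by (simp add: S_def weyl_scalar_def zero_word_def)
next
  case (Cons i js)
  have "Poly_Mapping.single (Word (map Var js)) c \<in> carrier (free_algebra n)"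
    using Cons.prems by (intro free_algebra_single) auto
  then show ?case using assms(2) Cons
    by (simp add: single_Word_Cons[of "Var i"] weyl_class_mult free_x_closed smult_assoc
        weyl_class_closed X_def weyl_x_def flip: free_x_def)
qed

lemma foldr_X_closed: "set js \<subseteq> {..n} \<Longrightarrow> m \<in> carrier M \<Longrightarrow> foldr X js m \<in> carrier M"
  by (induction js) (auto intro: X_closed)

lemma foldr_X_zero: "set js \<subseteq> {..n} \<Longrightarrow> foldr X js \<zero> = \<zero>"
  by (induction js) (auto simp: X_zero)

text \<open>Gathers all factors with index \<open>i\<close> next to \<open>m\<close>, so that a
  monomial kills \<open>m\<close> as soon as one of its pure powers does.\<close>

lemma foldr_X_extract:
  assumes "set js \<subseteq> {..n}" "i \<le> n" "m \<in> carrier M"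
  shows "foldr X js m = foldr X (filter (\<lambda>j. j \<noteq> i) js) ((X i ^^ count_list js i) m)"
  using assms(1)
proof (induction js)
  case (Cons j js)
  have "X i (foldr X ks w) = foldr X ks (X i w)" if "set ks \<subseteq> {..n}" "w \<in> carrier M" for ks w
    using that assms(2) by (induction ks) (auto simp: X_X[of i] foldr_X_closed)
  from this[of "filter (\<lambda>j. j \<noteq> i) js" "(X i ^^ count_list js i) m"]
  show ?case using Cons assms by (auto simp: pow_closed subset_iff)
qed simp

end

context weighted_module
begin

definition torsion_elt :: "'m \<Rightarrow> bool"
  where "torsion_elt m \<longleftrightarrow> (\<forall>i\<le>n. \<exists>k. (X i ^^ k) m = \<zero>)"

lemma X_pow_zero_mono: "i \<le> n \<Longrightarrow> (X i ^^ k) m = \<zero> \<Longrightarrow> k \<le> l \<Longrightarrow> (X i ^^ l) m = \<zero>"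
  using pow_zero(1)[of i "l - k"] funpow_add[of "l - k" k "X i"] by simp

text \<open>Powers of a single variable have arbitrarily large degree because weights are positive.
  Conversely, if \<open>X i ^^ K i\<close> kills \<open>m\<close> for every \<open>i\<close>, a
  monomial of degree above the sum of the \<open>K i * d i\<close> contains some variable more than
  \<open>K i\<close> times.\<close>

lemma torsion_elt_iff:
  assumes m: "m \<in> carrier M"
  shows "(\<exists>N::int. \<forall>k>N. \<forall>a\<in>poly_part n d k. a \<odot> m = \<zero>) \<longleftrightarrow> torsion_elt m"
proof
  assume "\<exists>N::int. \<forall>k>N. \<forall>a\<in>poly_part n d k. a \<odot> m = \<zero>"
  then obtain N where N: "\<And>k a. N < k \<Longrightarrow> a \<in> poly_part n d k \<Longrightarrow> a \<odot> m = \<zero>" by blast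
  show "torsion_elt m"
    unfolding torsion_elt_def
  proof (intro allI impI)
    fix i assume i: "i \<le> n"
    define k where "k = nat N + 1"
    have "N < int k * 1" by (simp add: k_def)
    also have "\<dots> \<le> int k * int (d i)" using d_pos[OF i] by (intro mult_left_mono) auto
    finally have "N < int k * int (d i)" .
    moreover have "weyl_class n (Poly_Mapping.single (Word (replicate k (Var i))) 1)
        \<in> poly_part n d (int k * int (d i))"
      unfolding poly_part_def using i
      by (intro imageI CollectI conjI free_algebra_single)
        (auto simp: word_deg_def sum_list_replicate)
    ultimately show "\<exists>k. (X i ^^ k) m = \<zero>"
      using N replicate_var_smult[OF i m] by metis
  qed
next
  assume "torsion_elt m"
  then obtain K where K: "\<And>i. i \<le> n \<Longrightarrow> (X i ^^ K i) m = \<zero>"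
    unfolding torsion_elt_def by metis
  define N where "N = int (\<Sum>i\<le>n. K i * d i)"
  have word: "weyl_class n (Poly_Mapping.single w c) \<odot> m = \<zero>"
    if w: "set (letters w) \<subseteq> range Var" "\<forall>g\<in>set (letters w). gen_index g \<le> n" "word_deg d w > N" for w c
  proof -
    define js where "js = map gen_index (letters w)"
    have ljs: "letters w = map Var js"
      unfolding js_def map_map using w(1) by (auto intro!: map_idI[symmetric])
    have js: "set js \<subseteq> {..n}" using w(2) by (auto simp: js_def)
    have "sum_list (map (\<lambda>j. int (d j)) ks) = int (sum_list (map d ks))" for ks
      by (induction ks) auto
    then have "int (sum_list (map d js)) > N"
      using w(3) by (simp add: word_deg_def ljs comp_def)
    moreover have "sum_list (map d js) = (\<Sum>i\<le>n. count_list js i * d i)"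
      using js by (intro sum_list_map_eq_sum_count2) auto
    ultimately have "(\<Sum>i\<le>n. K i * d i) < (\<Sum>i\<le>n. count_list js i * d i)"
      unfolding N_def by linarith
    then obtain i where i: "i \<le> n" "K i * d i < count_list js i * d i"
      by (meson sum_mono not_le atMost_iff)
    then have "(X i ^^ count_list js i) (S c m) = \<zero>"
      using X_pow_zero_mono[OF i(1) K[OF i(1)], of "count_list js i"] m by (simp add: pow_S S_zero)
    then have "foldr X js (S c m) = \<zero>"
      using foldr_X_extract[OF js i(1) S_closed[OF m], of c] foldr_X_zero[of "filter (\<lambda>j. j \<noteq> i) js"] js
      by (auto simp: subset_iff)
    moreover have "w = Word (map Var js)" using ljs by (cases w) simp
    ultimately show ?thesis using var_word_smult[OF js m, of c] by simp
  qed
  show "\<exists>N::int. \<forall>k>N. \<forall>a\<in>poly_part n d k. a \<odot> m = \<zero>"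
  proof (intro exI[of _ N] allI impI ballI)
    fix k and a :: "'k weyl_elt" assume k: "N < k" and "a \<in> poly_part n d k"
    then obtain p where p: "p \<in> carrier (free_algebra n)" "a = weyl_class n p"
      "\<forall>w\<in>Poly_Mapping.keys p. set (letters w) \<subseteq> range Var \<and> word_deg d w = k"
      unfolding poly_part_def by auto
    show "a \<odot> m = \<zero>"
      unfolding p(2) using p(1)
    proof (rule weyl_class_induct)
      fix w c assume "w \<in> Poly_Mapping.keys p"
      then show "weyl_class n (Poly_Mapping.single w c) \<odot> m = \<zero>"
        using p k by (intro word) (auto simp: carrier_free_algebra)
    qed (use m in \<open>auto simp: smult_zero_left smult_l_distr\<close>)
  qed
qed

lemma torsion_iff: "torsion n d M \<longleftrightarrow> (\<forall>m\<in>carrier M. torsion_elt m)"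
  unfolding torsion_def using torsion_elt_iff by blast

definition torsion_part :: "'m set" where "torsion_part = {m \<in> carrier M. torsion_elt m}"

lemma torsion_elt_common:
  assumes "torsion_elt x" "torsion_elt y" "i \<le> n"
  shows "\<exists>k. (X i ^^ k) x = \<zero> \<and> (X i ^^ k) y = \<zero>"
proof -
  obtain k l where "(X i ^^ k) x = \<zero>" "(X i ^^ l) y = \<zero>" using assms unfolding torsion_elt_def by blast
  then show ?thesis using X_pow_zero_mono[OF assms(3), of _ _ "max k l"] by (metis max.cobounded1 max.cobounded2)
qed

text \<open>The case with content is a derivation against its own variable: if
  \<open>X i ^^ k\<close> kills \<open>x\<close>, then \<open>X i ^^ Suc k\<close> kills
  \<open>D i x\<close>, since the commutator of the two is a multiple of
  \<open>X i ^^ k\<close>.\<close>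

lemma torsion_part_submodule: "submodule torsion_part (weyl n) M"
proof (rule submoduleI)
  fix a :: "'k weyl_elt" and x assume a: "a \<in> carrier (weyl n)" and x: "x \<in> torsion_part"
  have "\<forall>x\<in>torsion_part. a \<odot> x \<in> torsion_part"
    using a
  proof (induction a rule: weyl_induct)
    case (scalar c)
    then show ?case unfolding S_def[symmetric] torsion_part_def
      by (auto simp: S_closed torsion_elt_def pow_S) (metis S_zero)
  next
    case (x i)
    then show ?case unfolding X_def[symmetric] torsion_part_def
      by (auto simp: X_closed torsion_elt_def X_pow_X) (metis X_zero)
  next
    case (d i)
    show ?case
      unfolding D_def[symmetric]
    proof
      fix x assume x: "x \<in> torsion_part"
      then have xc: "x \<in> carrier M" by (simp add: torsion_part_def)
      have "\<exists>k. (X j ^^ k) (D i x) = \<zero>" if j: "j \<le> n" for j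
      proof -
        obtain k where k: "(X j ^^ k) x = \<zero>" using x j by (auto simp: torsion_part_def torsion_elt_def)
        show ?thesis
        proof (cases "i = j")
          case True
          have "(X j ^^ Suc k) x = \<zero>" using k j by (simp add: X_zero)
          then have "(X j ^^ Suc k) (D i x) \<oplus> S (of_nat (Suc k)) \<zero> = \<zero>"
            using D_X_pow[OF j xc, of k] k True by (simp add: D_zero j)
          then show ?thesis using pow_closed(1)[OF j D_closed[OF d xc], of "Suc k"]
            by (intro exI[of _ "Suc k"]) (simp add: S_zero)
        next
          case False
          then show ?thesis using D_X_pow_neq[OF d j False xc, of k] k d by (auto simp: D_zero)
        qed
      qed
      then show "D i x \<in> torsion_part" using xc d by (simp add: torsion_part_def torsion_elt_def D_closed)
    qed
  next
    case (add a b)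
    show ?case
    proof
      fix x assume x: "x \<in> torsion_part"
      then have c: "a \<odot> x \<in> torsion_part" "b \<odot> x \<in> torsion_part" "x \<in> carrier M"
        using add by (auto simp: torsion_part_def)
      have "torsion_elt (a \<odot> x \<oplus> b \<odot> x)"
        unfolding torsion_elt_def
      proof (intro allI impI)
        fix i assume i: "i \<le> n"
        obtain k where "(X i ^^ k) (a \<odot> x) = \<zero>" "(X i ^^ k) (b \<odot> x) = \<zero>"
          using torsion_elt_common[of "a \<odot> x" "b \<odot> x" i] c i by (auto simp: torsion_part_def)
        then show "\<exists>k. (X i ^^ k) (a \<odot> x \<oplus> b \<odot> x) = \<zero>"
          using c i by (intro exI[of _ k]) (simp add: pow_add torsion_part_def)
      qed
      then show "(a \<oplus>\<^bsub>weyl n\<^esub> b) \<odot> x \<in> torsion_part"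
        using c add by (simp add: smult_l_distr torsion_part_def)
    qed
  next
    case (mult a b)
    then show ?case by (simp add: smult_assoc torsion_part_def)
  qed
  then show "a \<odot> x \<in> torsion_part" using x by blast
next
  fix x y assume "x \<in> torsion_part" "y \<in> torsion_part"
  then have xy: "x \<in> carrier M" "y \<in> carrier M" "torsion_elt x" "torsion_elt y" by (auto simp: torsion_part_def)
  have "torsion_elt (x \<oplus> y)"
    unfolding torsion_elt_def
  proof (intro allI impI)
    fix i assume i: "i \<le> n"
    obtain k where "(X i ^^ k) x = \<zero>" "(X i ^^ k) y = \<zero>"
      using torsion_elt_common[OF xy(3,4) i] by auto
    then show "\<exists>k. (X i ^^ k) (x \<oplus> y) = \<zero>"
      using xy i by (intro exI[of _ k]) (simp add: pow_add)
  qed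
  then show "x \<oplus> y \<in> torsion_part" using xy by (simp add: torsion_part_def)
qed (auto simp: torsion_part_def torsion_elt_def intro: exI[of _ 0])

end

section \<open>Grading and torsion of submodules and quotients\<close>

locale weighted_submodule = weighted_module n M d + left_submodule "weyl n" M H
  for n and M :: "('k::field_char_0 weyl_elt, 'm) module" (structure) and d H
begin

sublocale Q: weighted_module n "quot_module M H" d
  by (intro weighted_module.intro weyl_module.intro quot_left_module weighted_module_axioms.intro d_pos)

sublocale Res: weighted_module n "restrict_module M H" d
  by (intro weighted_module.intro weyl_module.intro restrict_left_module weighted_module_axioms.intro d_pos)

lemma Res_simps:
  "carrier (restrict_module M H) = H" "\<zero>\<^bsub>restrict_module M H\<^esub> = \<zero>"
  "ring.add (restrict_module M H) = ring.add M" "module.smult (restrict_module M H) = module.smult M"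
  by (simp_all add: restrict_module_def)

lemma Res_X: "Res.X = X" and Res_S: "Res.S = S" and Res_Eul: "Res.Eul = Eul"
  unfolding Res.X_def X_def Res.S_def S_def Res.Eul_def Eul_def fun_eq_iff Res_simps by simp_all

lemma Res_torsion_elt: "Res.torsion_elt = torsion_elt"
  unfolding Res.torsion_elt_def torsion_elt_def fun_eq_iff Res_X Res_simps by simp

lemma Res_V: "Res.V \<mu> = V \<mu> \<inter> H"
  using sub_carrier unfolding set_eq_iff Res.V_iff by (auto simp: V_iff Res_simps Res_Eul Res_S)

lemma Q_X: "i \<le> n \<Longrightarrow> x \<in> carrier M \<Longrightarrow> Q.X i (coset x) = coset (X i x)"
  unfolding Q.X_def X_def by (simp add: coset_smult weyl_x_closed)

lemma Q_X_pow: "i \<le> n \<Longrightarrow> x \<in> carrier M \<Longrightarrow> (Q.X i ^^ k) (coset x) = coset ((X i ^^ k) x)"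
  by (induction k) (auto simp: Q_X pow_closed)

lemma Q_V: "x \<in> V \<mu> \<Longrightarrow> coset x \<in> Q.V \<mu>"
  by (simp add: Q.V_iff V_iff Q.Eu_smult Eu_smult Q.S_def S_def coset_smult euler_field_closed
      weyl_scalar_closed carrier_quot)

lemma Q_torsion_elt: "x \<in> carrier M \<Longrightarrow> Q.torsion_elt (coset x) \<longleftrightarrow> (\<forall>i\<le>n. \<exists>k. (X i ^^ k) x \<in> H)"
  unfolding Q.torsion_elt_def by (simp add: Q_X_pow zero_quot coset_eq_zero pow_closed)

lemma Q_torsion: "torsion n d (quot_module M H) \<longleftrightarrow> (\<forall>x\<in>carrier M. \<forall>i\<le>n. \<exists>k. (X i ^^ k) x \<in> H)"
  unfolding Q.torsion_iff by (auto simp: carrier_quot Q_torsion_elt)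

lemma Res_torsion: "torsion n d (restrict_module M H) \<longleftrightarrow> H \<subseteq> torsion_part"
  unfolding Res.torsion_iff torsion_part_def Res_torsion_elt using sub_carrier by (auto simp: Res_simps)

lemma Q_esum: "x \<in> esum lam \<Longrightarrow> coset x \<in> Q.esum lam"
proof (induction rule: esum.induct)
  case zero
  show ?case using Q.esum.zero[of lam] by (simp add: coset_zero zero_quot)
next
  case (add e k m)
  then show ?case using Q.esum.add[OF Q_V[OF add(1)] add(3)]
    by (simp add: add_quot coset_add V_carrier esum_carrier)
qed

lemma Q_euler: "euler_module n d lam M \<Longrightarrow> euler_module n d lam (quot_module M H)"
  unfolding euler_module_iff Q.euler_module_iff using Q_esum by (auto simp: carrier_quot)

text \<open>By \<open>component_in_submodule\<close> the homogeneous components of an element of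
  \<open>H\<close> lie in \<open>H\<close>, so its decomposition in \<open>M\<close> is already one
  in \<open>H\<close>.\<close>

lemma Res_euler:
  assumes "euler_module n d lam M" shows "euler_module n d lam (restrict_module M H)"
  unfolding Res.euler_module_iff
proof
  fix x assume "x \<in> carrier (restrict_module M H)"
  then have x: "x \<in> H" "x \<in> esum lam" using assms sub_carrier by (auto simp: Res_simps euler_module_iff)
  then obtain c where c: "\<And>k. c k \<in> V (lam + of_int k)" "finite {k. c k \<noteq> \<zero>}" "x = (\<Oplus>k\<in>{k. c k \<noteq> \<zero>}. c k)"
    using esum_decompose by metis
  have cH: "c k \<in> H" if "k \<in> {k. c k \<noteq> \<zero>}" for k
    using component_in_submodule[OF submod c(2), of c lam k] c x(1) that by simp
  have "(\<Oplus>k\<in>F. c k) \<in> Res.esum lam" if "finite F" "F \<subseteq> {k. c k \<noteq> \<zero>}" for F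
    using that
  proof (induction F rule: finite_induct)
    case empty
    then show ?case using Res.esum.zero by (simp add: Res_simps)
  next
    case (insert k F)
    then have "c k \<in> Res.V (lam + of_int k)" using c cH by (auto simp: Res_V)
    from Res.esum.add[OF this] insert show ?case
      using V_carrier[OF c(1)] by (simp add: Res_simps Pi_iff)
  qed
  from this[OF c(2) subset_refl] show "x \<in> Res.esum lam" by (subst c(3))
qed

lemma Q_torsion_euler:
  "euler_module n d lam M \<Longrightarrow> torsion_euler_module n d lam (quot_module M H) \<longleftrightarrow>
    (\<forall>x\<in>carrier M. \<forall>i\<le>n. \<exists>k. (X i ^^ k) x \<in> H)"
  unfolding torsion_euler_module_def by (simp add: Q_euler Q_torsion)

lemma Res_torsion_euler:
  "euler_module n d lam M \<Longrightarrow> torsion_euler_module n d lam (restrict_module M H) \<longleftrightarrow> H \<subseteq> torsion_part"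
  unfolding torsion_euler_module_def by (simp add: Res_euler Res_torsion)

end

section \<open>Torsion-free modules without global sections\<close>

text \<open>Iterates the two-term Bezout identity. The coefficients say how often each variable or
  derivation is to be applied to change the degree by the gcd.\<close>

lemma bezout_atMost:
  fixes d :: "nat \<Rightarrow> nat"
  shows "\<exists>z :: nat \<Rightarrow> int. (\<Sum>i\<le>k. z i * int (d i)) = int (Gcd (d ` {..k}))"
proof (induction k)
  case 0
  show ?case by (intro exI[of _ "\<lambda>_. 1"]) simp
next
  case (Suc k)
  then obtain z where z: "(\<Sum>i\<le>k. z i * int (d i)) = int (Gcd (d ` {..k}))" by blast
  obtain u v where uv: "u * int (d (Suc k)) + v * int (Gcd (d ` {..k})) = int (gcd (d (Suc k)) (Gcd (d ` {..k})))"
    using bezout_int[of "int (d (Suc k))" "int (Gcd (d ` {..k}))"] by auto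
  have "(\<Sum>i\<le>Suc k. (if i = Suc k then u else v * z i) * int (d i)) =
      u * int (d (Suc k)) + v * (\<Sum>i\<le>k. z i * int (d i))"
    by (simp add: sum_distrib_left mult.assoc)
  then show ?case unfolding z uv
    by (intro exI[of _ "\<lambda>i. if i = Suc k then u else v * z i"]) (simp add: atMost_Suc)
qed

context weighted_module
begin

text \<open>On the kernel of \<open>D i\<close>, applying \<open>D i\<close> to
  \<open>X i ^^ Suc k\<close> gives back a nonzero multiple of \<open>X i ^^ k\<close>, so
  nonvanishing climbs from each power to the next.\<close>

lemma X_pow_nonzero_of_D_zero:
  assumes "i \<le> n" "m \<in> carrier M" "m \<noteq> \<zero>" "D i m = \<zero>"
  shows "(X i ^^ k) m \<noteq> \<zero>"
proof (induction k)
  case (Suc k)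
  have "D i ((X i ^^ Suc k) m) = S (of_nat (Suc k)) ((X i ^^ k) m)"
    using D_X_pow[OF assms(1,2), of k] assms pow_closed(1)[OF assms(1,2)] pow_zero(1)[OF assms(1), of "Suc k"]
    by (simp only: M.l_zero S_closed)
  moreover have "\<dots> \<noteq> \<zero>"
    using Suc pow_closed(1)[OF assms(1,2)] by (simp add: S_eq_zero_iff del: of_nat_Suc)
  ultimately show ?case using D_zero[OF assms(1)] by metis
qed (use assms in simp)

lemma Eul_eq_zero:
  assumes "finite I" "I \<subseteq> {..n}" "m \<in> carrier M" "\<And>i. i \<in> I \<Longrightarrow> D i m = \<zero>"
  shows "Eul I m = \<zero>"
  using assms(1,2,4)
  by (induction I rule: finite_induct) (auto simp: Eul_empty Eul_insert assms(3) X_zero S_zero)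

text \<open>The derivations are treated one after the other: \<open>v\<close> is replaced by its
  last nonzero iterate under \<open>D j\<close>. As derivations commute, those already annihilating
  \<open>v\<close> still do, and the others stay nilpotent on it.\<close>

lemma common_kernel:
  assumes "m \<in> V (lam + of_int l)" "m \<noteq> \<zero>" "\<And>i. i \<le> n \<Longrightarrow> \<exists>k. (D i ^^ k) m = \<zero>"
  shows "\<exists>v l. v \<in> V (lam + of_int l) \<and> v \<noteq> \<zero> \<and> (\<forall>i\<le>n. D i v = \<zero>)"
proof -
  have "\<exists>v l. v \<in> V (lam + of_int l) \<and> v \<noteq> \<zero> \<and> (\<forall>i<j. D i v = \<zero>) \<and> (\<forall>i\<le>n. \<exists>k. (D i ^^ k) v = \<zero>)"
    if "j \<le> Suc n" for j
    using that
  proof (induction j)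
    case 0
    then show ?case using assms by blast
  next
    case (Suc j)
    then obtain v l where v: "v \<in> V (lam + of_int l)" "v \<noteq> \<zero>" "\<And>i. i < j \<Longrightarrow> D i v = \<zero>"
      "\<And>i. i \<le> n \<Longrightarrow> \<exists>k. (D i ^^ k) v = \<zero>" by auto
    have j: "j \<le> n" using Suc.prems by simp
    have vc: "v \<in> carrier M" using v(1) by (rule V_carrier)
    define c where "c = (LEAST k. (D j ^^ k) v = \<zero>)"
    have c: "(D j ^^ c) v = \<zero>" "\<And>b. b < c \<Longrightarrow> (D j ^^ b) v \<noteq> \<zero>"
      unfolding c_def using v(4)[OF j] by (auto intro: LeastI dest: not_less_Least)
    obtain b where b: "c = Suc b" using c(1) v(2) by (cases c) auto
    define w where "w = (D j ^^ b) v"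
    have "w \<in> V (lam + of_int l - of_nat (b * d j))" unfolding w_def using V_D_pow[OF j v(1)] .
    then have "w \<in> V (lam + of_int (l - int (b * d j)))" by (simp add: algebra_simps)
    moreover have "w \<noteq> \<zero>" unfolding w_def using c(2) b by auto
    moreover have "D i w = \<zero>" if "i < Suc j" for i
    proof (cases "i = j")
      case True
      then show ?thesis using c(1) b by (simp add: w_def)
    next
      case False
      then have "D i w = (D j ^^ b) (D i v)" using that j vc by (simp add: w_def D_pow_D)
      then show ?thesis using v(3)[of i] that False j by (simp add: pow_zero)
    qed
    moreover have "\<exists>k. (D i ^^ k) w = \<zero>" if i: "i \<le> n" for i
    proof -
      obtain k where k: "(D i ^^ k) v = \<zero>" using v(4) i by blast
      have "(D i ^^ k) ((D j ^^ b) v) = (D j ^^ b) ((D i ^^ k) v)"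
        by (induction b) (use i j vc in \<open>auto simp: D_pow_D pow_closed\<close>)
      then show ?thesis using k j by (auto simp: w_def pow_zero)
    qed
    ultimately show ?case by blast
  qed
  from this[of "Suc n"] show ?thesis by (auto simp: less_Suc_eq_le)
qed

text \<open>Starting from a common zero of the derivations, the monomial with exponents \<open>b\<close> reaches
  degree \<open>\<lambda>\<close> without dying, because \<open>\<partial>\<^sup>b x\<^sup>b v\<close> is a nonzero multiple of \<open>v\<close>.\<close>

lemma monomial_nonzero:
  assumes "v \<in> V 0" "v \<noteq> \<zero>" "\<And>i. i \<le> n \<Longrightarrow> D i v = \<zero>"
  shows "\<exists>w\<in>V (of_int (\<Sum>i\<le>n. int (b i * d i))). w \<noteq> \<zero>"
proof -
  \<comment> \<open>The powers are multiplied in one variable at a time; the invariant is that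
    derivations in the variables still to come annihilate the current element.\<close>
  have "\<exists>w. w \<in> V (of_int (\<Sum>i<j. int (b i * d i))) \<and> w \<noteq> \<zero> \<and> (\<forall>i\<ge>j. i \<le> n \<longrightarrow> D i w = \<zero>)"
    if "j \<le> Suc n" for j
    using that
  proof (induction j)
    case 0
    then show ?case using assms by auto
  next
    case (Suc j)
    then obtain w where w: "w \<in> V (of_int (\<Sum>i<j. int (b i * d i)))" "w \<noteq> \<zero>"
      "\<And>i. j \<le> i \<Longrightarrow> i \<le> n \<Longrightarrow> D i w = \<zero>" by auto
    have j: "j \<le> n" using Suc.prems by simp
    have wc: "w \<in> carrier M" using w(1) by (rule V_carrier)
    have "(X j ^^ b j) w \<in> V (of_int (\<Sum>i<Suc j. int (b i * d i)))"
      using V_X_pow[OF j w(1), of "b j"] by simp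
    moreover have "(X j ^^ b j) w \<noteq> \<zero>"
      using X_pow_nonzero_of_D_zero[OF j wc w(2)] w(3) j by blast
    moreover have "D i ((X j ^^ b j) w) = \<zero>" if "Suc j \<le> i" "i \<le> n" for i
      using that D_X_pow_neq[of i j w "b j"] w(3)[of i] j wc by (simp add: pow_zero)
    ultimately show ?case by blast
  qed
  from this[of "Suc n"] show ?thesis by (auto simp: lessThan_Suc_atMost)
qed

text \<open>Handles the indices one by one, shifting the degree by \<open>z j * d j\<close> modulo
  \<open>L\<close> at index \<open>j\<close>. Working modulo \<open>L\<close> leaves a choice
  between the variable and the derivation, and one of the two preserves nonvanishing.\<close>

lemma reach_degree_mod:
  fixes z :: "nat \<Rightarrow> int"
  assumes L: "0 < L" and m: "m \<in> V (lam + of_int l)" "m \<noteq> \<zero>"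
  shows "\<exists>w c. w \<in> V (lam + of_int (l + (\<Sum>i\<le>n. z i * int (d i)) + c * L)) \<and> w \<noteq> \<zero>"
proof -
  have "\<exists>w c. w \<in> V (lam + of_int (l + (\<Sum>i<j. z i * int (d i)) + c * L)) \<and> w \<noteq> \<zero>"
    if "j \<le> Suc n" for j
    using that
  proof (induction j)
    case 0
    then show ?case using m by (intro exI[of _ m] exI[of _ 0]) simp
  next
    case (Suc j)
    define s where "s = l + (\<Sum>i<j. z i * int (d i))"
    obtain w c where w: "w \<in> V (lam + of_int (s + c * L))" "w \<noteq> \<zero>"
      using Suc unfolding s_def by auto
    have j: "j \<le> n" using Suc.prems by simp
    have wc: "w \<in> carrier M" using w(1) by (rule V_carrier)
    have eq: "l + (\<Sum>i<Suc j. z i * int (d i)) = s + z j * int (d j)" by (simp add: s_def)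
    \<comment> \<open>Exponents must be natural numbers. Reducing \<open>z j\<close> and
      \<open>- z j\<close> modulo \<open>L\<close> makes both the shift by \<open>a * d j\<close>
      upwards and the shift by \<open>b * d j\<close> downwards congruent to
      \<open>z j * d j\<close>.\<close>
    define a where "a = nat (z j mod L)"
    define b where "b = nat (- z j mod L)"
    have a: "int a = z j - (z j div L) * L" and b: "int b = - z j - (- z j div L) * L"
      using L unfolding a_def b_def by (simp_all add: minus_div_mult_eq_mod)
    \<comment> \<open>If a power of the variable kills \<open>w\<close>, then no power of the
      derivation does.\<close>
    consider "(X j ^^ a) w \<noteq> \<zero>" | "(D j ^^ b) w \<noteq> \<zero>"
      using D_pow_nonzero_of_X_pow_zero[OF j wc w(2)] by blast
    then show ?case
    proof cases
      case 1
      have "(X j ^^ a) w \<in> V (lam + of_int (s + c * L) + of_nat (a * d j))"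
        using V_X_pow[OF j w(1)] .
      also have "lam + of_int (s + c * L) + of_nat (a * d j) = lam + of_int (s + c * L + int a * int (d j))"
        by simp
      also have "s + c * L + int a * int (d j) = s + z j * int (d j) + (c - (z j div L) * int (d j)) * L"
        unfolding a by (simp add: algebra_simps)
      finally show ?thesis using 1 unfolding eq by blast
    next
      case 2
      have "(D j ^^ b) w \<in> V (lam + of_int (s + c * L) - of_nat (b * d j))"
        using V_D_pow[OF j w(1)] .
      also have "lam + of_int (s + c * L) - of_nat (b * d j) = lam + of_int (s + c * L - int b * int (d j))"
        by simp
      also have "s + c * L - int b * int (d j) = s + z j * int (d j) + (c + (- z j div L) * int (d j)) * L"
        unfolding b by (simp add: algebra_simps)
      finally show ?thesis using 2 unfolding eq by blast
    qed
  qed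
  from this[of "Suc n"] show ?thesis by (simp add: lessThan_Suc_atMost)
qed

theorem carrier_trivial:
  assumes euler: "euler_module n d lam M"
    and tf: "\<And>m. m \<in> carrier M \<Longrightarrow> torsion_elt m \<Longrightarrow> m = \<zero>"
    and sec: "V lam = {\<zero>}"
    and gcd: "Gcd (d ` {..n}) = 1"
    and lam: "lam \<in> (UNIV - \<int>) \<union> of_int ` weight_span n d"
  shows "carrier M = {\<zero>}"
proof -
  \<comment> \<open>A multiple of all weights: from degree \<open>- c * L\<close> or
    \<open>c * L\<close> a power of each single variable, respectively derivation, lands exactly in
    the vanishing degree zero part \<open>V lam\<close>.\<close>
  define L where "L = (\<Prod>i\<le>n. d i)"
  have L: "0 < L" unfolding L_def using d_pos by (intro prod_pos) auto
  have dvd: "c * L div d i * d i = c * L" if "i \<le> n" for c i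
    using that unfolding L_def by (intro dvd_div_mult_self dvd_mult dvd_prodI) auto
  have low: "m = \<zero>" if m: "m \<in> V (lam + of_int (- int (c * L)))" for m c
  proof (rule tf)
    show "m \<in> carrier M" using m by (rule V_carrier)
    have "(X i ^^ (c * L div d i)) m = \<zero>" if i: "i \<le> n" for i
    proof -
      have "(X i ^^ (c * L div d i)) m \<in> V (lam + of_int (- int (c * L)) + of_nat (c * L))"
        using V_X_pow[OF i m, of "c * L div d i"] unfolding dvd[OF i] .
      then show ?thesis using sec by simp
    qed
    then show "torsion_elt m" unfolding torsion_elt_def by blast
  qed
  have high: "m = \<zero>" if m: "m \<in> V (lam + of_int (int (c * L)))" for m c
  proof (rule ccontr)
    assume nz: "m \<noteq> \<zero>"
    have "(D i ^^ (c * L div d i)) m = \<zero>" if i: "i \<le> n" for i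
    proof -
      have "(D i ^^ (c * L div d i)) m \<in> V (lam + of_int (int (c * L)) - of_nat (c * L))"
        using V_D_pow[OF i m, of "c * L div d i"] unfolding dvd[OF i] .
      then show ?thesis using sec by simp
    qed
    then obtain v l where v: "v \<in> V (lam + of_int l)" "v \<noteq> \<zero>" "\<And>i. i \<le> n \<Longrightarrow> D i v = \<zero>"
      using common_kernel[OF m nz] by blast
    \<comment> \<open>The Euler field ends in derivations, so it kills \<open>v\<close>; comparing
      with the eigenvalue of \<open>v\<close> shows that \<open>lam\<close> is an integer.\<close>
    have "Eu v = \<zero>" using v(3) by (intro Eul_eq_zero V_carrier[OF v(1)]) auto
    then have "S (lam + of_int l) v = \<zero>" using v(1) by (simp add: V_iff)
    then have l: "lam + of_int l = 0" using v(2) S_eq_zero_iff[OF V_carrier[OF v(1)]] by blast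
    then have "lam = of_int (- l)" by (simp add: eq_neg_iff_add_eq_0)
    then have "lam \<in> \<int>" by (metis Ints_of_int)
    then obtain b :: "nat \<Rightarrow> nat" where b: "lam = of_int (\<Sum>i\<le>n. int (b i * d i))"
      using lam unfolding weight_span_def by auto
    have "v \<in> V 0" using v(1) l by simp
    from monomial_nonzero[OF this v(2,3), of b] sec show False unfolding b by auto
  qed
  have hom: "m = \<zero>" if m: "m \<in> V (lam + of_int l)" for m l
  proof (rule ccontr)
    assume nz: "m \<noteq> \<zero>"
    obtain z :: "nat \<Rightarrow> int" where z: "(\<Sum>i\<le>n. z i * int (d i)) = 1"
      using bezout_atMost[of d n] gcd by auto
    \<comment> \<open>Scaling the Bezout coefficients by \<open>- l\<close> moves degree
      \<open>l\<close> to zero modulo \<open>L\<close>, where \<open>low\<close> or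
      \<open>high\<close> applies according to the sign of \<open>c\<close>.\<close>
    have "(\<Sum>i\<le>n. (- l * z i) * int (d i)) = - l * (\<Sum>i\<le>n. z i * int (d i))"
      by (simp only: sum_distrib_left mult.assoc)
    also have "\<dots> = - l" by (simp add: z)
    finally have sum: "(\<Sum>i\<le>n. (- l * z i) * int (d i)) = - l" .
    obtain w c where w: "w \<in> V (lam + of_int (l + (- l) + c * int L))" "w \<noteq> \<zero>"
      using reach_degree_mod[of "int L" m lam l "\<lambda>i. - l * z i"] L m nz unfolding sum by auto
    show False
    proof (cases "c \<ge> 0")
      case True
      then show ?thesis using high[of w "nat c"] w by simp
    next
      case False
      then show ?thesis using low[of w "nat (- c)"] w by simp
    qed
  qed
  have "m = \<zero>" if "m \<in> esum lam" for m
    using that by (induction rule: esum.induct) (auto dest: hom)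
  then show ?thesis using euler unfolding euler_module_iff by auto
qed

end

section \<open>Morphisms in the quotient category\<close>

lemma Ob_DGrmod: "M \<in> Ob (DGrmod n d lam) \<longleftrightarrow> left_module (weyl n) M \<and> euler_module n d lam M"
  by (simp add: DGrmod_def full_subcat_def LMod_def)

lemma Hom_DGrmod: "Hom (DGrmod n d lam) = mod_hom (weyl n)"
  by (simp add: DGrmod_def full_subcat_def LMod_def)

lemma Ob_DQcoh: "Ob (DQcoh n d lam) = Ob (DGrmod n d lam)"
  and Hom_DQcoh: "Hom (DQcoh n d lam) M N = roofs n d lam M N // roof_rel n d lam M N"
  by (simp_all add: DQcoh_def)

lemma (in weighted_module) weighted_submoduleI:
  "submodule H (weyl n) M \<Longrightarrow> weighted_submodule n M d H"
  by (intro weighted_submodule.intro left_submodule.intro left_submodule_axioms.intro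
      weighted_module_axioms left_module_axioms)

lemma (in weighted_module) cofinal_inter:
  assumes "\<forall>i\<le>n. \<exists>k. (X i ^^ k) x \<in> H" "\<forall>i\<le>n. \<exists>k. (X i ^^ k) x \<in> K"
    and "submodule H (weyl n) M" "submodule K (weyl n) M"
  shows "\<forall>i\<le>n. \<exists>k. (X i ^^ k) x \<in> H \<inter> K"
proof (intro allI impI)
  fix i assume i: "i \<le> n"
  have up: "(X i ^^ (l + k)) x \<in> W" if "(X i ^^ k) x \<in> W" "submodule W (weyl n) M" for l k W
  proof -
    interpret W: weighted_submodule n M d W using that(2) by (rule weighted_submoduleI)
    show ?thesis using that(1)
      by (induction l) (auto simp: X_def W.sub_smult weyl_x_closed i)
  qed
  obtain k l where "(X i ^^ k) x \<in> H" "(X i ^^ l) x \<in> K" using assms i by blast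
  then have "(X i ^^ (l + k)) x \<in> H" "(X i ^^ (k + l)) x \<in> K" using up assms by blast+
  then show "\<exists>k. (X i ^^ k) x \<in> H \<inter> K" by (metis IntI add.commute)
qed

lemma (in weighted_module) submodule_inter:
  assumes "submodule H (weyl n) M" "submodule K (weyl n) M"
  shows "submodule (H \<inter> K) (weyl n) M"
proof -
  interpret H: weighted_submodule n M d H using assms(1) by (rule weighted_submoduleI)
  interpret K: weighted_submodule n M d K using assms(2) by (rule weighted_submoduleI)
  show ?thesis
    by (rule submoduleI)
      (auto simp: H.sub_zero K.sub_zero H.sub_add K.sub_add H.sub_smult K.sub_smult H.sub_carrier)
qed

locale module_pair = M: weighted_module n M d + N: weighted_module n N d
  for n :: nat and d :: "nat \<Rightarrow> nat" and M N :: "('k::field_char_0 weyl_elt, 'm) module" +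
  fixes lam :: 'k
  assumes M_euler: "euler_module n d lam M" and N_euler: "euler_module n d lam N"
begin

text \<open>These are the possible domains of roofs out of \<open>M\<close>: for a submodule
  \<open>H\<close> the power condition says that \<open>quot_module M H\<close> is torsion.\<close>

definition cofinal :: "'m set \<Rightarrow> bool" where
  "cofinal H \<longleftrightarrow> submodule H (weyl n) M \<and> (\<forall>x\<in>carrier M. \<forall>i\<le>n. \<exists>k. (M.X i ^^ k) x \<in> H)"

lemma cofinal_submodule: "cofinal H \<Longrightarrow> submodule H (weyl n) M" by (simp add: cofinal_def)

lemma cofinal_inter: "cofinal H \<Longrightarrow> cofinal K \<Longrightarrow> cofinal (H \<inter> K)"
proof -
  assume *: "cofinal H" "cofinal K"
  then have sub: "submodule H (weyl n) M" "submodule K (weyl n) M" by (auto simp: cofinal_def)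
  have "\<forall>i\<le>n. \<exists>k. (M.X i ^^ k) x \<in> H \<inter> K" if "x \<in> carrier M" for x
    by (rule M.cofinal_inter[OF _ _ sub]) (use * that in \<open>simp_all add: cofinal_def\<close>)
  then show ?thesis unfolding cofinal_def using M.submodule_inter[OF sub] by blast
qed

lemma cofinal_carrier: "cofinal (carrier M)"
  unfolding cofinal_def by (auto intro!: M.submodule_carrier exI[of _ 0])

lemma roof_index_iff: "(H, K) \<in> roof_index n d lam M N \<longleftrightarrow>
    cofinal H \<and> submodule K (weyl n) N \<and> K \<subseteq> N.torsion_part"
proof -
  have "torsion_euler_module n d lam (quot_module M H) \<longleftrightarrow> (\<forall>x\<in>carrier M. \<forall>i\<le>n. \<exists>k. (M.X i ^^ k) x \<in> H)"
    if "submodule H (weyl n) M"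
    using weighted_submodule.Q_torsion_euler[OF M.weighted_submoduleI[OF that] M_euler] .
  moreover have "torsion_euler_module n d lam (restrict_module N K) \<longleftrightarrow> K \<subseteq> N.torsion_part"
    if "submodule K (weyl n) N"
    using weighted_submodule.Res_torsion_euler[OF N.weighted_submoduleI[OF that] N_euler] .
  ultimately show ?thesis unfolding roof_index_def cofinal_def by auto
qed

lemma zero_roof: "(carrier M, {\<zero>\<^bsub>N\<^esub>}, \<lambda>m\<in>carrier M. {\<zero>\<^bsub>N\<^esub>}) \<in> roofs n d lam M N"
proof -
  interpret Z: weighted_submodule n N d "{\<zero>\<^bsub>N\<^esub>}"
    by (rule N.weighted_submoduleI[OF N.submodule_zero])
  have "{\<zero>\<^bsub>N\<^esub>} \<in> carrier (quot_module N {\<zero>\<^bsub>N\<^esub>})"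
    using Z.Q.M.zero_closed unfolding Z.zero_quot .
  moreover have "{\<zero>\<^bsub>N\<^esub>} \<oplus>\<^bsub>quot_module N {\<zero>\<^bsub>N\<^esub>}\<^esub> {\<zero>\<^bsub>N\<^esub>} = {\<zero>\<^bsub>N\<^esub>}"
    using Z.Q.M.l_zero[OF Z.Q.M.zero_closed] unfolding Z.zero_quot .
  moreover have "a \<odot>\<^bsub>quot_module N {\<zero>\<^bsub>N\<^esub>}\<^esub> {\<zero>\<^bsub>N\<^esub>} = {\<zero>\<^bsub>N\<^esub>}" if "a \<in> carrier (weyl n)" for a
    using Z.Q.smult_zero_right[OF that] unfolding Z.zero_quot .
  ultimately show ?thesis
    unfolding roofs_def roof_index_iff
    by (auto simp: cofinal_carrier N.submodule_zero N.torsion_part_def N.torsion_elt_def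
        mod_hom_def restrict_module_def M.smult_closed intro: exI[of _ 0])
qed

lemma quot_class:
  assumes "submodule K (weyl n) N" "C \<in> carrier (quot_module N K)"
  shows "C \<noteq> {}" "C \<subseteq> carrier N"
proof -
  interpret Z: weighted_submodule n N d K using assms(1) by (rule N.weighted_submoduleI)
  obtain x where "x \<in> carrier N" "C = Z.coset x" using assms(2) by (auto simp: Z.carrier_quot)
  then show "C \<noteq> {}" "C \<subseteq> carrier N" using Z.coset_mem Z.coset_subset by auto
qed

text \<open>A roof becomes zero in the colimit once its values on a smaller cofinal submodule are
  torsion, because the submodule divided out of \<open>N\<close> may be enlarged to the whole
  torsion part. If this happens for every roof, all roofs are equivalent.\<close>

lemma hom_singleton:
  assumes van: "\<And>H K f. (H, K, f) \<in> roofs n d lam M N \<Longrightarrow>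
      \<exists>H'. cofinal H' \<and> H' \<subseteq> H \<and> (\<forall>m\<in>H'. f m \<subseteq> N.torsion_part)"
  shows "\<exists>!F. F \<in> Hom (DQcoh n d lam) M N"
proof -
  interpret T: weighted_submodule n N d N.torsion_part
    by (rule N.weighted_submoduleI[OF N.torsion_part_submodule])
  \<comment> \<open>Roof values are nonempty sets, and a nonempty set of torsion elements is
    absorbed by the torsion part, the zero coset of the enlarged quotient.\<close>
  have absorb: "N.torsion_part <+>\<^bsub>N\<^esub> C = N.torsion_part" if C: "C \<noteq> {}" "C \<subseteq> N.torsion_part" for C
  proof
    show "N.torsion_part <+>\<^bsub>N\<^esub> C \<subseteq> N.torsion_part"
      using C T.sub_add unfolding set_add_def' by auto
    show "N.torsion_part \<subseteq> N.torsion_part <+>\<^bsub>N\<^esub> C"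
    proof
      fix t assume t: "t \<in> N.torsion_part"
      obtain c where c: "c \<in> C" using C by auto
      then have cT: "c \<in> N.torsion_part" using C by auto
      have "t = (t \<oplus>\<^bsub>N\<^esub> \<ominus>\<^bsub>N\<^esub> c) \<oplus>\<^bsub>N\<^esub> c"
        using t cT T.sub_carrier by (simp add: N.M.a_assoc N.M.l_neg)
      then show "t \<in> N.torsion_part <+>\<^bsub>N\<^esub> C"
        using T.sub_add[OF t T.sub_minus[OF cT]] c unfolding set_add_def' by blast
    qed
  qed
  have rel: "(r1, r2) \<in> roof_rel n d lam M N"
    if r: "r1 \<in> roofs n d lam M N" "r2 \<in> roofs n d lam M N" for r1 r2
  proof -
    obtain H1 K1 f1 H2 K2 f2 where eq: "r1 = (H1, K1, f1)" "r2 = (H2, K2, f2)"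
      by (cases r1, cases r2) auto
    obtain H1' H2' where H': "cofinal H1'" "H1' \<subseteq> H1" "\<And>m. m \<in> H1' \<Longrightarrow> f1 m \<subseteq> N.torsion_part"
      "cofinal H2'" "H2' \<subseteq> H2" "\<And>m. m \<in> H2' \<Longrightarrow> f2 m \<subseteq> N.torsion_part"
      using van r unfolding eq by meson
    have idx: "(H1, K1) \<in> roof_index n d lam M N" "(H2, K2) \<in> roof_index n d lam M N"
      and f: "f1 \<in> H1 \<rightarrow> carrier (quot_module N K1)" "f2 \<in> H2 \<rightarrow> carrier (quot_module N K2)"
      using r unfolding eq roofs_def mod_hom_def by (auto simp: restrict_module_def)
    have ne: "f1 m \<noteq> {}" "f2 m \<noteq> {}" if "m \<in> H1' \<inter> H2'" for m
      using that H' f idx quot_class(1)[of K1 "f1 m"] quot_class(1)[of K2 "f2 m"]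
      unfolding roof_index_iff by blast+
    have "(H1' \<inter> H2', N.torsion_part) \<in> roof_index n d lam M N"
      unfolding roof_index_iff using H' N.torsion_part_submodule by (simp add: cofinal_inter)
    moreover have "H1' \<inter> H2' \<subseteq> H1 \<inter> H2" "K1 \<union> K2 \<subseteq> N.torsion_part"
      using H' idx unfolding roof_index_iff by auto
    moreover have "\<forall>m\<in>H1' \<inter> H2'. N.torsion_part <+>\<^bsub>N\<^esub> f1 m = N.torsion_part <+>\<^bsub>N\<^esub> f2 m"
      using absorb ne H' by simp
    ultimately show ?thesis using r unfolding eq roof_rel_def by blast
  qed
  have "roof_rel n d lam M N \<subseteq> roofs n d lam M N \<times> roofs n d lam M N"
    unfolding roof_rel_def by auto
  \<comment> \<open>With all roofs related, the only equivalence class is the set of all roofs;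
    \<open>zero_roof\<close> guarantees that it exists.\<close>
  then have "roof_rel n d lam M N `` {r} = roofs n d lam M N" if "r \<in> roofs n d lam M N" for r
    using rel that by blast
  then have "Hom (DQcoh n d lam) M N = {roofs n d lam M N}"
    unfolding Hom_DQcoh quotient_def using zero_roof by auto
  then show ?thesis by auto
qed

text \<open>If \<open>N\<close> is torsion, every roof value consists of torsion elements. If
  \<open>M\<close> is torsion, the zero submodule is cofinal, and a roof restricted to it takes only
  the value \<open>K\<close>.\<close>

lemma hom_singleton_torsion:
  assumes "M.torsion_part = carrier M \<or> N.torsion_part = carrier N"
  shows "\<exists>!F. F \<in> Hom (DQcoh n d lam) M N"
proof (rule hom_singleton)
  fix H K f assume r: "(H, K, f) \<in> roofs n d lam M N"
  then have idx: "cofinal H" "submodule K (weyl n) N" "K \<subseteq> N.torsion_part"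
    and f: "f \<in> mod_hom (weyl n) (restrict_module M H) (quot_module N K)"
    unfolding roofs_def by (auto simp: roof_index_iff)
  interpret H: weighted_submodule n M d H
    by (rule M.weighted_submoduleI[OF cofinal_submodule[OF idx(1)]])
  interpret K: weighted_submodule n N d K by (rule N.weighted_submoduleI[OF idx(2)])
  have fH: "f m \<in> carrier (quot_module N K)" if "m \<in> H" for m
    using f that unfolding mod_hom_def by (auto simp: restrict_module_def)
  show "\<exists>H'. cofinal H' \<and> H' \<subseteq> H \<and> (\<forall>m\<in>H'. f m \<subseteq> N.torsion_part)"
    using assms
  proof
    assume "N.torsion_part = carrier N"
    then show ?thesis using idx(1) fH quot_class(2)[OF idx(2)] by (intro exI[of _ H]) auto
  next
    assume tors: "M.torsion_part = carrier M"
    \<comment> \<open>Zero is written as a multiple of itself so that linearity of \<open>f\<close>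
      determines its value there.\<close>
    have "f (\<zero>\<^bsub>weyl n\<^esub> \<odot>\<^bsub>M\<^esub> \<zero>\<^bsub>M\<^esub>) = \<zero>\<^bsub>weyl n\<^esub> \<odot>\<^bsub>quot_module N K\<^esub> f \<zero>\<^bsub>M\<^esub>"
      using f H.sub_zero M.R.zero_closed unfolding mod_hom_def by (auto simp: restrict_module_def)
    then have "f \<zero>\<^bsub>M\<^esub> = K"
      using K.Q.smult_zero_left[OF fH[OF H.sub_zero]] by (simp add: M.smult_zero_left K.zero_quot)
    moreover have "cofinal {\<zero>\<^bsub>M\<^esub>}"
      using tors unfolding cofinal_def M.torsion_part_def M.torsion_elt_def
      by (auto simp: M.submodule_zero)
    ultimately show ?thesis using idx H.sub_zero by (intro exI[of _ "{\<zero>\<^bsub>M\<^esub>}"]) auto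
  qed
qed

end

section \<open>Zero objects of the quotient category\<close>

locale euler_object = weighted_module n M d
  for n and M :: "('k::field_char_0 weyl_elt, 'm) module" and d +
  fixes lam :: 'k
  assumes euler: "euler_module n d lam M"
begin

text \<open>Cosets of the zero submodule are singletons, so sending \<open>m\<close> to
  \<open>{m}\<close> is the identity homomorphism in roof form.\<close>

lemma id_roof: "(carrier M, {\<zero>\<^bsub>M\<^esub>}, \<lambda>m\<in>carrier M. {m}) \<in> roofs n d lam M M"
proof -
  interpret module_pair n d M M lam by unfold_locales (rule euler)+
  interpret Z: weighted_submodule n M d "{\<zero>\<^bsub>M\<^esub>}"
    by (rule weighted_submoduleI[OF submodule_zero])
  have c: "Z.coset x = {x}" if "x \<in> carrier M" for x
    using that by (auto simp: Z.mem_coset)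
  have "{x} \<in> carrier (quot_module M {\<zero>\<^bsub>M\<^esub>})" if "x \<in> carrier M" for x
    using that c by (auto simp: Z.carrier_quot)
  moreover have "{x} \<oplus>\<^bsub>quot_module M {\<zero>\<^bsub>M\<^esub>}\<^esub> {y} = {x \<oplus>\<^bsub>M\<^esub> y}" if "x \<in> carrier M" "y \<in> carrier M" for x y
    using Z.coset_add[OF that] that by (simp add: c Z.add_quot)
  moreover have "a \<odot>\<^bsub>quot_module M {\<zero>\<^bsub>M\<^esub>}\<^esub> {x} = {a \<odot>\<^bsub>M\<^esub> x}"
    if "a \<in> carrier (weyl n)" "x \<in> carrier M" for a x
    using Z.coset_smult[OF that] that by (simp add: c smult_closed)
  ultimately show ?thesis
    unfolding roofs_def roof_index_iff
    by (auto simp: cofinal_carrier submodule_zero torsion_part_def torsion_elt_def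
        mod_hom_def restrict_module_def smult_closed intro: exI[of _ 0])
qed

text \<open>If the identity and zero roofs agree in the colimit, some cofinal \<open>H\<close>
  consists of torsion elements. Powers of each variable carry any element into \<open>H\<close>,
  where further powers kill it.\<close>

lemma torsion_of_hom_singleton:
  assumes "\<exists>!F. F \<in> Hom (DQcoh n d lam) M M"
  shows "torsion_part = carrier M"
proof -
  interpret P: module_pair n d M M lam by unfold_locales (rule euler)+
  interpret T: weighted_submodule n M d torsion_part
    by (rule weighted_submoduleI[OF torsion_part_submodule])
  let ?r = "(carrier M, {\<zero>\<^bsub>M\<^esub>}, \<lambda>m\<in>carrier M. {m})"
  let ?z = "(carrier M, {\<zero>\<^bsub>M\<^esub>}, \<lambda>m\<in>carrier M. {\<zero>\<^bsub>M\<^esub>})"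
  have "roof_rel n d lam M M `` {?r} \<in> Hom (DQcoh n d lam) M M"
    "roof_rel n d lam M M `` {?z} \<in> Hom (DQcoh n d lam) M M"
    unfolding Hom_DQcoh by (rule quotientI[OF id_roof], rule quotientI[OF P.zero_roof])
  then have eq: "roof_rel n d lam M M `` {?r} = roof_rel n d lam M M `` {?z}" using assms by blast
  have "(carrier M, {\<zero>\<^bsub>M\<^esub>}) \<in> roof_index n d lam M M"
    using id_roof unfolding roofs_def by auto
  then have "(?z, ?z) \<in> roof_rel n d lam M M"
    using P.zero_roof unfolding roof_rel_def by blast
  then have "(?r, ?z) \<in> roof_rel n d lam M M" using eq by blast
  then obtain H K where HK: "(H, K) \<in> roof_index n d lam M M" "H \<subseteq> carrier M"
    "\<And>m. m \<in> H \<Longrightarrow> K <+>\<^bsub>M\<^esub> {m} = K <+>\<^bsub>M\<^esub> {\<zero>\<^bsub>M\<^esub>}"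
    unfolding roof_rel_def by (auto simp: subset_iff)
  have cof: "P.cofinal H" "submodule K (weyl n) M" "K \<subseteq> torsion_part"
    using HK(1) unfolding P.roof_index_iff by auto
  interpret K: weighted_submodule n M d K by (rule weighted_submoduleI[OF cof(2)])
  have HT: "m \<in> torsion_part" if m: "m \<in> H" for m
  proof -
    have mc: "m \<in> carrier M" using m HK(2) by auto
    have "m \<in> K <+>\<^bsub>M\<^esub> {m}"
      using K.sub_zero mc unfolding set_add_def' by (auto intro!: bexI[of _ "\<zero>\<^bsub>M\<^esub>"])
    then have "m \<in> K <+>\<^bsub>M\<^esub> {\<zero>\<^bsub>M\<^esub>}" unfolding HK(3)[OF m] .
    then have "\<exists>k\<in>K. m = k \<oplus>\<^bsub>M\<^esub> \<zero>\<^bsub>M\<^esub>" unfolding set_add_def' by simp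
    then obtain k where "k \<in> K" "m = k \<oplus>\<^bsub>M\<^esub> \<zero>\<^bsub>M\<^esub>" ..
    then have "m \<in> K" using K.sub_carrier by simp
    then show ?thesis using cof(3) by auto
  qed
  have "x \<in> torsion_part" if x: "x \<in> carrier M" for x
  proof -
    have "\<exists>k. (X i ^^ k) x = \<zero>\<^bsub>M\<^esub>" if i: "i \<le> n" for i
    proof -
      obtain k where "(X i ^^ k) x \<in> H" using cof(1) x i unfolding P.cofinal_def by blast
      from HT[OF this] obtain l where "(X i ^^ l) ((X i ^^ k) x) = \<zero>\<^bsub>M\<^esub>"
        using i by (auto simp: torsion_part_def torsion_elt_def)
      then show ?thesis by (metis comp_apply funpow_add)
    qed
    then show ?thesis using x by (simp add: torsion_part_def torsion_elt_def)
  qed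
  then show ?thesis using T.sub_carrier by blast
qed

lemma in_Ob: "M \<in> Ob (DGrmod n d lam)"
  using euler left_module_axioms by (simp add: Ob_DGrmod)

lemma zero_object_of_torsion:
  assumes "torsion_part = carrier M"
  shows "zero_object (DQcoh n d lam) M"
  unfolding zero_object_def Ob_DQcoh
proof (intro conjI ballI in_Ob)
  fix A :: "('k weyl_elt, 'm) module" assume "A \<in> Ob (DGrmod n d lam)"
  then have A: "left_module (weyl n) A" "euler_module n d lam A" by (auto simp: Ob_DGrmod)
  interpret A: weighted_module n A d
    by (intro weighted_module.intro weyl_module.intro A weighted_module_axioms.intro d_pos)
  interpret AM: module_pair n d A M lam by unfold_locales (rule A euler)+
  interpret MA: module_pair n d M A lam by unfold_locales (rule A euler)+
  show "\<exists>!F. F \<in> Hom (DQcoh n d lam) A M" "\<exists>!F. F \<in> Hom (DQcoh n d lam) M A"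
    using AM.hom_singleton_torsion MA.hom_singleton_torsion assms by auto
qed

lemma submodule_object:
  assumes "submodule H (weyl n) M"
  shows "euler_object n (restrict_module M H) d lam"
proof -
  interpret H: weighted_submodule n M d H by (rule weighted_submoduleI[OF assms])
  show ?thesis
    by (intro euler_object.intro H.Res.weighted_module_axioms euler_object_axioms.intro H.Res_euler euler)
qed

text \<open>The inclusion and the zero map are both homomorphisms from \<open>H\<close> to
  \<open>M\<close>, so uniqueness identifies them.\<close>

lemma submodule_eq_zero:
  assumes H: "submodule H (weyl n) M"
    and one: "\<exists>!f. f \<in> mod_hom (weyl n) (restrict_module M H) M"
  shows "H = {\<zero>\<^bsub>M\<^esub>}"
proof -
  interpret H: weighted_submodule n M d H by (rule weighted_submoduleI[OF H])
  have "(\<lambda>x\<in>H. x) \<in> mod_hom (weyl n) (restrict_module M H) M"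
    "(\<lambda>x\<in>H. \<zero>\<^bsub>M\<^esub>) \<in> mod_hom (weyl n) (restrict_module M H) M"
    unfolding mod_hom_def
    by (auto simp: H.Res_simps H.sub_carrier H.sub_add H.sub_smult smult_zero_right)
  then have "(\<lambda>x\<in>H. x) = (\<lambda>x\<in>H. \<zero>\<^bsub>M\<^esub>)" using one by blast
  then have "x = \<zero>\<^bsub>M\<^esub>" if "x \<in> H" for x using that by (metis restrict_apply')
  then show ?thesis using H.sub_zero by blast
qed

end

lemma euler_objectI:
  assumes "M \<in> Ob (DGrmod n d lam)" "\<And>i. i \<le> n \<Longrightarrow> 0 < d i"
  shows "euler_object n M d lam"
  using assms unfolding Ob_DGrmod
  by (intro euler_object.intro weighted_module.intro weyl_module.intro weighted_module_axioms.intro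
      euler_object_axioms.intro) auto

lemma bij_betw_ex1:
  assumes "bij_betw f A B" shows "(\<exists>!x. x \<in> A) \<longleftrightarrow> (\<exists>!y. y \<in> B)"
proof -
  have f: "inj_on f A" "B = f ` A" using assms by (auto simp: bij_betw_def)
  show ?thesis
  proof
    assume "\<exists>!x. x \<in> A"
    then obtain x where "A = {x}" by auto
    then show "\<exists>!y. y \<in> B" by (simp add: f(2))
  next
    assume "\<exists>!y. y \<in> B"
    then obtain y where fA: "f ` A = {y}" unfolding f(2) by auto
    have "f x = y" if "x \<in> A" for x using fA that by blast
    then have "x = x'" if "x \<in> A" "x' \<in> A" for x x'
      using that by (intro inj_onD[OF f(1)]) auto
    moreover have "A \<noteq> {}" using fA by auto
    ultimately show "\<exists>!x. x \<in> A" by blast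
  qed
qed

section \<open>The kernel of global sections\<close>

lemma adjoint_ob:
  assumes "right_adjoint (DGrmod n d lam) (DQcoh n d lam) (quot_functor n d lam) \<omega>"
    and "B \<in> Ob (DGrmod n d lam)"
  shows "fob \<omega> B \<in> Ob (DGrmod n d lam)"
proof -
  have "is_functor (DQcoh n d lam) (DGrmod n d lam) \<omega>"
    using assms(1) unfolding right_adjoint_def by blast
  from is_functor.fob_in[OF this] assms(2) show ?thesis by (simp add: Ob_DQcoh)
qed

text \<open>The quotient functor is the identity on objects, so the adjunction compares morphisms
  from \<open>A\<close> to \<open>B\<close> in the quotient category directly with homomorphisms
  from \<open>A\<close> to \<open>fob \<omega> B\<close>.\<close>

lemma adjoint_hom_singleton:
  assumes "right_adjoint (DGrmod n d lam) (DQcoh n d lam) (quot_functor n d lam) \<omega>"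
    and "A \<in> Ob (DGrmod n d lam)" "B \<in> Ob (DGrmod n d lam)"
  shows "(\<exists>!F. F \<in> Hom (DQcoh n d lam) A B) \<longleftrightarrow> (\<exists>!f. f \<in> mod_hom (weyl n) A (fob \<omega> B))"
proof -
  obtain \<phi> where "\<forall>A\<in>Ob (DGrmod n d lam). \<forall>B\<in>Ob (DQcoh n d lam).
      bij_betw (\<phi> A B) (Hom (DQcoh n d lam) (fob (quot_functor n d lam) A) B) (Hom (DGrmod n d lam) A (fob \<omega> B))"
    using assms(1) unfolding right_adjoint_def by blast
  then have "bij_betw (\<phi> A B) (Hom (DQcoh n d lam) A B) (mod_hom (weyl n) A (fob \<omega> B))"
    using assms(2,3) by (simp add: Ob_DQcoh Hom_DGrmod quot_functor_def)
  then show ?thesis by (rule bij_betw_ex1)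
qed

lemma Ob_ker_global_sections:
  "A \<in> Ob (ker_global_sections n d lam \<omega>) \<longleftrightarrow>
    A \<in> Ob (DGrmod n d lam) \<and> eigenspace n d (fob \<omega> A) lam = {\<zero>\<^bsub>fob \<omega> A\<^esub>}"
  by (simp add: ker_global_sections_def full_subcat_def Ob_DQcoh zero_module_def
      global_sections_def eigenspace_module_def)

theorem zero_object_of_no_sections:
  fixes \<omega> :: "(('k::field_char_0 weyl_elt, 'm) module, 'm roof set, ('k weyl_elt, 'm) module, 'm \<Rightarrow> 'm) cat_functor"
  assumes d_pos: "\<And>i. i \<le> n \<Longrightarrow> 0 < d i"
    and adj: "right_adjoint (DGrmod n d lam) (DQcoh n d lam) (quot_functor n d lam) \<omega>"
    and gcd: "Gcd (d ` {..n}) = 1"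
    and lam: "lam \<in> (UNIV - \<int>) \<union> of_int ` weight_span n d"
    and A: "A \<in> Ob (ker_global_sections n d lam \<omega>)"
  shows "zero_object (DQcoh n d lam) A"
proof -
  have AO: "A \<in> Ob (DGrmod n d lam)" and sec: "eigenspace n d (fob \<omega> A) lam = {\<zero>\<^bsub>fob \<omega> A\<^esub>}"
    using A unfolding Ob_ker_global_sections by auto
  interpret A: euler_object n A d lam by (rule euler_objectI[OF AO d_pos])
  interpret N: euler_object n "fob \<omega> A" d lam by (rule euler_objectI[OF adjoint_ob[OF adj AO] d_pos])
  interpret T: weighted_submodule n "fob \<omega> A" d N.torsion_part
    by (rule N.weighted_submoduleI[OF N.torsion_part_submodule])
  interpret TO: euler_object n "restrict_module (fob \<omega> A) N.torsion_part" d lam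
    by (rule N.submodule_object[OF N.torsion_part_submodule])
  have "T.Res.torsion_part = carrier (restrict_module (fob \<omega> A) N.torsion_part)"
    unfolding T.Res.torsion_part_def T.Res_torsion_elt T.Res_simps by (auto simp: N.torsion_part_def)
  \<comment> \<open>The torsion part of \<open>fob \<omega> A\<close> is a zero object, hence has
    one morphism to \<open>A\<close>. By adjunction it then has only one homomorphism into
    \<open>fob \<omega> A\<close>, so its inclusion is zero.\<close>
  from TO.zero_object_of_torsion[OF this]
  have "\<exists>!F. F \<in> Hom (DQcoh n d lam) (restrict_module (fob \<omega> A) N.torsion_part) A"
    using AO unfolding zero_object_def Ob_DQcoh by blast
  then have "N.torsion_part = {\<zero>\<^bsub>fob \<omega> A\<^esub>}"
    using N.submodule_eq_zero[OF N.torsion_part_submodule]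
      adjoint_hom_singleton[OF adj TO.in_Ob AO] by blast
  then have "m = \<zero>\<^bsub>fob \<omega> A\<^esub>" if "m \<in> carrier (fob \<omega> A)" "N.torsion_elt m" for m
    using that unfolding N.torsion_part_def by blast
  then have triv: "carrier (fob \<omega> A) = {\<zero>\<^bsub>fob \<omega> A\<^esub>}"
    by (intro N.carrier_trivial[OF N.euler _ sec gcd lam])
  have "f = (\<lambda>x\<in>carrier A. \<zero>\<^bsub>fob \<omega> A\<^esub>)" if "f \<in> mod_hom (weyl n) A (fob \<omega> A)" for f
    using that unfolding mod_hom_def triv by (auto simp: PiE_iff extensional_def fun_eq_iff)
  moreover have "(\<lambda>x\<in>carrier A. \<zero>\<^bsub>fob \<omega> A\<^esub>) \<in> mod_hom (weyl n) A (fob \<omega> A)"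
    unfolding mod_hom_def by (auto simp: A.smult_closed N.smult_zero_right)
  ultimately have "\<exists>!f. f \<in> mod_hom (weyl n) A (fob \<omega> A)" by blast
  then have "\<exists>!F. F \<in> Hom (DQcoh n d lam) A A"
    using adjoint_hom_singleton[OF adj AO AO] by blast
  then show ?thesis by (intro A.zero_object_of_torsion A.torsion_of_hom_singleton)
qed

text \<open>The last hypothesis says that \<open>B\<close> has no nonzero sections of degree \<open>\<lambda>\<close> over the complement
  of the origin: \<open>g i / x\<^sub>i\<^sup>k\<close> would be such a section.\<close>

theorem nonzero_object_without_sections:
  fixes \<omega> :: "(('k::field_char_0 weyl_elt, 'm) module, 'm roof set, ('k weyl_elt, 'm) module, 'm \<Rightarrow> 'm) cat_functor"
    and B :: "('k weyl_elt, 'm) module"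
  assumes B: "euler_object n B d lam"
    and adj: "right_adjoint (DGrmod n d lam) (DQcoh n d lam) (quot_functor n d lam) \<omega>"
    and tf: "weighted_module.torsion_part n B = {\<zero>\<^bsub>B\<^esub>}" and nz: "carrier B \<noteq> {\<zero>\<^bsub>B\<^esub>}"
    and sec: "\<And>k g. \<lbrakk>\<And>i. i \<le> n \<Longrightarrow> g i \<in> eigenspace n d B (lam + of_nat (k * d i));
        \<And>i j. i \<le> n \<Longrightarrow> j \<le> n \<Longrightarrow>
          (weyl_module.X n B j ^^ k) (g i) = (weyl_module.X n B i ^^ k) (g j)\<rbrakk>
        \<Longrightarrow> \<forall>i\<le>n. g i = \<zero>\<^bsub>B\<^esub>"
  shows "\<exists>A\<in>Ob (ker_global_sections n d lam \<omega>). \<not> zero_object (DQcoh n d lam) A"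
proof -
  interpret B: euler_object n B d lam by (rule B)
  interpret N: euler_object n "fob \<omega> B" d lam
    by (rule euler_objectI[OF adjoint_ob[OF adj B.in_Ob] B.d_pos])
  interpret Z: weighted_submodule n B d "{\<zero>\<^bsub>B\<^esub>}" by (rule B.weighted_submoduleI[OF B.submodule_zero])
  have "u = \<zero>\<^bsub>fob \<omega> B\<^esub>" if u: "u \<in> N.V lam" for u
  proof -
    have uc: "u \<in> carrier (fob \<omega> B)" using u by (rule N.V_carrier)
    \<comment> \<open>The submodule generated by \<open>u\<close>. Once it has a single morphism to
      \<open>B\<close> in the quotient category, the adjunction leaves a single homomorphism from it
      into \<open>fob \<omega> B\<close>, and the inclusion forces \<open>u\<close> to be
      zero.\<close>
    define U where "U = {a \<odot>\<^bsub>fob \<omega> B\<^esub> u | a. a \<in> carrier (weyl n)}"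
    have U: "submodule U (weyl n) (fob \<omega> B)"
    proof (rule N.submoduleI)
      show "\<zero>\<^bsub>fob \<omega> B\<^esub> \<in> U"
        unfolding U_def using N.smult_zero_left[OF uc] B.R.zero_closed by force
    next
      fix x y assume "x \<in> U" "y \<in> U"
      then obtain a b where "a \<in> carrier (weyl n)" "b \<in> carrier (weyl n)"
        "x = a \<odot>\<^bsub>fob \<omega> B\<^esub> u" "y = b \<odot>\<^bsub>fob \<omega> B\<^esub> u" by (auto simp: U_def)
      then show "x \<oplus>\<^bsub>fob \<omega> B\<^esub> y \<in> U"
        unfolding U_def using N.smult_l_distr[OF _ _ uc] B.R.a_closed by (auto intro!: exI[of _ "a \<oplus>\<^bsub>weyl n\<^esub> b"])
    next
      fix a :: "'k weyl_elt" and x assume "a \<in> carrier (weyl n)" "x \<in> U"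
      moreover then obtain b where "b \<in> carrier (weyl n)" "x = b \<odot>\<^bsub>fob \<omega> B\<^esub> u" by (auto simp: U_def)
      ultimately show "a \<odot>\<^bsub>fob \<omega> B\<^esub> x \<in> U"
        unfolding U_def using N.smult_assoc[OF _ _ uc] B.R.m_closed by (auto intro!: exI[of _ "a \<otimes>\<^bsub>weyl n\<^esub> b"])
    qed (auto simp: U_def uc N.smult_closed)
    have uU: "u \<in> U" unfolding U_def using N.smult_one[OF uc] B.R.one_closed by force
    let ?L = "restrict_module (fob \<omega> B) U"
    interpret U: weighted_submodule n "fob \<omega> B" d U by (rule N.weighted_submoduleI[OF U])
    interpret L: euler_object n ?L d lam by (rule N.submodule_object[OF U])
    interpret P: module_pair n d ?L B lam by unfold_locales (rule L.euler B.euler)+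
    have "\<exists>!F. F \<in> Hom (DQcoh n d lam) ?L B"
    proof (rule P.hom_singleton)
      fix H K f assume "(H, K, f) \<in> roofs n d lam ?L B"
      then have idx: "P.cofinal H" "submodule K (weyl n) B" "K \<subseteq> {\<zero>\<^bsub>B\<^esub>}"
        and f: "f \<in> mod_hom (weyl n) (restrict_module ?L H) (quot_module B K)"
        unfolding roofs_def by (auto simp: P.roof_index_iff tf)
      interpret H: weighted_submodule n ?L d H
        by (rule U.Res.weighted_submoduleI[OF P.cofinal_submodule[OF idx(1)]])
      interpret K: weighted_submodule n B d K by (rule B.weighted_submoduleI[OF idx(2)])
      \<comment> \<open>\<open>B\<close> has no torsion, so roofs into it divide out nothing and
        \<open>f\<close> amounts to an honest homomorphism \<open>g\<close> from \<open>H\<close> to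
        \<open>B\<close>.\<close>
      have K: "K = {\<zero>\<^bsub>B\<^esub>}" using idx(3) K.sub_zero by auto
      note f = f[unfolded K]
      have HU: "H \<subseteq> U" using H.sub_carrier by (auto simp: U.Res_simps)
      have f_closed: "f x \<in> carrier (quot_module B {\<zero>\<^bsub>B\<^esub>})" if "x \<in> H" for x
        using f that unfolding mod_hom_def by (auto simp: restrict_module_def)
      have f_add: "f (x \<oplus>\<^bsub>fob \<omega> B\<^esub> y) = f x \<oplus>\<^bsub>quot_module B {\<zero>\<^bsub>B\<^esub>}\<^esub> f y" if "x \<in> H" "y \<in> H" for x y
        using f that unfolding mod_hom_def by (auto simp: restrict_module_def)
      have f_smult: "f (a \<odot>\<^bsub>fob \<omega> B\<^esub> x) = a \<odot>\<^bsub>quot_module B {\<zero>\<^bsub>B\<^esub>}\<^esub> f x"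
        if "a \<in> carrier (weyl n)" "x \<in> H" for a x
        using f that unfolding mod_hom_def by (auto simp: restrict_module_def)
      have coset: "Z.coset x = {x}" if "x \<in> carrier B" for x using that by (auto simp: Z.mem_coset)
      have "\<exists>y. y \<in> carrier B \<and> f x = {y}" if x: "x \<in> H" for x
        using f_closed[OF x] coset unfolding Z.carrier_quot by auto
      then obtain g where g: "\<And>x. x \<in> H \<Longrightarrow> g x \<in> carrier B" "\<And>x. x \<in> H \<Longrightarrow> f x = {g x}"
        by metis
      have g_smult: "g (a \<odot>\<^bsub>fob \<omega> B\<^esub> x) = a \<odot>\<^bsub>B\<^esub> g x" if a: "a \<in> carrier (weyl n)" and x: "x \<in> H" for a x
      proof -
        have ax: "a \<odot>\<^bsub>fob \<omega> B\<^esub> x \<in> H" using H.sub_smult[OF a x] by (simp add: U.Res_simps)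
        have "f (a \<odot>\<^bsub>fob \<omega> B\<^esub> x) = {a \<odot>\<^bsub>B\<^esub> g x}"
          using f_smult[OF a x] Z.coset_smult[OF a g(1)[OF x]] g(1)[OF x] a
          by (simp add: g(2)[OF x] coset B.smult_closed)
        then show ?thesis using g(2)[OF ax] by simp
      qed
      have g_X: "g (N.X i x) = B.X i (g x)" "N.X i x \<in> H" if "i \<le> n" "x \<in> H" for i x
        using that g_smult[OF weyl_x_closed, of i x] H.sub_smult[OF weyl_x_closed, of i x]
        by (auto simp: N.X_def B.X_def U.Res_simps)
      have g_X_pow: "g ((N.X i ^^ k) x) = (B.X i ^^ k) (g x) \<and> (N.X i ^^ k) x \<in> H" if "i \<le> n" "x \<in> H" for i k x
        by (induction k) (use g_X that in auto)
      have g_V: "g x \<in> B.V \<mu>" if "x \<in> N.V \<mu>" "x \<in> H" for x \<mu>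
        using that g_smult[OF B.euler_field_closed, of x] g_smult[OF weyl_scalar_closed, of x \<mu>] g(1)[of x]
        unfolding eigenspace_def by auto
      \<comment> \<open>The kernel of \<open>g\<close>; the goal is that it is still cofinal in
        \<open>U\<close>.\<close>
      define H' where "H' = {x \<in> H. g x = \<zero>\<^bsub>B\<^esub>}"
      have H': "submodule H' (weyl n) ?L"
      proof (rule U.Res.submoduleI)
        show "\<zero>\<^bsub>?L\<^esub> \<in> H'"
          using g_smult[OF B.R.zero_closed H.sub_zero] H.sub_zero g(1)[OF H.sub_zero]
          by (simp add: H'_def U.Res_simps N.smult_zero_left B.smult_zero_left)
      next
        fix x y assume xy: "x \<in> H'" "y \<in> H'"
        then have xyH: "x \<in> H" "y \<in> H" "x \<oplus>\<^bsub>fob \<omega> B\<^esub> y \<in> H"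
          using H.sub_add by (auto simp: H'_def U.Res_simps)
        have "f (x \<oplus>\<^bsub>fob \<omega> B\<^esub> y) = {\<zero>\<^bsub>B\<^esub>}"
          using f_add[OF xyH(1,2)] g(2)[OF xyH(1)] g(2)[OF xyH(2)] xy Z.Q.M.l_zero[OF Z.Q.M.zero_closed]
          by (simp add: H'_def Z.zero_quot)
        then show "x \<oplus>\<^bsub>?L\<^esub> y \<in> H'" using g(2)[OF xyH(3)] xyH by (simp add: H'_def U.Res_simps)
      next
        fix a :: "'k weyl_elt" and x assume "a \<in> carrier (weyl n)" "x \<in> H'"
        then show "a \<odot>\<^bsub>?L\<^esub> x \<in> H'"
          using H.sub_smult[of a x] by (auto simp: H'_def U.Res_simps g_smult B.smult_zero_right)
      qed (use HU in \<open>auto simp: H'_def U.Res_simps\<close>)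
      interpret H': weighted_submodule n ?L d H' by (rule U.Res.weighted_submoduleI[OF H'])
      have "\<forall>i\<in>{..n}. \<exists>k. (N.X i ^^ k) u \<in> H"
        using idx(1) uU unfolding P.cofinal_def by (auto simp: U.Res_simps U.Res_X)
      then obtain k0 where k0: "\<And>i. i \<le> n \<Longrightarrow> (N.X i ^^ k0 i) u \<in> H" by (metis atMost_iff)
      \<comment> \<open>The sum bounds every \<open>k0 i\<close>, giving one exponent that serves
        all variables.\<close>
      define k where "k = (\<Sum>i\<le>n. k0 i)"
      have uH: "(N.X i ^^ k) u \<in> H" if i: "i \<le> n" for i
      proof -
        have "k0 i \<le> k" unfolding k_def using i by (intro member_le_sum) auto
        then have "(N.X i ^^ k) u = (N.X i ^^ (k - k0 i)) ((N.X i ^^ k0 i) u)"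
          using funpow_add[of "k - k0 i" "k0 i" "N.X i"] by simp
        then show ?thesis using g_X_pow[OF i k0[OF i]] by simp
      qed
      \<comment> \<open>The elements \<open>g ((N.X i ^^ k) u)\<close> behave like numerators of one
        section on the charts: they agree after cross multiplication because the variables commute,
        so \<open>sec\<close> annihilates them.\<close>
      have "\<forall>i\<le>n. g ((N.X i ^^ k) u) = \<zero>\<^bsub>B\<^esub>"
      proof (rule sec)
        fix i assume "i \<le> n"
        then show "g ((N.X i ^^ k) u) \<in> B.V (lam + of_nat (k * d i))"
          by (intro g_V uH N.V_X_pow u)
      next
        fix i j assume ij: "i \<le> n" "j \<le> n"
        show "(B.X j ^^ k) (g ((N.X i ^^ k) u)) = (B.X i ^^ k) (g ((N.X j ^^ k) u))"
          using g_X_pow[OF ij(2) uH[OF ij(1)], of k] g_X_pow[OF ij(1) uH[OF ij(2)], of k]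
            N.X_pow_pow[OF ij uc, of k k] by simp
      qed
      then have "\<forall>i\<le>n. \<exists>k. (U.Res.X i ^^ k) u \<in> H'"
        using uH unfolding U.Res_X H'_def by auto
      \<comment> \<open>A power of each variable takes \<open>u\<close> into \<open>H'\<close>, so
        the class of \<open>u\<close> modulo \<open>H'\<close> is torsion. Torsion classes form a
        submodule and \<open>u\<close> generates \<open>U\<close>, whence all of \<open>U\<close> is
        torsion modulo \<open>H'\<close>.\<close>
      then have "H'.coset u \<in> H'.Q.torsion_part"
        using H'.Q_torsion_elt[of u] uU unfolding H'.Q.torsion_part_def by (auto simp: U.Res_simps H'.carrier_quot)
      moreover interpret QT: weighted_submodule n "quot_module ?L H'" d H'.Q.torsion_part
        by (rule H'.Q.weighted_submoduleI[OF H'.Q.torsion_part_submodule])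
      have "H'.coset x \<in> H'.Q.torsion_part" if xU: "x \<in> U" for x
      proof -
        obtain a where a: "a \<in> carrier (weyl n)" "x = a \<odot>\<^bsub>?L\<^esub> u"
          using xU unfolding U_def by (auto simp: restrict_module_def)
        then show ?thesis
          using QT.sub_smult[OF a(1) calculation] H'.coset_smult[OF a(1), of u] uU by (simp add: U.Res_simps)
      qed
      then have "P.cofinal H'"
        unfolding P.cofinal_def using H' H'.Q_torsion_elt
        by (auto simp: H'.Q.torsion_part_def U.Res_simps)
      moreover have "f m \<subseteq> B.torsion_part" if "m \<in> H'" for m
        using that g(2)[of m] by (auto simp: H'_def tf)
      ultimately show "\<exists>H'. P.cofinal H' \<and> H' \<subseteq> H \<and> (\<forall>m\<in>H'. f m \<subseteq> B.torsion_part)"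
        by (intro exI[of _ H']) (auto simp: H'_def)
    qed
    then have "\<exists>!f. f \<in> mod_hom (weyl n) ?L (fob \<omega> B)"
      using adjoint_hom_singleton[OF adj L.in_Ob B.in_Ob] by blast
    from N.submodule_eq_zero[OF U this] show ?thesis using uU by blast
  qed
  then have "N.V lam = {\<zero>\<^bsub>fob \<omega> B\<^esub>}" using N.V_zero by blast
  then have "B \<in> Ob (ker_global_sections n d lam \<omega>)"
    unfolding Ob_ker_global_sections using B.in_Ob by blast
  moreover have "\<not> zero_object (DQcoh n d lam) B"
  proof
    assume "zero_object (DQcoh n d lam) B"
    then have "\<exists>!F. F \<in> Hom (DQcoh n d lam) B B"
      using B.in_Ob unfolding zero_object_def Ob_DQcoh by blast
    from B.torsion_of_hom_singleton[OF this] show False using tf nz by simp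
  qed
  ultimately show ?thesis by blast
qed

section \<open>Modules of Laurent polynomials with twisted derivations\<close>

text \<open>A function \<open>f\<close> on exponents stands for \<open>\<Sum>\<^sub>a f(a) x\<^bsup>\<alpha>+a\<^esup>\<close>.\<close>

fun gen_act :: "(nat \<Rightarrow> 'k::field) \<Rightarrow> weyl_gen \<Rightarrow> ((nat \<Rightarrow> int) \<Rightarrow> 'k) \<Rightarrow> (nat \<Rightarrow> int) \<Rightarrow> 'k" where
  "gen_act \<alpha> (Var i) f = (\<lambda>a. f (a(i := a i - 1)))"
| "gen_act \<alpha> (Der i) f = (\<lambda>a. (\<alpha> i + of_int (a i) + 1) * f (a(i := a i + 1)))"

definition word_act :: "(nat \<Rightarrow> 'k::field) \<Rightarrow> weyl_gen word \<Rightarrow> ((nat \<Rightarrow> int) \<Rightarrow> 'k) \<Rightarrow> (nat \<Rightarrow> int) \<Rightarrow> 'k"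
  where "word_act \<alpha> w = foldr (gen_act \<alpha>) (letters w)"

definition free_act :: "(nat \<Rightarrow> 'k::field) \<Rightarrow> 'k free_alg \<Rightarrow> ((nat \<Rightarrow> int) \<Rightarrow> 'k) \<Rightarrow> (nat \<Rightarrow> int) \<Rightarrow> 'k"
  where "free_act \<alpha> p f = (\<lambda>a. \<Sum>w\<in>Poly_Mapping.keys p. Poly_Mapping.lookup p w * word_act \<alpha> w f a)"

section \<open>Extending the action to the free algebra and descending to the Weyl algebra\<close>

lemma gen_act_linear:
  "gen_act \<alpha> g (\<lambda>a. f a + f' a) = (\<lambda>a. gen_act \<alpha> g f a + gen_act \<alpha> g f' a)"
  "gen_act \<alpha> g (\<lambda>a. c * f a) = (\<lambda>a. c * gen_act \<alpha> g f a)"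
  by (cases g; simp add: algebra_simps)+

lemma word_act_linear:
  "word_act \<alpha> w (\<lambda>a. f a + f' a) = (\<lambda>a. word_act \<alpha> w f a + word_act \<alpha> w f' a)"
  "word_act \<alpha> w (\<lambda>a. c * f a) = (\<lambda>a. c * word_act \<alpha> w f a)"
proof -
  have "foldr (gen_act \<alpha>) gs (\<lambda>a. f a + f' a) = (\<lambda>a. foldr (gen_act \<alpha>) gs f a + foldr (gen_act \<alpha>) gs f' a)"
    "foldr (gen_act \<alpha>) gs (\<lambda>a. c * f a) = (\<lambda>a. c * foldr (gen_act \<alpha>) gs f a)" for gs
    by (induction gs) (simp_all add: gen_act_linear)
  then show "word_act \<alpha> w (\<lambda>a. f a + f' a) = (\<lambda>a. word_act \<alpha> w f a + word_act \<alpha> w f' a)"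
    "word_act \<alpha> w (\<lambda>a. c * f a) = (\<lambda>a. c * word_act \<alpha> w f a)"
    by (simp_all add: word_act_def)
qed

lemma free_act_superset:
  "finite F \<Longrightarrow> Poly_Mapping.keys p \<subseteq> F \<Longrightarrow>
    free_act \<alpha> p f a = (\<Sum>w\<in>F. Poly_Mapping.lookup p w * word_act \<alpha> w f a)"
  unfolding free_act_def by (rule sum.mono_neutral_left) (auto simp: in_keys_iff)

lemma free_act_add: "free_act \<alpha> (p + q) f = (\<lambda>a. free_act \<alpha> p f a + free_act \<alpha> q f a)"
proof
  fix a
  let ?F = "Poly_Mapping.keys p \<union> Poly_Mapping.keys q"
  show "free_act \<alpha> (p + q) f a = free_act \<alpha> p f a + free_act \<alpha> q f a"
    using keys_add[of p q]
    by (simp add: free_act_superset[of ?F] lookup_add distrib_right sum.distrib)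
qed

lemma free_act_single: "free_act \<alpha> (Poly_Mapping.single w c) f = (\<lambda>a. c * word_act \<alpha> w f a)"
  by (rule ext) (simp add: free_act_superset[of "{w}"] split: if_splits)

lemma free_act_linear:
  "free_act \<alpha> p (\<lambda>a. f a + f' a) = (\<lambda>a. free_act \<alpha> p f a + free_act \<alpha> p f' a)"
  "free_act \<alpha> p (\<lambda>a. c * f a) = (\<lambda>a. c * free_act \<alpha> p f a)"
  by (simp_all add: free_act_def word_act_linear distrib_left sum.distrib sum_distrib_left algebra_simps)

text \<open>Both sides are additive in \<open>p\<close> and in \<open>q\<close>; on monomials the
  claim is that concatenated words act by composition.\<close>

lemma free_act_mult: "free_act \<alpha> (p * q) f = free_act \<alpha> p (free_act \<alpha> q f)"
proof (induction p rule: poly_mapping_add_induct)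
  case (single u b)
  show ?case
  proof (induction q rule: poly_mapping_add_induct)
    case (single v c)
    have "word_act \<alpha> (u + v) f = word_act \<alpha> u (word_act \<alpha> v f)" by (simp add: word_act_def)
    then show ?case by (simp add: mult_single free_act_single word_act_linear mult.assoc)
  qed (simp add: distrib_left free_act_add free_act_linear)
qed (simp add: distrib_right free_act_add)

lemma free_act_uminus: "free_act \<alpha> (- p) f = (\<lambda>a. - free_act \<alpha> p f a)"
  by (simp add: free_act_def sum_negf)

lemma free_act_diff: "free_act \<alpha> (p - q) f = (\<lambda>a. free_act \<alpha> p f a - free_act \<alpha> q f a)"
  using free_act_add[of \<alpha> p "- q" f] by (simp add: free_act_uminus)

lemma free_act_0: "free_act \<alpha> 0 f = (\<lambda>_. 0)"
  by (simp add: free_act_def)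

lemma free_act_scalar: "free_act \<alpha> (Poly_Mapping.single 0 c) f = (\<lambda>a. c * f a)"
  by (simp add: free_act_single word_act_def)

lemma free_act_1: "free_act \<alpha> 1 f = f"
  using free_act_scalar[of \<alpha> 1 f] by simp

lemma free_act_x: "free_act \<alpha> (free_x i) f = gen_act \<alpha> (Var i) f"
  and free_act_d: "free_act \<alpha> (free_d i) f = gen_act \<alpha> (Der i) f"
  by (simp_all add: free_x_def free_d_def free_act_single word_act_def)

lemma free_act_sum: "free_act \<alpha> (sum p I) f = (\<lambda>a. \<Sum>i\<in>I. free_act \<alpha> (p i) f a)"
  by (induction I rule: infinite_finite_induct) (simp_all add: free_act_0 free_act_add)

lemma free_act_relation:
  assumes "r \<in> weyl_relations n" shows "free_act \<alpha> r f = (\<lambda>_. 0)"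
proof -
  have "free_act \<alpha> (free_x i * free_x j - free_x j * free_x i) f = (\<lambda>_. 0)" for i j
    by (cases "i = j") (auto simp: free_act_diff free_act_mult free_act_x free_act_0 fun_upd_twist)
  moreover have "free_act \<alpha> (free_d i * free_d j - free_d j * free_d i) f = (\<lambda>_. 0)" for i j
    by (cases "i = j") (auto simp: free_act_diff free_act_mult free_act_d free_act_0 fun_upd_twist)
  moreover have "free_act \<alpha> (free_d i * free_x j - free_x j * free_d i - (if i = j then 1 else 0)) f = (\<lambda>_. 0)" for i j
    by (cases "i = j")
      (auto simp: free_act_diff free_act_mult free_act_d free_act_x free_act_1 free_act_0 free_act_add fun_upd_twist algebra_simps)
  ultimately show ?thesis using assms unfolding weyl_relations_def by auto
qed

text \<open>The elements that annihilate every function form a two-sided ideal containing the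
  defining relations, hence containing the ideal they generate.\<close>

lemma free_act_ideal:
  assumes "p \<in> weyl_ideal n" shows "free_act \<alpha> p f = (\<lambda>_. 0)"
proof -
  define K where "K = {p \<in> carrier (free_algebra n). \<forall>f. free_act \<alpha> p f = (\<lambda>_. 0)}"
  have lin0: "free_act \<alpha> q (\<lambda>_. 0) = (\<lambda>_. 0)" for q
    using free_act_linear(2)[of \<alpha> q 0] by simp
  interpret F: ring "free_algebra n" by (rule free_algebra_ring)
  have "ideal K (free_algebra n)"
  proof (rule idealI[OF free_algebra_ring])
    show "subgroup K (add_monoid (free_algebra n))"
    proof (rule F.add.subgroupI)
      fix p assume "p \<in> K"
      then show "\<ominus>\<^bsub>free_algebra n\<^esub> p \<in> K"
        by (auto simp: K_def free_algebra_a_inv free_act_uminus free_algebra_uminus)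
    qed (auto simp: K_def free_act_add free_algebra_add free_act_0 intro: free_algebra_zero)
  qed (auto simp: K_def free_act_mult free_algebra_mult lin0)
  then have "weyl_ideal n \<subseteq> K"
    unfolding weyl_ideal_def
    by (rule F.genideal_minimal) (use weyl_relations_closed free_act_relation in \<open>auto simp: K_def\<close>)
  then show ?thesis using assms by (auto simp: K_def)
qed

text \<open>A class acts through a chosen representative; \<open>free_act_ideal\<close> makes the
  result independent of the choice.\<close>

definition weyl_act :: "(nat \<Rightarrow> 'k::field) \<Rightarrow> 'k weyl_elt \<Rightarrow> ((nat \<Rightarrow> int) \<Rightarrow> 'k) \<Rightarrow> (nat \<Rightarrow> int) \<Rightarrow> 'k"
  where "weyl_act \<alpha> C = free_act \<alpha> (SOME p. p \<in> C)"

lemma weyl_act_class: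
  assumes p: "p \<in> carrier (free_algebra n)"
  shows "weyl_act \<alpha> (weyl_class n p) f = free_act \<alpha> p f"
proof -
  interpret I: ideal "weyl_ideal n" "free_algebra n" by (rule weyl_ideal_ideal)
  define q where "q = (SOME q. q \<in> weyl_class n p)"
  have "q \<in> weyl_class n p"
    unfolding q_def using I.a_rcos_self[OF p] by (intro someI) (simp add: weyl_class_def)
  then obtain h where "h \<in> weyl_ideal n" "q = h + p"
    unfolding weyl_class_def a_r_coset_def r_coset_def by auto
  then show ?thesis by (simp add: weyl_act_def free_act_add free_act_ideal flip: q_def)
qed

lemma weyl_act_add: "a \<in> carrier (weyl n) \<Longrightarrow> b \<in> carrier (weyl n) \<Longrightarrow>
    weyl_act \<alpha> (a \<oplus>\<^bsub>weyl n\<^esub> b) f = (\<lambda>x. weyl_act \<alpha> a f x + weyl_act \<alpha> b f x)"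
  unfolding carrier_weyl
  by (auto simp: weyl_act_class free_algebra_add free_act_add simp flip: weyl_class_add)

lemma weyl_act_mult: "a \<in> carrier (weyl n) \<Longrightarrow> b \<in> carrier (weyl n) \<Longrightarrow>
    weyl_act \<alpha> (a \<otimes>\<^bsub>weyl n\<^esub> b) f = weyl_act \<alpha> a (weyl_act \<alpha> b f)"
  unfolding carrier_weyl
  by (auto simp: weyl_act_class free_algebra_mult free_act_mult simp flip: weyl_class_mult)

lemma weyl_act_linear: "a \<in> carrier (weyl n) \<Longrightarrow>
    weyl_act \<alpha> a (\<lambda>x. f x + f' x) = (\<lambda>x. weyl_act \<alpha> a f x + weyl_act \<alpha> a f' x)"
  unfolding carrier_weyl by (auto simp: weyl_act_class free_act_linear)

lemma weyl_act_one: "weyl_act \<alpha> \<one>\<^bsub>weyl n\<^esub> f = f"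
  by (simp add: weyl_act_class free_algebra_one free_act_1 flip: weyl_class_one)

lemma weyl_act_scalar: "weyl_act \<alpha> (weyl_scalar n c) f = (\<lambda>x. c * f x)"
  by (simp add: weyl_scalar_def weyl_act_class free_scalar_closed free_act_scalar)

lemma weyl_act_x: "i \<le> n \<Longrightarrow> weyl_act \<alpha> (weyl_x n i) f = gen_act \<alpha> (Var i) f"
  and weyl_act_d: "i \<le> n \<Longrightarrow> weyl_act \<alpha> (weyl_d n i) f = gen_act \<alpha> (Der i) f"
  by (simp_all add: weyl_x_def weyl_d_def weyl_act_class free_x_closed free_d_closed free_act_x free_act_d)

text \<open>The span of the monomials with exponent \<open>\<alpha> + a\<close>, for
  \<open>a\<close> in \<open>E\<close>. Closure downwards is required only where the derivation does
  not kill the monomial, which admits polynomials as well as Laurent polynomials.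
  \<open>weight\<close> puts all Euler eigenvalues into \<open>lam\<close> plus integers, and
  \<open>h\<close> codes the coefficient functions as elements of the universe type.\<close>

locale laurent_module =
  fixes n :: nat and d :: "nat \<Rightarrow> nat" and lam :: "'k::field_char_0" and \<alpha> :: "nat \<Rightarrow> 'k"
    and E :: "(nat \<Rightarrow> int) set" and h :: "((nat \<Rightarrow> int) \<Rightarrow> 'k) \<Rightarrow> 'm"
  assumes d_pos: "i \<le> n \<Longrightarrow> 0 < d i"
    and E_nonempty: "E \<noteq> {}"
    and E_up: "a \<in> E \<Longrightarrow> i \<le> n \<Longrightarrow> a(i := a i + 1) \<in> E"
    and E_down: "a \<in> E \<Longrightarrow> i \<le> n \<Longrightarrow> \<alpha> i + of_int (a i) \<noteq> 0 \<Longrightarrow> a(i := a i - 1) \<in> E"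
    and weight: "a \<in> E \<Longrightarrow> \<exists>k. (\<Sum>i\<le>n. of_nat (d i) * (\<alpha> i + of_int (a i))) = lam + of_int k"
    and h_inj: "inj_on h {f. finite {a. f a \<noteq> 0} \<and> {a. f a \<noteq> 0} \<subseteq> E}"
begin

definition C :: "((nat \<Rightarrow> int) \<Rightarrow> 'k) set"
  where "C = {f. finite {a. f a \<noteq> 0} \<and> {a. f a \<noteq> 0} \<subseteq> E}"

definition wt :: "(nat \<Rightarrow> int) \<Rightarrow> 'k" where "wt a = (\<Sum>i\<le>n. of_nat (d i) * (\<alpha> i + of_int (a i)))"

abbreviation h' :: "'m \<Rightarrow> (nat \<Rightarrow> int) \<Rightarrow> 'k" where "h' \<equiv> inv_into C h"

definition B :: "('k weyl_elt, 'm) module" where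
  "B = \<lparr>carrier = h ` C, monoid.mult = undefined, one = undefined, ring.zero = h (\<lambda>_. 0),
     ring.add = (\<lambda>x y. h (\<lambda>a. h' x a + h' y a)), module.smult = (\<lambda>a x. h (weyl_act \<alpha> a (h' x)))\<rparr>"

lemma C_I: "finite F \<Longrightarrow> {a. f a \<noteq> 0} \<subseteq> F \<Longrightarrow> {a. f a \<noteq> 0} \<subseteq> E \<Longrightarrow> f \<in> C"
  unfolding C_def by (auto intro: finite_subset)

lemma C_zero: "(\<lambda>_. 0) \<in> C" by (simp add: C_def)

lemma C_add: assumes "f \<in> C" "g \<in> C" shows "(\<lambda>a. f a + g a) \<in> C"
proof -
  have "{a. f a + g a \<noteq> 0} \<subseteq> {a. f a \<noteq> 0} \<union> {a. g a \<noteq> 0}" by auto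
  then show ?thesis using assms by (intro C_I[of "{a. f a \<noteq> 0} \<union> {a. g a \<noteq> 0}"]) (auto simp: C_def)
qed

lemma C_scale: "f \<in> C \<Longrightarrow> (\<lambda>a. c * f a) \<in> C"
  by (rule C_I[of "{a. f a \<noteq> 0}"]) (auto simp: C_def)

lemma C_x: assumes "f \<in> C" "i \<le> n" shows "gen_act \<alpha> (Var i) f \<in> C"
proof (rule C_I[of "(\<lambda>a. a(i := a i + 1)) ` {a. f a \<noteq> 0}"])
  show sub: "{a. gen_act \<alpha> (Var i) f a \<noteq> 0} \<subseteq> (\<lambda>a. a(i := a i + 1)) ` {a. f a \<noteq> 0}"
  proof
    fix a assume "a \<in> {a. gen_act \<alpha> (Var i) f a \<noteq> 0}"
    then show "a \<in> (\<lambda>a. a(i := a i + 1)) ` {a. f a \<noteq> 0}"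
      by (intro image_eqI[of _ _ "a(i := a i - 1)"]) auto
  qed
  show "{a. gen_act \<alpha> (Var i) f a \<noteq> 0} \<subseteq> E"
    using sub assms E_up by (auto simp: C_def)
qed (use assms in \<open>auto simp: C_def\<close>)

lemma C_d: assumes "f \<in> C" "i \<le> n" shows "gen_act \<alpha> (Der i) f \<in> C"
proof (rule C_I[of "(\<lambda>a. a(i := a i - 1)) ` {a. f a \<noteq> 0}"])
  show "{a. gen_act \<alpha> (Der i) f a \<noteq> 0} \<subseteq> (\<lambda>a. a(i := a i - 1)) ` {a. f a \<noteq> 0}"
  proof
    fix a assume "a \<in> {a. gen_act \<alpha> (Der i) f a \<noteq> 0}"
    then show "a \<in> (\<lambda>a. a(i := a i - 1)) ` {a. f a \<noteq> 0}"
      by (intro image_eqI[of _ _ "a(i := a i + 1)"]) auto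
  qed
  show "{a. gen_act \<alpha> (Der i) f a \<noteq> 0} \<subseteq> E"
  proof
    fix a assume "a \<in> {a. gen_act \<alpha> (Der i) f a \<noteq> 0}"
    then have "a(i := a i + 1) \<in> E" "\<alpha> i + of_int (a i) + 1 \<noteq> 0" using assms by (auto simp: C_def)
    from E_down[OF this(1) assms(2)] this(2) show "a \<in> E" by (simp add: add.assoc)
  qed
qed (use assms in \<open>auto simp: C_def\<close>)

lemma C_weyl:
  assumes "a \<in> carrier (weyl n)" "f \<in> C" shows "weyl_act \<alpha> a f \<in> C"
proof -
  have "\<forall>f\<in>C. weyl_act \<alpha> a f \<in> C"
    using assms(1)
    by (induction a rule: weyl_induct)
      (auto simp: weyl_act_scalar weyl_act_x weyl_act_d weyl_act_add weyl_act_mult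
         C_scale C_add C_x C_d simp del: gen_act.simps)
  then show ?thesis using assms(2) by blast
qed

lemma h'_h: "f \<in> C \<Longrightarrow> h' (h f) = f"
  using h_inj by (intro inv_into_f_f) (simp_all add: C_def)

lemma carrier_B: "carrier B = h ` C"
  and zero_B: "\<zero>\<^bsub>B\<^esub> = h (\<lambda>_. 0)"
  by (simp_all add: B_def)

lemma add_B: "f \<in> C \<Longrightarrow> g \<in> C \<Longrightarrow> h f \<oplus>\<^bsub>B\<^esub> h g = h (\<lambda>a. f a + g a)"
  and smult_B: "f \<in> C \<Longrightarrow> w \<odot>\<^bsub>B\<^esub> h f = h (weyl_act \<alpha> w f)"
  by (simp_all add: B_def h'_h)

lemma h_eq: "f \<in> C \<Longrightarrow> g \<in> C \<Longrightarrow> h f = h g \<longleftrightarrow> f = g"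
  using h'_h by metis

lemma B_left_module: "left_module (weyl n) B"
proof -
  have "abelian_group B"
  proof (rule abelian_groupI)
    fix x assume "x \<in> carrier B"
    then obtain f where f: "f \<in> C" "x = h f" by (auto simp: carrier_B)
    then show "\<exists>y\<in>carrier B. y \<oplus>\<^bsub>B\<^esub> x = \<zero>\<^bsub>B\<^esub>"
      using C_scale[of f "- 1"] by (intro bexI[of _ "h (\<lambda>a. - 1 * f a)"]) (auto simp: carrier_B add_B zero_B)
  qed (auto simp: carrier_B zero_B add_B C_zero C_add algebra_simps)
  then show ?thesis
    unfolding left_module_def left_module_axioms_def using weyl_ring
    by (auto simp: carrier_B add_B smult_B C_weyl C_add weyl_act_add weyl_act_mult weyl_act_linear weyl_act_one)
qed

sublocale B: weighted_module n B d
  by (intro weighted_module.intro weyl_module.intro weighted_module_axioms.intro B_left_module d_pos)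

lemma X_B: "i \<le> n \<Longrightarrow> f \<in> C \<Longrightarrow> B.X i (h f) = h (gen_act \<alpha> (Var i) f)"
  by (simp add: B.X_def smult_B weyl_act_x)

lemma X_pow_B: "i \<le> n \<Longrightarrow> f \<in> C \<Longrightarrow>
    (B.X i ^^ k) (h f) = h (\<lambda>a. f (a(i := a i - int k))) \<and> (\<lambda>a. f (a(i := a i - int k))) \<in> C"
proof (induction k)
  case (Suc k)
  have eq: "gen_act \<alpha> (Var i) (\<lambda>a. f (a(i := a i - int k))) = (\<lambda>a. f (a(i := a i - int (Suc k))))"
    by (simp add: algebra_simps)
  note IH = Suc.IH[OF Suc.prems, THEN conjunct1] Suc.IH[OF Suc.prems, THEN conjunct2]
  have "(B.X i ^^ Suc k) (h f) = h (gen_act \<alpha> (Var i) (\<lambda>a. f (a(i := a i - int k))))"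
    unfolding funpow.simps comp_apply IH(1) by (rule X_B[OF Suc.prems(1) IH(2)])
  moreover have "gen_act \<alpha> (Var i) (\<lambda>a. f (a(i := a i - int k))) \<in> C"
    by (rule C_x[OF IH(2) Suc.prems(1)])
  ultimately show ?case unfolding eq by (rule conjI)
qed simp

text \<open>The operator consisting of \<open>D i\<close> followed by \<open>X i\<close> multiplies
  a monomial by its exponent \<open>\<alpha> i + a i\<close>, so monomials are Euler eigenvectors
  with eigenvalue \<open>wt a\<close>.\<close>

lemma Eu_B:
  assumes "f \<in> C" shows "B.Eu (h f) = h (\<lambda>a. wt a * f a)"
proof -
  have nat_eq: "of_nat k = (Poly_Mapping.single 0 (of_nat k) :: 'k free_alg)" for k by simp
  have "free_act \<alpha> (of_nat (d i) * free_x i * free_d i) f = (\<lambda>a. of_nat (d i) * (\<alpha> i + of_int (a i)) * f a)" for i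
    unfolding nat_eq free_act_mult free_act_scalar free_act_x free_act_d by (simp add: mult.assoc)
  then have "free_act \<alpha> (\<Sum>i\<le>n. of_nat (d i) * free_x i * free_d i) f = (\<lambda>a. wt a * f a)"
    by (simp add: free_act_sum wt_def sum_distrib_right)
  moreover have "(\<Sum>i\<le>n. of_nat (d i) * free_x i * free_d i :: 'k free_alg) \<in> carrier (free_algebra n)"
    by (intro free_algebra_sum B.Eul_term_closed) simp
  ultimately show ?thesis
    unfolding B.Eul_def smult_B[OF assms] by (simp add: weyl_act_class)
qed

lemma V_B: "f \<in> C \<Longrightarrow> h f \<in> B.V \<mu> \<longleftrightarrow> (\<forall>a. f a \<noteq> 0 \<longrightarrow> wt a = \<mu>)"
proof -
  assume f: "f \<in> C"
  have "(\<lambda>a. wt a * f a) \<in> C" using f by (intro C_I[of "{a. f a \<noteq> 0}"]) (auto simp: C_def)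
  then have "h f \<in> B.V \<mu> \<longleftrightarrow> (\<lambda>a. wt a * f a) = (\<lambda>a. \<mu> * f a)"
    using f by (simp add: B.V_iff Eu_B B.S_def smult_B weyl_act_scalar carrier_B h_eq C_scale)
  then show ?thesis by (auto simp: fun_eq_iff)
qed

lemma B_euler: "euler_module n d lam B"
  unfolding B.euler_module_iff
proof
  fix x assume "x \<in> carrier B"
  then obtain f where f: "f \<in> C" "x = h f" by (auto simp: carrier_B)
  \<comment> \<open>One monomial at a time is split off the support; each is an eigenvector.\<close>
  have "h f \<in> B.esum lam" if "finite F" "{a. f a \<noteq> 0} \<subseteq> F" "F \<subseteq> E" for F f
    using that
  proof (induction F arbitrary: f rule: finite_induct)
    case empty
    then have "f = (\<lambda>_. 0)" by auto
    then show ?case using B.esum.zero by (simp add: zero_B)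
  next
    case (insert b F)
    define e where "e = (\<lambda>a. if a = b then f b else 0)"
    define g where "g = f(b := 0)"
    have C: "e \<in> C" "g \<in> C"
      using insert.prems insert.hyps by (auto simp: e_def g_def intro!: C_I[of "insert b F"] split: if_splits)
    have "h g \<in> B.esum lam" using insert by (intro insert.IH) (auto simp: g_def)
    moreover have "\<exists>k. wt b = lam + of_int k" using weight[of b] insert.prems unfolding wt_def by simp
    then obtain k where "wt b = lam + of_int k" ..
    then have "h e \<in> B.V (lam + of_int k)" unfolding V_B[OF C(1)] by (auto simp: e_def)
    ultimately have "h e \<oplus>\<^bsub>B\<^esub> h g \<in> B.esum lam" by (rule B.esum.add[rotated])
    moreover have "(\<lambda>a. e a + g a) = f" by (auto simp: e_def g_def)
    ultimately show ?case by (simp add: add_B C)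
  qed
  then show "x \<in> B.esum lam" using f by (auto simp: C_def)
qed

sublocale B: euler_object n B d lam
  by (intro euler_object.intro euler_object_axioms.intro B.weighted_module_axioms B_euler)

lemma B_torsion_free: "B.torsion_part = {\<zero>\<^bsub>B\<^esub>}"
proof -
  have "f = (\<lambda>_. 0)" if f: "f \<in> C" "B.torsion_elt (h f)" for f
  proof
    fix a
    \<comment> \<open>One variable already decides: it acts by shifting exponents, which is
      injective.\<close>
    obtain k where "(B.X 0 ^^ k) (h f) = \<zero>\<^bsub>B\<^esub>" using f(2) unfolding B.torsion_elt_def by blast
    then have "(\<lambda>a. f (a(0 := a 0 - int k))) = (\<lambda>_. 0)"
      using X_pow_B[of 0 f k] f(1) C_zero h_eq by (simp add: zero_B)
    from fun_cong[OF this, of "a(0 := a 0 + int k)"] show "f a = 0" by simp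
  qed
  then have "B.torsion_part \<subseteq> {\<zero>\<^bsub>B\<^esub>}"
    unfolding B.torsion_part_def carrier_B zero_B by blast
  moreover have "\<zero>\<^bsub>B\<^esub> \<in> B.torsion_part"
    unfolding B.torsion_part_def B.torsion_elt_def by (auto simp: B.pow_zero)
  ultimately show ?thesis by blast
qed

lemma B_nonzero: "carrier B \<noteq> {\<zero>\<^bsub>B\<^esub>}"
proof -
  obtain b where b: "b \<in> E" using E_nonempty by blast
  define e :: "(nat \<Rightarrow> int) \<Rightarrow> 'k" where "e = (\<lambda>a. if a = b then 1 else 0)"
  have "e \<in> C" using b by (auto simp: e_def intro!: C_I[of "{b}"] split: if_splits)
  moreover have "e \<noteq> (\<lambda>_. 0)" by (auto simp: e_def fun_eq_iff)
  ultimately show ?thesis using h_eq[OF _ C_zero, of e] by (auto simp: carrier_B zero_B)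
qed

text \<open>If the monomial \<open>a\<close> occurs in \<open>g i\<close>, compatibility with
  \<open>g j\<close> makes \<open>a\<close> lowered by \<open>k\<close> at \<open>i\<close> and
  raised by \<open>k\<close> at \<open>j\<close> an exponent of \<open>g j\<close>, hence a member
  of \<open>E\<close>. The hypothesis \<open>comb\<close> excludes such an \<open>a\<close> of the
  required weight.\<close>

lemma B_no_sections:
  assumes comb: "\<And>k i a. \<lbrakk>i \<le> n; a \<in> E; wt a = lam + of_nat (k * d i);
      \<And>j. j \<le> n \<Longrightarrow> j \<noteq> i \<Longrightarrow> a(i := a i - int k, j := a j + int k) \<in> E\<rbrakk> \<Longrightarrow> False"
    and gV: "\<And>i. i \<le> n \<Longrightarrow> g i \<in> B.V (lam + of_nat (k * d i))"
    and comp: "\<And>i j. i \<le> n \<Longrightarrow> j \<le> n \<Longrightarrow> (B.X j ^^ k) (g i) = (B.X i ^^ k) (g j)"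
  shows "\<forall>i\<le>n. g i = \<zero>\<^bsub>B\<^esub>"
proof -
  have "\<forall>i\<le>n. \<exists>f. f \<in> C \<and> g i = h f" using gV B.V_carrier by (fastforce simp: carrier_B)
  then obtain f where f: "\<And>i. i \<le> n \<Longrightarrow> f i \<in> C" "\<And>i. i \<le> n \<Longrightarrow> g i = h (f i)" by metis
  have "f i a = 0" if i: "i \<le> n" for i a
  proof (rule ccontr)
    assume nz: "f i a \<noteq> 0"
    have a: "a \<in> E" "wt a = lam + of_nat (k * d i)"
      using f(1)[OF i] nz V_B[OF f(1)[OF i]] gV[OF i] unfolding f(2)[OF i] by (auto simp: C_def)
    have "a(i := a i - int k, j := a j + int k) \<in> E" if j: "j \<le> n" "j \<noteq> i" for j
    proof -
      have "(\<lambda>a. f i (a(j := a j - int k))) = (\<lambda>a. f j (a(i := a i - int k)))"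
        using comp[OF i j(1)] X_pow_B[OF j(1) f(1)[OF i], of k] X_pow_B[OF i f(1)[OF j(1)], of k]
        unfolding f(2)[OF i] f(2)[OF j(1)] by (simp add: h_eq)
      \<comment> \<open>At this exponent the left side is the nonzero coefficient
        \<open>f i a\<close>.\<close>
      from fun_cong[OF this, of "a(j := a j + int k)"] j(2) nz
      have "f j (a(j := a j + int k, i := a i - int k)) \<noteq> 0" by simp
      then have "a(j := a j + int k, i := a i - int k) \<in> E" using f(1)[OF j(1)] by (auto simp: C_def)
      then show ?thesis using fun_upd_twist[OF j(2), of a] by simp
    qed
    then show False using comb i a by blast
  qed
  then have "f i = (\<lambda>_. 0)" if "i \<le> n" for i using that by auto
  then show ?thesis using f(2) by (simp add: zero_B)
qed

end

section \<open>Objects with vanishing global sections\<close>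

lemma inj_on_map_list:
  fixes E :: "(nat \<Rightarrow> int) set"
  assumes "\<And>a. a \<in> E \<Longrightarrow> \<forall>i>n. a i = 0"
  shows "inj_on (\<lambda>a. map a [0..<Suc n]) E"
proof (rule inj_onI, rule ext)
  fix a b i assume ab: "a \<in> E" "b \<in> E" and eq: "map a [0..<Suc n] = map b [0..<Suc n]"
  show "a i = b i"
  proof (cases "i \<le> n")
    case True
    then show ?thesis using arg_cong[OF eq, of "\<lambda>l. l ! i"] by (simp del: upt_Suc)
  next
    case False
    then show ?thesis using assms[OF ab(1)] assms[OF ab(2)] by simp
  qed
qed

text \<open>An infinite set is equipotent with its square. Nested pairing is injective on lists of a
  fixed length, and pairing once more with a code of the length separates the lengths.\<close>

lemma inj_list:
  assumes "infinite (UNIV :: 'k set)"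
  shows "\<exists>c :: 'k list \<Rightarrow> 'k. inj c"
proof -
  have "\<exists>p. bij_betw p (UNIV \<times> UNIV :: ('k \<times> 'k) set) (UNIV :: 'k set)"
    unfolding card_of_ordIso by (rule card_of_Times_same_infinite[OF assms])
  then obtain p :: "'k \<times> 'k \<Rightarrow> 'k" where p: "inj p"
    unfolding bij_betw_def by auto
  obtain u :: "nat \<Rightarrow> 'k" where u: "inj u"
    using infinite_countable_subset[OF assms] by blast
  define c where "c = rec_list (u 0) (\<lambda>x _ y. p (x, y))"
  have c: "c [] = u 0" "c (x # xs) = p (x, c xs)" for x xs by (simp_all add: c_def)
  have c_inj: "xs = ys" if "length xs = length ys" "c xs = c ys" for xs ys
    using that by (induction xs ys rule: list_induct2) (auto simp: c dest: injD[OF p])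
  have "inj (\<lambda>xs. p (u (length xs), c xs))"
    by (intro injI) (auto dest!: injD[OF p] dest: injD[OF u] intro: c_inj)
  then show ?thesis by blast
qed

text \<open>Enumerating exponents by \<open>e\<close> turns a finitely supported function into a
  finite list of values: \<open>N\<close> exceeds every index in the support, so entries beyond the
  list are zero and the function can be recovered.\<close>

lemma inj_on_finite_support:
  fixes e :: "'a \<Rightarrow> nat"
  assumes e: "inj_on e E" and k: "infinite (UNIV :: 'k::zero set)"
  shows "\<exists>h :: ('a \<Rightarrow> 'k) \<Rightarrow> 'k. inj_on h {f. finite {a. f a \<noteq> 0} \<and> {a. f a \<noteq> 0} \<subseteq> E}"
proof -
  obtain c :: "'k list \<Rightarrow> 'k" where c: "inj c" using inj_list[OF k] by blast
  define N where "N f = Suc (Max (insert 0 (e ` {a. f a \<noteq> (0::'k)})))" for f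
  define l where "l f = map (\<lambda>m. f (inv_into E e m)) [0..<N f]" for f
  have rec: "f a = (if e a < length (l f) then l f ! e a else 0)"
    if f: "finite {a. f a \<noteq> 0}" and a: "a \<in> E" for f a
  proof (cases "f a = 0")
    case True
    then show ?thesis using e a by (simp add: l_def)
  next
    case False
    then have "e a < N f" unfolding N_def using f by (simp add: less_Suc_eq_le)
    then show ?thesis using e a by (simp add: l_def)
  qed
  have "inj_on (\<lambda>f. c (l f)) {f. finite {a. f a \<noteq> 0} \<and> {a. f a \<noteq> 0} \<subseteq> E}"
  proof (rule inj_onI, rule ext)
    fix f g a
    assume f: "f \<in> {f. finite {a. f a \<noteq> 0} \<and> {a. f a \<noteq> 0} \<subseteq> E}"
      and g: "g \<in> {f. finite {a. f a \<noteq> 0} \<and> {a. f a \<noteq> 0} \<subseteq> E}" and eq: "c (l f) = c (l g)"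
    have l: "l f = l g" using injD[OF c eq] .
    show "f a = g a"
    proof (cases "a \<in> E")
      case True
      then show ?thesis using rec[of f a] rec[of g a] f g l by simp
    next
      case False
      then have "f a = 0" "g a = 0" using f g by auto
      then show ?thesis by simp
    qed
  qed
  then show ?thesis by blast
qed

text \<open>Exponents vanishing beyond \<open>n\<close> are countable, so finitely supported
  functions on them are coded first by scalars and then, through \<open>i0\<close>, by elements of
  the universe.\<close>

lemma exists_coding:
  fixes i0 :: "'k::field_char_0 \<Rightarrow> 'm"
  assumes "inj i0" "\<And>a. a \<in> E \<Longrightarrow> \<forall>i>n. a i = 0"
  shows "\<exists>h :: ((nat \<Rightarrow> int) \<Rightarrow> 'k) \<Rightarrow> 'm. inj_on h {f. finite {a. f a \<noteq> 0} \<and> {a. f a \<noteq> 0} \<subseteq> E}"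
proof -
  have "inj_on (\<lambda>a. to_nat (map a [0..<Suc n])) E"
    using comp_inj_on[OF inj_on_map_list[OF assms(2)] inj_on_subset[OF inj_to_nat subset_UNIV]]
    by (simp only: comp_def)
  from inj_on_finite_support[OF this infinite_UNIV_char_0]
  obtain h :: "((nat \<Rightarrow> int) \<Rightarrow> 'k) \<Rightarrow> 'k" where h: "inj_on h {f. finite {a. f a \<noteq> 0} \<and> {a. f a \<noteq> 0} \<subseteq> E}"
    by blast
  have "inj_on (i0 \<circ> h) {f. finite {a. f a \<noteq> 0} \<and> {a. f a \<noteq> 0} \<subseteq> E}"
    by (rule comp_inj_on[OF h inj_on_subset[OF assms(1) subset_UNIV]])
  then show ?thesis by blast
qed

section \<open>The two families of nonzero objects without global sections\<close>

lemma (in laurent_module) kernel_nonzero: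
  fixes \<omega> :: "(('k weyl_elt, 'm) module, 'm roof set, ('k weyl_elt, 'm) module, 'm \<Rightarrow> 'm) cat_functor"
  assumes adj: "right_adjoint (DGrmod n d lam) (DQcoh n d lam) (quot_functor n d lam) \<omega>"
    and comb: "\<And>k i a. \<lbrakk>i \<le> n; a \<in> E; (\<Sum>i\<le>n. of_nat (d i) * (\<alpha> i + of_int (a i))) = lam + of_nat (k * d i);
      \<And>j. j \<le> n \<Longrightarrow> j \<noteq> i \<Longrightarrow> a(i := a i - int k, j := a j + int k) \<in> E\<rbrakk> \<Longrightarrow> False"
  shows "\<exists>A\<in>Ob (ker_global_sections n d lam \<omega>). \<not> zero_object (DQcoh n d lam) A"
  by (rule nonzero_object_without_sections[OF B.euler_object_axioms adj B_torsion_free B_nonzero])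
    (rule B_no_sections[OF comb[folded wt_def]]; assumption)

text \<open>Outside \<open>\<A>\<close> the polynomial ring itself has no sections of degree \<open>\<lambda>\<close>; here \<open>1 \<le> n\<close> is used,
  since sections on the complement of the origin then extend.\<close>

lemma kernel_nonzero_polynomial:
  fixes lam :: "'k::field_char_0"
    and \<omega> :: "(('k weyl_elt, 'm) module, 'm roof set, ('k weyl_elt, 'm) module, 'm \<Rightarrow> 'm) cat_functor"
  assumes n: "1 \<le> n" and d_pos: "\<And>i. i \<le> n \<Longrightarrow> 0 < d i" and inj: "\<exists>f :: 'k \<Rightarrow> 'm. inj f"
    and adj: "right_adjoint (DGrmod n d lam) (DQcoh n d lam) (quot_functor n d lam) \<omega>"
    and lam: "lam \<in> \<int>" "lam \<notin> of_int ` weight_span n d"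
  shows "\<exists>A\<in>Ob (ker_global_sections n d lam \<omega>). \<not> zero_object (DQcoh n d lam) A"
proof -
  define E :: "(nat \<Rightarrow> int) set" where "E = {a. (\<forall>i\<le>n. 0 \<le> a i) \<and> (\<forall>i>n. a i = 0)}"
  obtain h :: "((nat \<Rightarrow> int) \<Rightarrow> 'k) \<Rightarrow> 'm"
    where h: "inj_on h {f. finite {a. f a \<noteq> 0} \<and> {a. f a \<noteq> 0} \<subseteq> E}"
    using exists_coding[of _ E n] inj by (auto simp: E_def)
  obtain l where l: "lam = of_int l" using lam(1) by (auto elim: Ints_cases)
  have wt: "(\<Sum>i\<le>n. of_nat (d i) * (0 + of_int (a i))) = (of_int (\<Sum>i\<le>n. int (d i) * a i) :: 'k)" for a
    by simp
  interpret laurent_module n d lam "\<lambda>_. 0" E h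
  proof unfold_locales
    show "E \<noteq> {}" unfolding E_def by (auto intro: exI[of _ "\<lambda>_. 0"])
  next
    fix a i assume "a \<in> E" "i \<le> n" "0 + of_int (a i) \<noteq> (0::'k)"
    \<comment> \<open>The monomials that would leave \<open>E\<close> have exponent zero at
      \<open>i\<close> and are killed by the derivation.\<close>
    moreover from this have "a i \<ge> 1" by (auto simp: E_def order_le_less dest!: spec[of _ i])
    ultimately show "a(i := a i - 1) \<in> E" by (auto simp: E_def)
  next
    fix a
    show "\<exists>k. (\<Sum>i\<le>n. of_nat (d i) * (0 + of_int (a i))) = lam + of_int k"
      unfolding wt l by (intro exI[of _ "(\<Sum>i\<le>n. int (d i) * a i) - l"]) simp
  qed (use d_pos h in \<open>auto simp: E_def\<close>)
  show ?thesis
  proof (rule kernel_nonzero[OF adj])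
    fix k i a
    assume i: "i \<le> n" and a: "a \<in> E"
      and w: "(\<Sum>i\<le>n. of_nat (d i) * (0 + of_int (a i))) = lam + of_nat (k * d i)"
      and sh: "\<And>j. j \<le> n \<Longrightarrow> j \<noteq> i \<Longrightarrow> a(i := a i - int k, j := a j + int k) \<in> E"
    \<comment> \<open>A second index exists since \<open>n\<close> is positive. Membership of the
      shifted exponent in \<open>E\<close> then shows that lowering \<open>a\<close> by
      \<open>k\<close> at \<open>i\<close> keeps it nonnegative.\<close>
    obtain j where j: "j \<le> n" "j \<noteq> i" using n i by (metis le_zero_eq not_one_le_zero order_refl zero_le)
    then have nonneg: "a i - int k \<ge> 0" using sh[OF j] i by (auto simp: E_def dest!: spec[of _ i])
    \<comment> \<open>The lowered exponent. Its weight is exactly \<open>lam\<close>, which would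
      put \<open>lam\<close> into the span of the weights.\<close>
    define b where "b = (\<lambda>j. nat (if j = i then a i - int k else a j))"
    have "(\<Sum>j\<le>n. int (b j * d j)) = (\<Sum>j\<le>n. int (d j) * a j - (if j = i then int k * int (d i) else 0))"
      using a nonneg by (intro sum.cong) (auto simp: b_def E_def algebra_simps)
    also have "\<dots> = (\<Sum>j\<le>n. int (d j) * a j) - int k * int (d i)"
      using i by (simp add: sum_subtractf)
    finally have b: "(\<Sum>j\<le>n. int (b j * d j)) = (\<Sum>j\<le>n. int (d j) * a j) - int k * int (d i)" .
    have "of_int (\<Sum>j\<le>n. int (d j) * a j) = lam + of_nat (k * d i)" using w unfolding wt .
    then have "lam = of_int (\<Sum>j\<le>n. int (b j * d j))" unfolding b by simp
    then show False using lam(2) unfolding weight_span_def by blast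
  qed
qed

text \<open>All Euler eigenvalues of the module are \<open>lam + 1\<close> modulo the gcd of the
  weights, whereas a numerator over a power of \<open>X i\<close> would need an eigenvalue congruent
  to \<open>lam\<close>. The gcd would then divide one.\<close>

lemma kernel_nonzero_gcd:
  fixes lam :: "'k::field_char_0"
    and \<omega> :: "(('k weyl_elt, 'm) module, 'm roof set, ('k weyl_elt, 'm) module, 'm \<Rightarrow> 'm) cat_functor"
  assumes d_pos: "\<And>i. i \<le> n \<Longrightarrow> 0 < d i" and inj: "\<exists>f :: 'k \<Rightarrow> 'm. inj f"
    and adj: "right_adjoint (DGrmod n d lam) (DQcoh n d lam) (quot_functor n d lam) \<omega>"
    and gcd: "Gcd (d ` {..n}) \<noteq> 1"
  shows "\<exists>A\<in>Ob (ker_global_sections n d lam \<omega>). \<not> zero_object (DQcoh n d lam) A"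
proof -
  define E :: "(nat \<Rightarrow> int) set" where "E = {a. \<forall>i>n. a i = 0}"
  \<comment> \<open>The fractional exponent at index zero shifts every weight by
    \<open>lam + 1\<close>.\<close>
  define \<alpha> where "\<alpha> = (\<lambda>i::nat. if i = 0 then (lam + 1) / of_nat (d 0) else 0)"
  obtain h :: "((nat \<Rightarrow> int) \<Rightarrow> 'k) \<Rightarrow> 'm"
    where h: "inj_on h {f. finite {a. f a \<noteq> 0} \<and> {a. f a \<noteq> 0} \<subseteq> E}"
    using exists_coding[of _ E n] inj by (auto simp: E_def)
  have "(\<Sum>i\<le>n. of_nat (d i) * \<alpha> i) = (\<Sum>i\<le>n. if i = 0 then lam + 1 else 0)"
    using d_pos[of 0] by (intro sum.cong) (auto simp: \<alpha>_def)
  then have \<alpha>: "(\<Sum>i\<le>n. of_nat (d i) * \<alpha> i) = lam + 1" by simp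
  have wt: "(\<Sum>i\<le>n. of_nat (d i) * (\<alpha> i + of_int (a i))) = lam + of_int (1 + (\<Sum>i\<le>n. int (d i) * a i))" for a
    by (simp add: distrib_left sum.distrib \<alpha>)
  interpret laurent_module n d lam \<alpha> E h
  proof unfold_locales
    show "E \<noteq> {}" unfolding E_def by (auto intro: exI[of _ "\<lambda>_. 0"])
  next
    fix a
    show "\<exists>k. (\<Sum>i\<le>n. of_nat (d i) * (\<alpha> i + of_int (a i))) = lam + of_int k" unfolding wt by blast
  qed (use d_pos h in \<open>auto simp: E_def\<close>)
  show ?thesis
  proof (rule kernel_nonzero[OF adj])
    fix k i a
    assume i: "i \<le> n" and w: "(\<Sum>i\<le>n. of_nat (d i) * (\<alpha> i + of_int (a i))) = lam + of_nat (k * d i)"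
    have dvd: "int (Gcd (d ` {..n})) dvd int (d j)" if "j \<le> n" for j
      using that by (subst int_dvd_int_iff) (auto intro: Gcd_dvd)
    have "of_int (1 + (\<Sum>i\<le>n. int (d i) * a i)) = (of_int (int (k * d i)) :: 'k)"
      using w unfolding wt by simp
    then have "1 + (\<Sum>i\<le>n. int (d i) * a i) = int (k * d i)" by (simp only: of_int_eq_iff)
    then have "1 = int k * int (d i) - (\<Sum>i\<le>n. int (d i) * a i)" by simp
    moreover have "int (Gcd (d ` {..n})) dvd int k * int (d i) - (\<Sum>i\<le>n. int (d i) * a i)"
      using dvd i by (intro dvd_diff dvd_sum dvd_mult2 dvd_mult) auto
    ultimately have "int (Gcd (d ` {..n})) dvd 1" by simp
    then show False using gcd by simp
  qed
qed

theorem theorem16: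
  fixes n :: nat and d :: "nat \<Rightarrow> nat"
    and lam :: "'k::{alg_closed_field, field_char_0}"
    and \<omega> :: "(('k weyl_elt, 'm) module, 'm roof set, ('k weyl_elt, 'm) module, 'm \<Rightarrow> 'm) cat_functor"
  assumes "1 \<le> n"
    and "\<And>i. i \<le> n \<Longrightarrow> 0 < d i"
    and "\<And>i j. i \<le> j \<Longrightarrow> j \<le> n \<Longrightarrow> d i \<le> d j"
    and "\<exists>f :: 'k \<Rightarrow> 'm. inj f"
    and "right_adjoint (DGrmod n d lam) (DQcoh n d lam) (quot_functor n d lam) \<omega>"
  shows "Gcd (d ` {..n}) = 1 \<and> lam \<in> (UNIV - \<int>) \<union> of_int ` weight_span n d
    \<longleftrightarrow> (\<forall>A \<in> Ob (ker_global_sections n d lam \<omega>). zero_object (DQcoh n d lam) A)"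
proof
  assume "Gcd (d ` {..n}) = 1 \<and> lam \<in> (UNIV - \<int>) \<union> of_int ` weight_span n d"
  then show "\<forall>A \<in> Ob (ker_global_sections n d lam \<omega>). zero_object (DQcoh n d lam) A"
    using zero_object_of_no_sections[OF assms(2,5)] by blast
next
  assume "\<forall>A \<in> Ob (ker_global_sections n d lam \<omega>). zero_object (DQcoh n d lam) A"
  then show "Gcd (d ` {..n}) = 1 \<and> lam \<in> (UNIV - \<int>) \<union> of_int ` weight_span n d"
    using kernel_nonzero_gcd[OF assms(2,4,5)] kernel_nonzero_polynomial[OF assms(1,2,4,5)] by blast
qed

end
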